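(* Suppose that $H$ is the fundamental group of a finite graph of groups whose vertex groups are all finitely generated and virtually abelian. If $H$ has (VRC) then there is a finite index normal subgroup $G$ of $H$ admitting a free action on a finite dimensional CAT($0$) cube complex $\mathcal{X}$, which is the product of the Bass-Serre tree for $H$ (corresponding to the given splitting of $H$ as the fundamental group of a graph of groups) with the standard cubulation of the Euclidean $n$-space, for some $n \in \mathbb{N}\cup\{0\}$.
   Context: A subgroup $H$ of a group $G$ is a virtual retract of $G$ if there is a finite index subgroup $K$ of $G$ such that $H \subseteq K$ and there is a homomorphism $\rho: K \to H$ whose restriction to $H$ is the identity map. A group has property (VRC) if every cyclic subgroup is a virtual retract. Actions on cube complexes are by cubical automorphisms. Graphs are in the sense of Serre: a graph $\Gamma$ has a vertex set $V\Gamma$, an edge set $E\Gamma$, an inversion map $e \mapsto \overline{e}$ on $E\Gamma$ with $\overline{e} \ne e$ and $\overline{\overline{e}} = e$, and incidence maps $\alpha,\omega: E\Gamma \to V\Gamma$ with $\omega(\overline{e}) = \alpha(e)$. An orientation is a decomposition $E\Gamma = E\Gamma^+ \sqcup E\Gamma^-$ with $E\Gamma^- = \{\overline{e} \mid e \in E\Gamma^+\}$. A finite graph of groups $(\mathcal{G},\Gamma)$ consists of a non-empty finite connected graph $\Gamma$, vertex groups $G_v$ ($v \in V\Gamma$), edge groups $G_e$ ($e \in E\Gamma$) with $G_e = G_{\overline{e}}$, and monomorphisms $\alpha_e: G_e \to G_{\alpha(e)}$ ($e \in E\Gamma$); put $\omega_e := \alpha_{\overline{e}}: G_e \to G_{\omega(e)}$.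 Given a maximal tree $T$ in $\Gamma$ and an orientation, its fundamental group is the group generated by all $G_v$, $v \in V\Gamma$, and free letters $t_e$, $e \in E\Gamma^+$, subject to the relations of the vertex groups, $t_e\, \omega_e(a)\, t_e^{-1} = \alpha_e(a)$ for all $e \in E\Gamma^+$, $a \in G_e$, and $t_f = 1$ for all $f \in ET \cap E\Gamma^+$; up to isomorphism it does not depend on the choices. The fundamental group acts on the corresponding Bass-Serre tree so that vertex (edge) stabilizers are the conjugates of the vertex (respectively, edge) groups. *)

theory Defs
  imports "HOL-Analysis.Analysis" "HOL-Algebra.Generated_Groups" "HOL-Algebra.Group_Action"
begin

section \<open>Virtual retracts and property (VRC)\<close>

definition finite_index_subgroup :: "'a set \<Rightarrow> ('a, 'm) monoid_scheme \<Rightarrow> bool" where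
  "finite_index_subgroup K G \<longleftrightarrow> subgroup K G \<and> finite (rcosets\<^bsub>G\<^esub> K)"

definition virtual_retract :: "'a set \<Rightarrow> ('a, 'm) monoid_scheme \<Rightarrow> bool" where
  "virtual_retract A G \<longleftrightarrow> subgroup A G \<and>
     (\<exists>K \<rho>. finite_index_subgroup K G \<and> A \<subseteq> K \<and>
        \<rho> \<in> hom (G\<lparr>carrier := K\<rparr>) (G\<lparr>carrier := A\<rparr>) \<and> (\<forall>a\<in>A. \<rho> a = a))"

definition VRC :: "('a, 'm) monoid_scheme \<Rightarrow> bool" where
  "VRC G \<longleftrightarrow> (\<forall>x\<in>carrier G. virtual_retract (generate G {x}) G)"

definition finitely_generated_group :: "('a, 'm) monoid_scheme \<Rightarrow> bool" where
  "finitely_generated_group G \<longleftrightarrow>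
     (\<exists>S. finite S \<and> S \<subseteq> carrier G \<and> generate G S = carrier G)"

definition virtually_abelian :: "('a, 'm) monoid_scheme \<Rightarrow> bool" where
  "virtually_abelian G \<longleftrightarrow>
     (\<exists>A. finite_index_subgroup A G \<and> comm_group (G\<lparr>carrier := A\<rparr>))"


section \<open>Group presentations\<close>

text \<open>
  Words over the alphabet of generators \<open>S\<close> and their formal inverses: the letter \<open>(x, True)\<close>
  stands for \<open>x\<close> and \<open>(x, False)\<close> for its inverse.  A relation is a pair of words
  (left and right hand side).
\<close>

type_synonym 'x word = "('x \<times> bool) list"

inductive pres_eq :: "'x set \<Rightarrow> ('x word \<times> 'x word) set \<Rightarrow> 'x word \<Rightarrow> 'x word \<Rightarrow> bool"
  for S :: "'x set" and R :: "('x word \<times> 'x word) set"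
where
  refl: "w \<in> lists (S \<times> UNIV) \<Longrightarrow> pres_eq S R w w"
| sym: "pres_eq S R u v \<Longrightarrow> pres_eq S R v u"
| trans: "pres_eq S R u v \<Longrightarrow> pres_eq S R v w \<Longrightarrow> pres_eq S R u w"
| cong: "pres_eq S R u v \<Longrightarrow> a \<in> lists (S \<times> UNIV) \<Longrightarrow> b \<in> lists (S \<times> UNIV) \<Longrightarrow>
    pres_eq S R (a @ u @ b) (a @ v @ b)"
| cancel: "x \<in> S \<Longrightarrow> pres_eq S R [(x, s), (x, \<not> s)] []"
| rel: "(u, v) \<in> R \<Longrightarrow> pres_eq S R u v"

definition pres_class :: "'x set \<Rightarrow> ('x word \<times> 'x word) set \<Rightarrow> 'x word \<Rightarrow> 'x word set" where
  "pres_class S R w = {w'. pres_eq S R w w'}"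

definition presented_group ::
  "'x set \<Rightarrow> ('x word \<times> 'x word) set \<Rightarrow> 'x word set monoid" where
  "presented_group S R =
     \<lparr>carrier = pres_class S R ` lists (S \<times> UNIV),
      mult = (\<lambda>A B. \<Union>u\<in>A. \<Union>v\<in>B. pres_class S R (u @ v)),
      one = pres_class S R []\<rparr>"


section \<open>Graphs in the sense of Serre\<close>

record ('v, 'e) sgraph =
  Vert :: "'v set"
  Edge :: "'e set"
  rev_edge :: "'e \<Rightarrow> 'e"
  src :: "'e \<Rightarrow> 'v"
  tgt :: "'e \<Rightarrow> 'v"

definition serre_graph :: "('v, 'e) sgraph \<Rightarrow> bool" where
  "serre_graph \<Gamma> \<longleftrightarrow>
     (\<forall>e\<in>Edge \<Gamma>.
        rev_edge \<Gamma> e \<in> Edge \<Gamma> \<and> rev_edge \<Gamma> e \<noteq> e \<and> rev_edge \<Gamma> (rev_edge \<Gamma> e) = e \<and>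
        src \<Gamma> e \<in> Vert \<Gamma> \<and> tgt \<Gamma> e \<in> Vert \<Gamma> \<and> tgt \<Gamma> (rev_edge \<Gamma> e) = src \<Gamma> e)"

fun edge_path :: "('v, 'e) sgraph \<Rightarrow> 'v \<Rightarrow> 'e list \<Rightarrow> 'v \<Rightarrow> bool" where
  "edge_path \<Gamma> u [] v \<longleftrightarrow> u \<in> Vert \<Gamma> \<and> u = v"
| "edge_path \<Gamma> u (e # es) v \<longleftrightarrow> e \<in> Edge \<Gamma> \<and> src \<Gamma> e = u \<and> edge_path \<Gamma> (tgt \<Gamma> e) es v"

definition connected_graph :: "('v, 'e) sgraph \<Rightarrow> bool" where
  "connected_graph \<Gamma> \<longleftrightarrow> (\<forall>u\<in>Vert \<Gamma>. \<forall>v\<in>Vert \<Gamma>. \<exists>es. edge_path \<Gamma> u es v)"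

text \<open>
  A circuit is a simple closed path of positive length.  The condition that no edge is followed by
  its inverse only matters for length two; loops and pairs of parallel edges are circuits.
\<close>

definition circuit :: "('v, 'e) sgraph \<Rightarrow> 'e list \<Rightarrow> bool" where
  "circuit \<Gamma> es \<longleftrightarrow> es \<noteq> [] \<and> (\<exists>u. edge_path \<Gamma> u es u) \<and> distinct (map (src \<Gamma>) es) \<and>
     (\<forall>i. Suc i < length es \<longrightarrow> es ! Suc i \<noteq> rev_edge \<Gamma> (es ! i))"

definition tree_graph :: "('v, 'e) sgraph \<Rightarrow> bool" where
  "tree_graph \<Gamma> \<longleftrightarrow> serre_graph \<Gamma> \<and> Vert \<Gamma> \<noteq> {} \<and> connected_graph \<Gamma> \<and> (\<forall>es. \<not> circuit \<Gamma> es)"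

definition subtree :: "('v, 'e) sgraph \<Rightarrow> ('v, 'e) sgraph \<Rightarrow> bool" where
  "subtree T \<Gamma> \<longleftrightarrow> tree_graph T \<and>
     (\<exists>V E. V \<subseteq> Vert \<Gamma> \<and> E \<subseteq> Edge \<Gamma> \<and> T = \<Gamma>\<lparr>Vert := V, Edge := E\<rparr>)"

definition maximal_tree :: "('v, 'e) sgraph \<Rightarrow> ('v, 'e) sgraph \<Rightarrow> bool" where
  "maximal_tree T \<Gamma> \<longleftrightarrow> subtree T \<Gamma> \<and>
     (\<forall>T'. subtree T' \<Gamma> \<and> Vert T \<subseteq> Vert T' \<and> Edge T \<subseteq> Edge T' \<longrightarrow> T' = T)"

definition orientation :: "('v, 'e) sgraph \<Rightarrow> 'e set \<Rightarrow> bool" where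
  "orientation \<Gamma> P \<longleftrightarrow> P \<union> rev_edge \<Gamma> ` P = Edge \<Gamma> \<and> P \<inter> rev_edge \<Gamma> ` P = {}"


section \<open>Graphs of groups, their fundamental groups and Bass-Serre trees\<close>

text \<open>
  \<open>emono \<GG> e\<close> is the monomorphism from the edge group of \<open>e\<close> to the vertex group at \<open>src e\<close>;
  the monomorphism to the vertex group at \<open>tgt e\<close> is \<open>emono \<GG> (rev_edge e)\<close>.
\<close>

record ('v, 'e, 'g, 'k) graph_of_groups =
  graph :: "('v, 'e) sgraph"
  vgroup :: "'v \<Rightarrow> 'g monoid"
  egroup :: "'e \<Rightarrow> 'k monoid"
  emono :: "'e \<Rightarrow> 'k \<Rightarrow> 'g"

definition finite_graph_of_groups :: "('v, 'e, 'g, 'k) graph_of_groups \<Rightarrow> bool" where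
  "finite_graph_of_groups \<GG> \<longleftrightarrow>
     serre_graph (graph \<GG>) \<and> Vert (graph \<GG>) \<noteq> {} \<and> connected_graph (graph \<GG>) \<and>
     finite (Vert (graph \<GG>)) \<and> finite (Edge (graph \<GG>)) \<and>
     (\<forall>v\<in>Vert (graph \<GG>). group (vgroup \<GG> v)) \<and>
     (\<forall>e\<in>Edge (graph \<GG>). group (egroup \<GG> e) \<and>
        egroup \<GG> (rev_edge (graph \<GG>) e) = egroup \<GG> e \<and>
        emono \<GG> e \<in> hom (egroup \<GG> e) (vgroup \<GG> (src (graph \<GG>) e)) \<and>
        inj_on (emono \<GG> e) (carrier (egroup \<GG> e)))"

datatype ('v, 'e, 'g) fgen = VElt 'v 'g | Stable 'e

text \<open>
  The parameters \<open>T\<close> and \<open>P\<close> are the maximal tree and the set of positively oriented edges.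
  The relations of a vertex group are given by its multiplication table.
\<close>

definition fund_gens ::
  "('v, 'e, 'g, 'k) graph_of_groups \<Rightarrow> 'e set \<Rightarrow> ('v, 'e, 'g) fgen set" where
  "fund_gens \<GG> P =
     {VElt v g | v g. v \<in> Vert (graph \<GG>) \<and> g \<in> carrier (vgroup \<GG> v)} \<union> Stable ` P"

definition fund_rels ::
  "('v, 'e, 'g, 'k) graph_of_groups \<Rightarrow> ('v, 'e) sgraph \<Rightarrow> 'e set \<Rightarrow>
     (('v, 'e, 'g) fgen word \<times> ('v, 'e, 'g) fgen word) set" where
  "fund_rels \<GG> T P =
     {([(VElt v g, True), (VElt v h, True)], [(VElt v (g \<otimes>\<^bsub>vgroup \<GG> v\<^esub> h), True)]) | v g h.
        v \<in> Vert (graph \<GG>) \<and> g \<in> carrier (vgroup \<GG> v) \<and> h \<in> carrier (vgroup \<GG> v)} \<union>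
     {([(Stable e, True),
        (VElt (tgt (graph \<GG>) e) (emono \<GG> (rev_edge (graph \<GG>) e) a), True),
        (Stable e, False)],
       [(VElt (src (graph \<GG>) e) (emono \<GG> e a), True)]) | e a.
        e \<in> P \<and> a \<in> carrier (egroup \<GG> e)} \<union>
     {([(Stable f, True)], []) | f. f \<in> Edge T \<inter> P}"

definition fundamental_group ::
  "('v, 'e, 'g, 'k) graph_of_groups \<Rightarrow> ('v, 'e) sgraph \<Rightarrow> 'e set \<Rightarrow>
     ('v, 'e, 'g) fgen word set monoid" where
  "fundamental_group \<GG> T P = presented_group (fund_gens \<GG> P) (fund_rels \<GG> T P)"

definition fund_class ::
  "('v, 'e, 'g, 'k) graph_of_groups \<Rightarrow> ('v, 'e) sgraph \<Rightarrow> 'e set \<Rightarrow>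
     ('v, 'e, 'g) fgen word \<Rightarrow> ('v, 'e, 'g) fgen word set" where
  "fund_class \<GG> T P = pres_class (fund_gens \<GG> P) (fund_rels \<GG> T P)"

text \<open>Images in the fundamental group of the vertex groups, and of the edge groups under the
  monomorphisms \<open>emono \<GG> e\<close>.\<close>

definition vertex_subgroup where
  "vertex_subgroup \<GG> T P v = (\<lambda>g. fund_class \<GG> T P [(VElt v g, True)]) ` carrier (vgroup \<GG> v)"

definition edge_subgroup where
  "edge_subgroup \<GG> T P e =
     (\<lambda>a. fund_class \<GG> T P [(VElt (src (graph \<GG>) e) (emono \<GG> e a), True)]) ` carrier (egroup \<GG> e)"

text \<open>For a negative edge, the stable letter is the inverse of that of the opposite edge.\<close>

definition stable_letter where
  "stable_letter \<GG> T P e =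
     (if e \<in> P then fund_class \<GG> T P [(Stable e, True)]
      else fund_class \<GG> T P [(Stable (rev_edge (graph \<GG>) e), False)])"

text \<open>
  The Bass-Serre tree.  Write \<open>H\<close> for the fundamental group, \<open>H_v\<close> and \<open>H_e\<close> for the subgroups just
  defined, \<open>t_e\<close> for the stable letter and \<open>e'\<close> for the edge opposite to \<open>e\<close>, so that
  \<open>t_e H_e' t_e\<inverse> = H_e\<close>.  The vertices are the left cosets \<open>g H_v\<close>, the edges are the left cosets
  \<open>g H_e\<close>; the edge \<open>g H_e\<close> goes from \<open>g H_(src e)\<close> to \<open>g t_e H_(tgt e)\<close> and its inverse is the coset
  \<open>g H_e t_e = g t_e H_e'\<close>.  The group \<open>H\<close> acts by left multiplication, with the conjugates of
  the \<open>H_v\<close> and \<open>H_e\<close> as stabilizers.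
\<close>

definition bass_serre_tree ::
  "('v, 'e, 'g, 'k) graph_of_groups \<Rightarrow> ('v, 'e) sgraph \<Rightarrow> 'e set \<Rightarrow>
     ('v \<times> ('v, 'e, 'g) fgen word set set, 'e \<times> ('v, 'e, 'g) fgen word set set) sgraph" where
  "bass_serre_tree \<GG> T P =
     (let \<Gamma> = graph \<GG>; H = fundamental_group \<GG> T P in
      \<lparr>Vert = {(v, g <#\<^bsub>H\<^esub> vertex_subgroup \<GG> T P v) | v g. v \<in> Vert \<Gamma> \<and> g \<in> carrier H},
       Edge = {(e, g <#\<^bsub>H\<^esub> edge_subgroup \<GG> T P e) | e g. e \<in> Edge \<Gamma> \<and> g \<in> carrier H},
       rev_edge = (\<lambda>(e, C). (rev_edge \<Gamma> e, C #>\<^bsub>H\<^esub> stable_letter \<GG> T P e)),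
       src = (\<lambda>(e, C). (src \<Gamma> e, C <#>\<^bsub>H\<^esub> vertex_subgroup \<GG> T P (src \<Gamma> e))),
       tgt = (\<lambda>(e, C). (tgt \<Gamma> e,
                (C #>\<^bsub>H\<^esub> stable_letter \<GG> T P e) <#>\<^bsub>H\<^esub> vertex_subgroup \<GG> T P (tgt \<Gamma> e)))\<rparr>)"

text \<open>The lift to the Bass-Serre tree of the orientation \<open>P\<close>.\<close>

definition bass_serre_pos ::
  "('v, 'e, 'g, 'k) graph_of_groups \<Rightarrow> ('v, 'e) sgraph \<Rightarrow> 'e set \<Rightarrow>
     ('e \<times> ('v, 'e, 'g) fgen word set set) set" where
  "bass_serre_pos \<GG> T P = {x \<in> Edge (bass_serre_tree \<GG> T P). fst x \<in> P}"


section \<open>CAT(0) spaces\<close>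

definition geodesic_path :: "'p set \<Rightarrow> ('p \<Rightarrow> 'p \<Rightarrow> real) \<Rightarrow> 'p \<Rightarrow> 'p \<Rightarrow> (real \<Rightarrow> 'p) \<Rightarrow> bool" where
  "geodesic_path M d x y c \<longleftrightarrow> c 0 = x \<and> c (d x y) = y \<and> c ` {0..d x y} \<subseteq> M \<and>
     (\<forall>s\<in>{0..d x y}. \<forall>t\<in>{0..d x y}. d (c s) (c t) = \<bar>s - t\<bar>)"

text \<open>
  In the comparison inequality it suffices to take points on two sides issuing from a common corner
  \<open>x\<close>, since \<open>x, y, z\<close> are arbitrary.  The comparison triangle has corners \<open>x', y', z'\<close>, and \<open>p', q'\<close>
  are the comparison points of \<open>c s\<close> and \<open>c' t\<close>.
\<close>

definition CAT0_space :: "'p set \<Rightarrow> ('p \<Rightarrow> 'p \<Rightarrow> real) \<Rightarrow> bool" where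
  "CAT0_space M d \<longleftrightarrow> Metric_space M d \<and>
     (\<forall>x\<in>M. \<forall>y\<in>M. \<exists>c. geodesic_path M d x y c) \<and>
     (\<forall>x\<in>M. \<forall>y\<in>M. \<forall>z\<in>M. \<forall>c c'. geodesic_path M d x y c \<longrightarrow> geodesic_path M d x z c' \<longrightarrow>
        (\<forall>(x' :: real^2) y' z'. dist x' y' = d x y \<longrightarrow> dist y' z' = d y z \<longrightarrow> dist x' z' = d x z \<longrightarrow>
          (\<forall>s\<in>{0..d x y}. \<forall>t\<in>{0..d x z}.
            \<forall>p'\<in>closed_segment x' y'. \<forall>q'\<in>closed_segment x' z'.
              dist x' p' = s \<longrightarrow> dist x' q' = t \<longrightarrow> d (c s) (c' t) \<le> dist p' q')))"


section \<open>Cube complexes\<close>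

text \<open>
  Points of Euclidean \<open>n\<close>-space are functions \<open>nat \<Rightarrow> real\<close> vanishing from index \<open>n\<close> on.
  A cubical complex (Bridson and Haefliger, Definition I.7.32) is a quotient of a disjoint union of
  unit cubes; it is encoded by its set of points and by the characteristic maps of its cubes, each
  together with the dimension of the cube.  Only the restriction of a characteristic map to the unit
  cube is relevant.  Faces of cubes are not required to be listed as cubes again.
\<close>

definition euclidean_points :: "nat \<Rightarrow> (nat \<Rightarrow> real) set" where
  "euclidean_points n = {x. \<forall>i\<ge>n. x i = 0}"

definition euclidean_dist :: "nat \<Rightarrow> (nat \<Rightarrow> real) \<Rightarrow> (nat \<Rightarrow> real) \<Rightarrow> real" where
  "euclidean_dist n x y = L2_set (\<lambda>i. x i - y i) {..<n}"

definition unit_cube :: "nat \<Rightarrow> (nat \<Rightarrow> real) set" where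
  "unit_cube n = {x \<in> euclidean_points n. \<forall>i<n. 0 \<le> x i \<and> x i \<le> 1}"

definition cube_face :: "nat \<Rightarrow> (nat \<Rightarrow> real) set \<Rightarrow> bool" where
  "cube_face n F \<longleftrightarrow>
     (\<exists>I \<epsilon>. I \<subseteq> {..<n} \<and> (\<forall>i\<in>I. \<epsilon> i \<in> {0, 1}) \<and> F = {x \<in> unit_cube n. \<forall>i\<in>I. x i = \<epsilon> i})"

definition cube_isometry ::
  "nat \<Rightarrow> (nat \<Rightarrow> real) set \<Rightarrow> nat \<Rightarrow> (nat \<Rightarrow> real) set \<Rightarrow> ((nat \<Rightarrow> real) \<Rightarrow> (nat \<Rightarrow> real)) \<Rightarrow> bool" where
  "cube_isometry m A n B h \<longleftrightarrow> bij_betw h A B \<and>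
     (\<forall>x\<in>A. \<forall>y\<in>A. euclidean_dist n (h x) (h y) = euclidean_dist m x y)"

record 'p cube_complex =
  points :: "'p set"
  cubes :: "(nat \<times> ((nat \<Rightarrow> real) \<Rightarrow> 'p)) set"

definition cubical_complex :: "'p cube_complex \<Rightarrow> bool" where
  "cubical_complex K \<longleftrightarrow>
     points K = (\<Union>(n, \<phi>)\<in>cubes K. \<phi> ` unit_cube n) \<and>
     (\<forall>(n, \<phi>)\<in>cubes K. inj_on \<phi> (unit_cube n)) \<and>
     (\<forall>(m, \<phi>)\<in>cubes K. \<forall>(n, \<psi>)\<in>cubes K.
        \<phi> ` unit_cube m \<inter> \<psi> ` unit_cube n \<noteq> {} \<longrightarrow>
        (\<exists>F F' h. cube_face m F \<and> cube_face n F' \<and> cube_isometry m F n F' h \<and>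
           (\<forall>x\<in>unit_cube m. \<forall>y\<in>unit_cube n. \<phi> x = \<psi> y \<longleftrightarrow> x \<in> F \<and> y = h x)))"

definition finite_dimensional :: "'p cube_complex \<Rightarrow> bool" where
  "finite_dimensional K \<longleftrightarrow> (\<exists>N. \<forall>(n, \<phi>)\<in>cubes K. n \<le> N)"

text \<open>
  \<open>cube_string K p q l\<close>: there is a string (piecewise linear path) of length \<open>l\<close> from \<open>p\<close> to \<open>q\<close>,
  consecutive points of which lie in a common cube.  The intrinsic distance is the infimum of these
  lengths.  Its value \<open>0\<close> for points not joined by a string is immaterial, as \<open>CAT0_cube_complex\<close>
  requires any two points to be joined.
\<close>

inductive cube_string :: "'p cube_complex \<Rightarrow> 'p \<Rightarrow> 'p \<Rightarrow> real \<Rightarrow> bool" for K where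
  nil: "p \<in> points K \<Longrightarrow> cube_string K p p 0"
| step: "(n, \<phi>) \<in> cubes K \<Longrightarrow> x \<in> unit_cube n \<Longrightarrow> y \<in> unit_cube n \<Longrightarrow>
    cube_string K (\<phi> y) q l \<Longrightarrow> cube_string K (\<phi> x) q (euclidean_dist n x y + l)"

definition intrinsic_dist :: "'p cube_complex \<Rightarrow> 'p \<Rightarrow> 'p \<Rightarrow> real" where
  "intrinsic_dist K p q =
     (if \<exists>l. cube_string K p q l then Inf {l. cube_string K p q l} else 0)"

definition CAT0_cube_complex :: "'p cube_complex \<Rightarrow> bool" where
  "CAT0_cube_complex K \<longleftrightarrow> cubical_complex K \<and>
     (\<forall>p\<in>points K. \<forall>q\<in>points K. \<exists>l. cube_string K p q l) \<and>
     CAT0_space (points K) (intrinsic_dist K)"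

definition cubical_map :: "'p cube_complex \<Rightarrow> ('p \<Rightarrow> 'p) \<Rightarrow> bool" where
  "cubical_map K f \<longleftrightarrow> (\<forall>(m, \<phi>)\<in>cubes K. \<exists>(n, \<psi>)\<in>cubes K. \<exists>F h.
     cube_face n F \<and> cube_isometry m (unit_cube m) n F h \<and> (\<forall>x\<in>unit_cube m. f (\<phi> x) = \<psi> (h x)))"

definition cubical_automorphism :: "'p cube_complex \<Rightarrow> ('p \<Rightarrow> 'p) \<Rightarrow> bool" where
  "cubical_automorphism K f \<longleftrightarrow> bij_betw f (points K) (points K) \<and>
     cubical_map K f \<and> cubical_map K (inv_into (points K) f)"

definition free_cubical_action ::
  "('a, 'm) monoid_scheme \<Rightarrow> 'p cube_complex \<Rightarrow> ('a \<Rightarrow> 'p \<Rightarrow> 'p) \<Rightarrow> bool" where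
  "free_cubical_action G K \<phi> \<longleftrightarrow> group_action G (points K) \<phi> \<and>
     (\<forall>g\<in>carrier G. cubical_automorphism K (\<phi> g)) \<and>
     (\<forall>g\<in>carrier G. \<forall>p\<in>points K. \<phi> g p = p \<longrightarrow> g = \<one>\<^bsub>G\<^esub>)"

text \<open>
  A Serre graph with orientation \<open>P\<close> as a one-dimensional cube complex: one edge \<open>[0,1]\<close> for every
  pair of mutually inverse edges, parametrized from source to target of the positive one.
\<close>

datatype ('v, 'e) graph_point = VPoint 'v | EPoint 'e real

definition edge_chart :: "('v, 'e) sgraph \<Rightarrow> 'e \<Rightarrow> (nat \<Rightarrow> real) \<Rightarrow> ('v, 'e) graph_point" where
  "edge_chart \<Gamma> e x =
     (if x 0 = 0 then VPoint (src \<Gamma> e) else if x 0 = 1 then VPoint (tgt \<Gamma> e) else EPoint e (x 0))"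

definition graph_complex :: "('v, 'e) sgraph \<Rightarrow> 'e set \<Rightarrow> ('v, 'e) graph_point cube_complex" where
  "graph_complex \<Gamma> P =
     \<lparr>points = VPoint ` Vert \<Gamma> \<union> {EPoint e t | e t. e \<in> P \<and> 0 < t \<and> t < 1},
      cubes = {(0, \<lambda>x. VPoint v) | v. v \<in> Vert \<Gamma>} \<union> {(1, edge_chart \<Gamma> e) | e. e \<in> P}\<rparr>"

text \<open>The standard cubulation of Euclidean \<open>n\<close>-space, by the integer translates of the unit cube.\<close>

definition euclidean_complex :: "nat \<Rightarrow> (nat \<Rightarrow> real) cube_complex" where
  "euclidean_complex n =
     \<lparr>points = euclidean_points n,
      cubes = {(n, \<lambda>x i. x i + of_int (z i)) | z :: nat \<Rightarrow> int. \<forall>i\<ge>n. z i = 0}\<rparr>"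

text \<open>The product of an \<open>m\<close>-cube and an \<open>n\<close>-cube is an \<open>m + n\<close>-cube, with the coordinates of the
  first factor preceding those of the second.\<close>

definition product_complex ::
  "'p cube_complex \<Rightarrow> 'q cube_complex \<Rightarrow> ('p \<times> 'q) cube_complex" where
  "product_complex K L =
     \<lparr>points = points K \<times> points L,
      cubes = {(m + n, \<lambda>x. (\<phi> (\<lambda>i. if i < m then x i else 0), \<psi> (\<lambda>i. x (m + i)))) | m \<phi> n \<psi>.
                 (m, \<phi>) \<in> cubes K \<and> (n, \<psi>) \<in> cubes L}\<rparr>"

end

theory Submission
  imports Defs
begin

text \<open>
  A finitely generated virtually abelian subgroup \<open>V\<close> of a group \<open>H\<close> with (VRC) is detected by virtual
  characters: there are a finite index subgroup \<open>K\<close> of \<open>H\<close> and finitely many homomorphisms \<open>K \<rightarrow> \<int>\<close>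
  without common kernel on \<open>V \<inter> K\<close>.  For an abelian \<open>V\<close> one adds the generators one at a time; the
  elements that are not yet detected then form a cyclic group, to which (VRC) applies.  For the vertex
  groups, pass to a normal finite index subgroup \<open>G\<close> and add the finitely many conjugates of the characters:
  this gives a homomorphism \<open>G \<rightarrow> \<int>\<^sup>n\<close> that is injective on all vertex stabilizers of \<open>G\<close> in the Bass-Serre
  tree, so that \<open>G\<close> acts freely on the product of the tree with \<open>\<real>\<^sup>n\<close>, on which \<open>\<int>\<^sup>n\<close> acts by translations.

  The Bass-Serre graph has no circuits because the fundamental group acts on the normal forms of reduced
  words, as in van der Waerden's proof of the normal form theorem for free products.  An edge of a tree
  has two sides, and sending a point to its positions with respect to all edges embeds the tree
  isometrically into an \<open>\<ell>\<^sup>1\<close>-space.  The CAT(0) inequality is proved in the form of Stewart's inequality,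
  which is additive in \<open>\<ell>\<^sup>2\<close>-products.
\<close>

section \<open>Finite index subgroups and virtual characters\<close>

text \<open>An element of \<open>G\<close> that fixes a point of the product lies in a vertex
  stabilizer and translates the Euclidean factor by zero, so freeness is injectivity of the
  homomorphism on these stabilizers. There are infinitely many of them, but they are conjugates of
  finitely many vertex groups, and an integer character is unchanged by conjugation with elements of
  its own domain. One conjugate of a character for each coset of the domain therefore serves all of
  them. Torsion is invisible to integer characters. It is removed by (VRC) as well: the kernel of a
  retraction onto a finite cyclic subgroup has finite index and meets that subgroup trivially. On
  the geometric side, CAT(0) is required of the intrinsic distance, an infimum over strings of
  cubes, which is hard to handle directly. It is identified with an explicit distance: the charts
  are isometric for it, so no string is shorter, and strings that follow geodesics attain
  it.\<close>

lemma (in group) finite_index_subgroupI: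
  assumes "subgroup K G" "finite (f ` carrier G)"
    and "\<And>x y. x \<in> carrier G \<Longrightarrow> y \<in> carrier G \<Longrightarrow> f x = f y \<Longrightarrow> x \<otimes> inv y \<in> K"
  shows "finite_index_subgroup K G"
proof -
  \<comment> \<open>Equal values of \<open>f\<close> mean equal cosets, so there are at most as many
    cosets as values. The index bounds below come from suitable choices of \<open>f\<close>.\<close>
  have "K #> x = K #> y" if "x \<in> carrier G" "y \<in> carrier G" "f x = f y" for x y
    using assms(1) assms(3)[OF that] that
    by (metis group.repr_independence group_l_invI is_group l_inv_ex subgroup.rcos_module_rev)
  then have *: "K #> x = K #> y \<or> f x \<noteq> f y" if "x \<in> carrier G" "y \<in> carrier G" for x y
    using that by blast
  have "rcosets K = (\<lambda>x. K #> x) ` carrier G" by (auto simp: RCOSETS_def)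
  also have "\<dots> \<subseteq> (\<lambda>c. K #> (inv_into (carrier G) f c)) ` (f ` carrier G)"
  proof
    fix C assume "C \<in> (\<lambda>x. K #> x) ` carrier G"
    then obtain x where x: "x \<in> carrier G" "C = K #> x" by auto
    have "f (inv_into (carrier G) f (f x)) = f x" "inv_into (carrier G) f (f x) \<in> carrier G"
      using x(1) by (simp_all add: f_inv_into_f inv_into_into)
    then have "C = K #> inv_into (carrier G) f (f x)" using * x by metis
    then show "C \<in> (\<lambda>c. K #> (inv_into (carrier G) f c)) ` (f ` carrier G)" using x(1) by blast
  qed
  finally have "finite (rcosets K)" using assms(2) finite_surj by blast
  then show ?thesis using assms(1) by (simp add: finite_index_subgroup_def)
qed

lemma (in group) finite_index_cosets_finite:
  assumes "finite_index_subgroup K G"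
  shows "finite ((\<lambda>x. K #> x) ` carrier G)"
proof -
  have "(\<lambda>x. K #> x) ` carrier G = rcosets K" by (auto simp: RCOSETS_def)
  then show ?thesis using assms by (simp add: finite_index_subgroup_def)
qed

lemma (in group) rcos_eqD:
  assumes "subgroup K G" "x \<in> carrier G" "y \<in> carrier G" "K #> x = K #> y"
  shows "x \<otimes> inv y \<in> K"
  using assms by (metis rcos_self subgroup.rcos_module_imp is_group)

lemma (in group) finite_index_Int:
  assumes "finite_index_subgroup K G" "finite_index_subgroup L G"
  shows "finite_index_subgroup (K \<inter> L) G"
proof (rule finite_index_subgroupI)
  have s: "subgroup K G" "subgroup L G" using assms by (auto simp: finite_index_subgroup_def)
  show "subgroup (K \<inter> L) G" using s by (rule subgroups_Inter_pair)
  have "(\<lambda>x. (K #> x, L #> x)) ` carrier G \<subseteq>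
      (\<lambda>x. K #> x) ` carrier G \<times> (\<lambda>x. L #> x) ` carrier G" by auto
  then show "finite ((\<lambda>x. (K #> x, L #> x)) ` carrier G)"
    using assms finite_index_cosets_finite by (meson finite_SigmaI finite_subset)
  show "x \<otimes> inv y \<in> K \<inter> L" if "x \<in> carrier G" "y \<in> carrier G"
    "(K #> x, L #> x) = (K #> y, L #> y)" for x y
    using that s rcos_eqD by auto
qed

lemma (in group) finite_index_carrier: "finite_index_subgroup (carrier G) G"
  by (rule finite_index_subgroupI[where f = "\<lambda>_. ()"]) (auto simp: subgroup_self)

text \<open>Intersecting with \<open>carrier G\<close> takes care of the empty family, whose
  intersection is the whole type.\<close>

lemma (in group) finite_index_INT:
  assumes "finite I" "\<And>i. i \<in> I \<Longrightarrow> finite_index_subgroup (K i) G"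
  shows "finite_index_subgroup (carrier G \<inter> (\<Inter>i\<in>I. K i)) G"
  using assms
proof (induction I)
  case empty then show ?case by (simp add: finite_index_carrier)
next
  case (insert i I)
  have "carrier G \<inter> (\<Inter>i\<in>insert i I. K i) = K i \<inter> (carrier G \<inter> (\<Inter>i\<in>I. K i))" by auto
  then show ?case using insert finite_index_Int by auto
qed

lemma (in group) inv_cancel:
  assumes "a \<in> carrier G" "b \<in> carrier G"
  shows "inv a \<otimes> (a \<otimes> b) = b" "a \<otimes> (inv a \<otimes> b) = b"
  using assms by (simp_all add: m_assoc[symmetric])

section \<open>Normal cores, and kernels of maps onto finite groups\<close>

definition normal_core :: "('a, 'm) monoid_scheme \<Rightarrow> 'a set \<Rightarrow> 'a set" where
  "normal_core G K =
     {x \<in> carrier G. \<forall>g\<in>carrier G. g \<otimes>\<^bsub>G\<^esub> x \<otimes>\<^bsub>G\<^esub> inv\<^bsub>G\<^esub> g \<in> K}"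

context group
begin

lemma normal_core_subset: "normal_core G K \<subseteq> K"
proof
  fix x assume "x \<in> normal_core G K"
  then have "x \<in> carrier G" "\<one> \<otimes> x \<otimes> inv \<one> \<in> K" unfolding normal_core_def by blast+
  then show "x \<in> K" by simp
qed

lemma normal_core_normal:
  assumes K: "subgroup K G"
  shows "normal_core G K \<lhd> G"
proof -
  have "subgroup (normal_core G K) G"
  proof (rule subgroupI)
    show "normal_core G K \<subseteq> carrier G" by (auto simp: normal_core_def)
    have "\<one> \<in> normal_core G K" using subgroup.one_closed[OF K] by (auto simp: normal_core_def)
    then show "normal_core G K \<noteq> {}" by blast
  next
    fix a assume a: "a \<in> normal_core G K"
    then have ac: "a \<in> carrier G" by (auto simp: normal_core_def)
    have "g \<otimes> inv a \<otimes> inv g \<in> K" if g: "g \<in> carrier G" for g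
    proof -
      have "inv (g \<otimes> a \<otimes> inv g) \<in> K"
        using a g subgroup.m_inv_closed[OF K] by (auto simp: normal_core_def)
      then show ?thesis using g ac by (simp add: inv_mult_group m_assoc)
    qed
    then show "inv a \<in> normal_core G K" using ac by (auto simp: normal_core_def)
  next
    fix a b assume a: "a \<in> normal_core G K" and b: "b \<in> normal_core G K"
    then have c: "a \<in> carrier G" "b \<in> carrier G" by (auto simp: normal_core_def)
    have "g \<otimes> (a \<otimes> b) \<otimes> inv g \<in> K" if g: "g \<in> carrier G" for g
    proof -
      have "(g \<otimes> a \<otimes> inv g) \<otimes> (g \<otimes> b \<otimes> inv g) \<in> K"
        using a b g subgroup.m_closed[OF K] by (auto simp: normal_core_def)
      moreover have "(g \<otimes> a \<otimes> inv g) \<otimes> (g \<otimes> b \<otimes> inv g) = g \<otimes> (a \<otimes> b) \<otimes> inv g"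
        using g c by (simp add: m_assoc inv_cancel)
      ultimately show ?thesis by simp
    qed
    then show "a \<otimes> b \<in> normal_core G K" using c by (auto simp: normal_core_def)
  qed
  moreover have "x \<otimes> a \<otimes> inv x \<in> normal_core G K"
    if x: "x \<in> carrier G" and a: "a \<in> normal_core G K" for x a
  proof -
    have ac: "a \<in> carrier G" using a by (auto simp: normal_core_def)
    have "g \<otimes> (x \<otimes> a \<otimes> inv x) \<otimes> inv g \<in> K" if g: "g \<in> carrier G" for g
    proof -
      have "(g \<otimes> x) \<otimes> a \<otimes> inv (g \<otimes> x) \<in> K" using a g x by (auto simp: normal_core_def)
      then show ?thesis using g x ac by (simp add: inv_mult_group m_assoc)
    qed
    then show ?thesis using ac x by (auto simp: normal_core_def)
  qed
  ultimately show ?thesis by (simp add: normal_inv_iff)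
qed

text \<open>The group permutes the finite set of right cosets of \<open>K\<close> by right
  multiplication, and \<open>?f\<close> records this permutation. Two elements inducing the same
  permutation differ by an element of every conjugate of \<open>K\<close>.\<close>

lemma normal_core_finite_index:
  assumes K: "finite_index_subgroup K G"
  shows "finite_index_subgroup (normal_core G K) G"
proof (rule finite_index_subgroupI)
  have sK: "subgroup K G" using K by (simp add: finite_index_subgroup_def)
  show "subgroup (normal_core G K) G" using normal_core_normal[OF sK] normal_imp_subgroup by blast
  let ?f = "\<lambda>x. \<lambda>C\<in>rcosets K. C #> x"
  have "?f ` carrier G \<subseteq> (rcosets K) \<rightarrow>\<^sub>E (rcosets K)"
  proof -
    have "C #> x \<in> rcosets K" if "x \<in> carrier G" "C \<in> rcosets K" for x C
      using that subgroup.subset[OF sK] by (auto simp: RCOSETS_def coset_mult_assoc)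
    then show ?thesis by (auto simp: PiE_iff)
  qed
  moreover have "finite ((rcosets K) \<rightarrow>\<^sub>E (rcosets K))"
    using K by (simp add: finite_index_subgroup_def finite_PiE)
  ultimately show "finite (?f ` carrier G)" by (rule finite_subset)
  fix x y assume x: "x \<in> carrier G" and y: "y \<in> carrier G" and eq: "?f x = ?f y"
  have "g \<otimes> (x \<otimes> inv y) \<otimes> inv g \<in> K" if g: "g \<in> carrier G" for g
  proof -
    have "K #> g \<in> rcosets K" using g by (auto simp: RCOSETS_def)
    then have "K #> g #> x = K #> g #> y" using fun_cong[OF eq, of "K #> g"] by simp
    then have "K #> (g \<otimes> x) = K #> (g \<otimes> y)"
      using g x y subgroup.subset[OF sK] by (simp add: coset_mult_assoc)
    then have "(g \<otimes> x) \<otimes> inv (g \<otimes> y) \<in> K" using rcos_eqD[OF sK] g x y by simp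
    then show ?thesis using g x y by (simp add: inv_mult_group m_assoc)
  qed
  then show "x \<otimes> inv y \<in> normal_core G K" using x y by (auto simp: normal_core_def)
qed

text \<open>Write \<open>x = k s\<close> with \<open>s\<close> the chosen representative of the
  coset of \<open>x\<close> and \<open>k\<close> in \<open>K\<close>. The coset together with
  \<open>\<rho> k\<close> determines \<open>x\<close> up to the kernel, and only finitely many such
  pairs exist.\<close>

lemma finite_index_kernel:
  assumes K: "finite_index_subgroup K G" and \<rho>: "\<rho> \<in> hom (G\<lparr>carrier := K\<rparr>) (G\<lparr>carrier := A\<rparr>)"
    and A: "subgroup A G" "finite A"
  shows "finite_index_subgroup {x \<in> K. \<rho> x = \<one>} G"
proof -
  have sK: "subgroup K G" using K by (simp add: finite_index_subgroup_def)
  interpret h: group_hom "G\<lparr>carrier := K\<rparr>" "G\<lparr>carrier := A\<rparr>" \<rho>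
    using \<rho> sK A by (simp add: group_hom_def group_hom_axioms_def subgroup.subgroup_is_group is_group)
  have inK: "inv\<^bsub>G\<lparr>carrier := K\<rparr>\<^esub> x = inv x" if "x \<in> K" for x using sK that by (simp add: m_inv_consistent)
  have "subgroup (kernel (G\<lparr>carrier := K\<rparr>) (G\<lparr>carrier := A\<rparr>) \<rho>) (G\<lparr>carrier := K\<rparr>)"
    by (rule h.subgroup_kernel)
  then have sub: "subgroup {x \<in> K. \<rho> x = \<one>} G"
    using incl_subgroup[OF sK] by (simp add: kernel_def)
  define r where "r C = (SOME x. x \<in> carrier G \<and> K #> x = C)" for C
  have r: "r (K #> x) \<in> carrier G \<and> K #> r (K #> x) = K #> x" if "x \<in> carrier G" for x
    unfolding r_def by (rule someI[where x = x]) (use that in simp)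
  let ?f = "\<lambda>x. (K #> x, \<rho> (x \<otimes> inv (r (K #> x))))"
  have in_K: "x \<otimes> inv (r (K #> x)) \<in> K" if "x \<in> carrier G" for x
    using r[OF that] that rcos_eqD[OF sK] by metis
  show ?thesis
  proof (rule finite_index_subgroupI[OF sub])
    have "?f ` carrier G \<subseteq> ((\<lambda>x. K #> x) ` carrier G) \<times> A"
      using in_K h.hom_closed by auto
    then show "finite (?f ` carrier G)"
      using finite_index_cosets_finite[OF K] A(2) by (meson finite_SigmaI finite_subset)
    fix x y assume x: "x \<in> carrier G" and y: "y \<in> carrier G" and e: "?f x = ?f y"
    define s where "s = r (K #> x)"
    have s: "s \<in> carrier G" "s = r (K #> y)" using r[OF x] e by (auto simp: s_def)
    have xs: "x \<otimes> inv s \<in> K" and ys: "y \<otimes> inv s \<in> K"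
      using in_K[OF x] in_K[OF y] s s_def by auto
    have eq: "\<rho> (x \<otimes> inv s) = \<rho> (y \<otimes> inv s)" using e s s_def by auto
    have m: "(x \<otimes> inv s) \<otimes> inv (y \<otimes> inv s) = x \<otimes> inv y"
      using x y s(1) by (simp add: inv_mult_group m_assoc inv_cancel)
    have "\<rho> ((x \<otimes> inv s) \<otimes> inv (y \<otimes> inv s)) = \<rho> (x \<otimes> inv s) \<otimes> \<rho> (inv (y \<otimes> inv s))"
      using h.hom_mult[of "x \<otimes> inv s" "inv (y \<otimes> inv s)"] xs ys subgroup.m_inv_closed[OF sK] by simp
    also have "\<rho> (inv (y \<otimes> inv s)) = inv (\<rho> (y \<otimes> inv s))"
      using h.hom_inv[of "y \<otimes> inv s"] ys inK h.hom_closed[of "y \<otimes> inv s"] A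
      by (simp add: m_inv_consistent)
    finally have "\<rho> (x \<otimes> inv y) = \<one>"
      using eq m h.hom_closed[of "y \<otimes> inv s"] ys subgroup.mem_carrier[OF A(1)] by simp
    moreover have "x \<otimes> inv y \<in> K"
      using m xs ys subgroup.m_closed[OF sK] subgroup.m_inv_closed[OF sK] by metis
    ultimately show "x \<otimes> inv y \<in> {x \<in> K. \<rho> x = \<one>}" by simp
  qed
qed

end

text \<open>The members of \<open>F\<close> are total functions constrained only on
  \<open>K\<close>, so families belonging to different subgroups can be united once the subgroups
  are intersected. With \<open>F\<close> empty the last clause says that \<open>A\<close> meets
  \<open>K\<close> trivially, which is how finite cyclic groups are treated.\<close>

definition detects :: "('a, 'm) monoid_scheme \<Rightarrow> 'a set \<Rightarrow> 'a set \<Rightarrow> ('a \<Rightarrow> int) set \<Rightarrow> bool" where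
  "detects G A K F \<longleftrightarrow> finite_index_subgroup K G \<and> finite F \<and>
     (\<forall>f\<in>F. \<forall>x\<in>K. \<forall>y\<in>K. f (x \<otimes>\<^bsub>G\<^esub> y) = f x + f y) \<and>
     (\<forall>x\<in>A \<inter> K. (\<forall>f\<in>F. f x = 0) \<longrightarrow> x = \<one>\<^bsub>G\<^esub>)"

context group
begin

lemma additive_zero:
  fixes f :: "'a \<Rightarrow> int"
  assumes "\<And>x y. x \<in> K \<Longrightarrow> y \<in> K \<Longrightarrow> f (x \<otimes> y) = f x + f y" "subgroup K G"
  shows "f \<one> = 0" and "x \<in> K \<Longrightarrow> f (inv x) = - f x"
proof -
  show 1: "f \<one> = 0" using assms(1)[of \<one> \<one>] subgroup.one_closed[OF assms(2)] by simp
  show "f (inv x) = - f x" if "x \<in> K"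
    using assms(1)[of x "inv x"] 1 that subgroup.m_inv_closed[OF assms(2)]
      subgroup.mem_carrier[OF assms(2)] by simp
qed

lemma common_kernel_subgroup:
  assumes sA: "subgroup A G" and K: "subgroup K G"
    and add: "\<forall>f\<in>F. \<forall>x\<in>K. \<forall>y\<in>K. f (x \<otimes> y) = (f x + f y :: int)"
  shows "subgroup {x \<in> A \<inter> K. \<forall>f\<in>F. f x = 0} G" (is "subgroup ?D G")
proof (rule subgroupI)
  have a: "f (x \<otimes> y) = f x + f y" if "f \<in> F" "x \<in> K" "y \<in> K" for f x y using add that by blast
  have zero: "f \<one> = 0" if "f \<in> F" for f using additive_zero(1)[OF a[OF that] K] .
  have minus: "f (inv x) = - f x" if "f \<in> F" "x \<in> K" for f x
    using additive_zero(2)[OF a[OF that(1)] K that(2)] .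
  show "?D \<subseteq> carrier G" using subgroup.subset[OF sA] by blast
  show "?D \<noteq> {}"
    using subgroup.one_closed[OF sA] subgroup.one_closed[OF K] zero by blast
  fix x assume x: "x \<in> ?D"
  then have x': "x \<in> A" "x \<in> K" by blast+
  have xf: "f x = 0" if "f \<in> F" for f using x that by blast
  have "f (inv x) = 0" if "f \<in> F" for f using minus[OF that x'(2)] xf[OF that] by simp
  then show "inv x \<in> ?D"
    using x' subgroup.m_inv_closed[OF sA] subgroup.m_inv_closed[OF K] by blast
  fix y assume y: "y \<in> ?D"
  then have y': "y \<in> A" "y \<in> K" by blast+
  have yf: "f y = 0" if "f \<in> F" for f using y that by blast
  have "f (x \<otimes> y) = 0" if "f \<in> F" for f using a[OF that x'(2) y'(2)] xf[OF that] yf[OF that] by simp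
  then show "x \<otimes> y \<in> ?D"
    using x' y' subgroup.m_closed[OF sA] subgroup.m_closed[OF K] by blast
qed

text \<open>Read off through exponents, a retraction onto an infinite cyclic group is an integer
  character that vanishes on no nontrivial element of that group. For a finite cyclic group no
  character is used: the kernel of the retraction has finite index and meets the group
  trivially.\<close>

lemma detects_cyclic:
  assumes "VRC G" and d: "d \<in> carrier G"
  shows "\<exists>K F. detects G (generate G {d}) K F"
proof -
  let ?A = "generate G {d}"
  obtain K \<rho> where sA: "subgroup ?A G" and K: "finite_index_subgroup K G" and AK: "?A \<subseteq> K"
    and \<rho>: "\<rho> \<in> hom (G\<lparr>carrier := K\<rparr>) (G\<lparr>carrier := ?A\<rparr>)" and ra: "\<forall>a\<in>?A. \<rho> a = a"
    using assms unfolding VRC_def virtual_retract_def by blast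
  have gen: "?A = {d [^] (k::int) | k. k \<in> UNIV}" by (rule generate_pow[OF d])
  show ?thesis
  proof (cases "inj (\<lambda>k::int. d [^] k)")
    case False
    have "finite ?A"
    proof -
      obtain i j :: int where ij: "d [^] i = d [^] j" "i < j"
        using False unfolding inj_def by (metis linorder_neqE)
      have e: "d [^] (j - i) = \<one>" using ij d by (simp add: int_pow_diff)
      have "d [^] k = d [^] (k mod (j - i))" for k :: int
      proof -
        have "d [^] k = d [^] ((j - i) * (k div (j - i)) + k mod (j - i))" by simp
        also have "\<dots> = (d [^] (j - i)) [^] (k div (j - i)) \<otimes> d [^] (k mod (j - i))"
          using d by (simp only: int_pow_mult int_pow_pow)
        finally show ?thesis using e d by simp
      qed
      moreover have "k mod (j - i) \<in> {0..<j - i}" for k using ij by simp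
      ultimately have "?A \<subseteq> (\<lambda>k::int. d [^] k) ` {0..<j - i}" unfolding gen by blast
      then show ?thesis using finite_surj by blast
    qed
    then have "finite_index_subgroup {x \<in> K. \<rho> x = \<one>} G"
      using finite_index_kernel[OF K \<rho> sA] by blast
    then have "detects G ?A {x \<in> K. \<rho> x = \<one>} {}" using ra by (auto simp: detects_def)
    then show ?thesis by blast
  next
    case True
    define f where "f x = (THE k::int. d [^] k = \<rho> x)" for x
    have f: "d [^] f x = \<rho> x" if "x \<in> K" for x
    proof -
      have "\<rho> x \<in> ?A" using \<rho> that by (auto simp: hom_def)
      then obtain k where "d [^] (k::int) = \<rho> x" using gen by auto
      then show ?thesis unfolding f_def using the_equality[of "\<lambda>k. d [^] k = \<rho> x" k] True
        by (metis injD)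
    qed
    have "detects G ?A K {f}"
      unfolding detects_def
    proof (intro conjI K ballI impI)
      fix g x y assume g: "g \<in> {f}" "x \<in> K" "y \<in> K"
      have xy: "x \<otimes> y \<in> K" using g K by (simp add: finite_index_subgroup_def subgroup.m_closed)
      have "d [^] (f x + f y) = \<rho> x \<otimes> \<rho> y" using g d by (simp add: int_pow_mult f)
      also have "\<dots> = \<rho> (x \<otimes> y)" using \<rho> g by (auto simp: hom_def)
      also have "\<dots> = d [^] f (x \<otimes> y)" using f[OF xy] by simp
      finally have "f x + f y = f (x \<otimes> y)" using True by (simp add: inj_def)
      then show "g (x \<otimes> y) = g x + g y" using g by simp
    next
      fix x assume x: "x \<in> ?A \<inter> K" "\<forall>g\<in>{f}. g x = 0"
      then have "d [^] (0::int) = \<rho> x" using f by force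
      then show "x = \<one>" using ra x by auto
    qed simp
    then show ?thesis by blast
  qed
qed

lemma detects_Int:
  assumes "detects G A K F" "detects G B L F'"
  shows "detects G A (K \<inter> L) (F \<union> F')" "detects G B (K \<inter> L) (F \<union> F')"
  using assms unfolding detects_def by (blast intro: finite_index_Int)+

section \<open>Finitely generated abelian subgroups\<close>

lemma int_subgroup_principal:
  fixes I :: "int set"
  assumes "0 \<in> I" "\<And>i j. i \<in> I \<Longrightarrow> j \<in> I \<Longrightarrow> i - j \<in> I"
  obtains c where "c \<in> I" "\<And>i. i \<in> I \<Longrightarrow> c dvd i"
proof (cases "\<exists>i\<in>I. i > 0")
  case False
  have "i = 0" if "i \<in> I" for i
    using assms(2)[OF assms(1) that] that False by (cases i rule: linorder_cases[of _ 0]) force+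
  then show ?thesis using that[of 0] assms(1) by auto
next
  case True
  define c where "c = (LEAST n::nat. n > 0 \<and> int n \<in> I)"
  have ex: "\<exists>n::nat. n > 0 \<and> int n \<in> I" using True by (metis zero_less_imp_eq_int)
  have c: "c > 0" "int c \<in> I" using LeastI_ex[OF ex] by (auto simp: c_def)
  have least: "c \<le> n" if "n > 0" "int n \<in> I" for n
    unfolding c_def by (rule Least_le) (use that in simp)
  have neg: "- i \<in> I" if "i \<in> I" for i using assms(2)[OF assms(1) that] by simp
  have add: "i + j \<in> I" if "i \<in> I" "j \<in> I" for i j using assms(2)[OF that(1) neg[OF that(2)]] by simp
  have muln: "int c * int n \<in> I" for n
    by (induction n) (auto simp: assms(1) algebra_simps intro: add c)
  have mul: "int c * k \<in> I" for k
    by (cases k rule: int_cases2) (use muln neg in \<open>auto simp del: of_nat_mult\<close>)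
  have "int c dvd i" if "i \<in> I" for i
  proof -
    have r: "i mod int c \<in> I"
      using assms(2)[OF that mul[of "i div int c"]] by (simp add: minus_mult_div_eq_mod)
    have "i mod int c = 0"
    proof (rule ccontr)
      assume n0: "i mod int c \<noteq> 0"
      have "0 \<le> i mod int c" "i mod int c < int c" using c(1) by auto
      then have "nat (i mod int c) > 0" "int (nat (i mod int c)) \<in> I" "nat (i mod int c) < c"
        using n0 r by auto
      then show False using least by (meson not_le)
    qed
    then show ?thesis by auto
  qed
  then show ?thesis using that c(2) by blast
qed

text \<open>The elements of \<open>A \<inter> K\<close> killed by all characters detecting \<open>B\<close> embed into the cyclic group
  \<open>A / B\<close>, so that they form a cyclic group, to which (VRC) applies once more.\<close>

lemma detects_extend:
  assumes VRC: "VRC G" and det: "detects G B K F"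
    and sA: "subgroup A G" and sB: "subgroup B G" "B \<subseteq> A" and a: "a \<in> A"
    and comm: "\<And>x y. x \<in> A \<Longrightarrow> y \<in> A \<Longrightarrow> x \<otimes> y = y \<otimes> x"
    and cover: "\<And>x. x \<in> A \<Longrightarrow> \<exists>b\<in>B. \<exists>i::int. x = b \<otimes> a [^] i"
  shows "\<exists>K F. detects G A K F"
proof -
  have K: "subgroup K G" using det by (simp add: detects_def finite_index_subgroup_def)
  have add: "f (x \<otimes> y) = f x + f y" if "f \<in> F" "x \<in> K" "y \<in> K" for f x y
    using det that by (simp add: detects_def)
  have ac: "A \<subseteq> carrier G" using subgroup.subset[OF sA] .
  define D where "D = {x \<in> A \<inter> K. \<forall>f\<in>F. f x = 0}"
  have Dc: "x \<in> carrier G" if "x \<in> D" for x using that ac by (auto simp: D_def)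
  have sD: "subgroup D G" unfolding D_def by (rule common_kernel_subgroup[OF sA K]) (use add in blast)
  have D1: "\<one> \<in> D" using subgroup.one_closed[OF sD] .
  have Dd: "x \<otimes> inv y \<in> D" if "x \<in> D" "y \<in> D" for x y
    using that by (simp add: subgroup.m_closed[OF sD] subgroup.m_inv_closed[OF sD])
  have DB: "x = \<one>" if "x \<in> D" "x \<in> B" for x using that det by (auto simp: D_def detects_def)
  have pA: "a [^] (i::int) \<in> A" for i
    using subgroup_int_pow_closed[OF sA a] .
  have arep: "a \<in> carrier G" using a ac by auto
  \<comment> \<open>The preimage in \<open>\<int>\<close> of the image of \<open>D\<close> in
    \<open>A / B\<close>, under the map sending \<open>i\<close> to the class of
    \<open>a [^] i\<close>. Its generator \<open>c\<close> is the exponent of the generator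
    \<open>d\<close> of \<open>D\<close>.\<close>
  define I where "I = {i::int. \<exists>b\<in>B. b \<otimes> a [^] i \<in> D}"
  have diff: "(b \<otimes> a [^] i) \<otimes> inv (b' \<otimes> a [^] j) = (b \<otimes> inv b') \<otimes> a [^] (i - j)"
    if "b \<in> B" "b' \<in> B" for b b' and i j :: int
  proof -
    have bA: "b \<in> A" "b' \<in> A" using that sB by auto
    have c: "b \<in> carrier G" "b' \<in> carrier G" using bA ac by auto
    have ci: "inv b' \<in> A" using bA subgroup.m_inv_closed[OF sA] by auto
    have "(b \<otimes> a [^] i) \<otimes> inv (b' \<otimes> a [^] j) = b \<otimes> (a [^] (i - j) \<otimes> inv b')"
      using c arep by (simp add: inv_mult_group m_assoc int_pow_diff)
    also have "a [^] (i - j) \<otimes> inv b' = inv b' \<otimes> a [^] (i - j)" using comm[OF pA ci] .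
    finally show ?thesis using c arep by (simp add: m_assoc)
  qed
  have "0 \<in> I" unfolding I_def using D1 subgroup.one_closed[OF sB(1)] by force
  moreover have "i - j \<in> I" if ij: "i \<in> I" "j \<in> I" for i j
  proof -
    obtain b b' where b: "b \<in> B" "b \<otimes> a [^] i \<in> D" "b' \<in> B" "b' \<otimes> a [^] j \<in> D"
      using ij unfolding I_def by auto
    have "(b \<otimes> inv b') \<otimes> a [^] (i - j) \<in> D" using Dd[OF b(2,4)] diff[OF b(1,3)] by simp
    moreover have "b \<otimes> inv b' \<in> B" using b sB(1) by (simp add: subgroup.m_closed subgroup.m_inv_closed)
    ultimately show ?thesis unfolding I_def by blast
  qed
  ultimately obtain c where c: "c \<in> I" "\<And>i. i \<in> I \<Longrightarrow> c dvd i" using int_subgroup_principal by blast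
  obtain b0 where b0: "b0 \<in> B" "b0 \<otimes> a [^] c \<in> D" using c(1) unfolding I_def by auto
  define d where "d = b0 \<otimes> a [^] c"
  have d: "d \<in> D" "d \<in> carrier G" using b0(2) Dc by (auto simp: d_def)
  have b0A: "b0 \<in> A" "b0 \<in> carrier G" using b0 sB ac by auto
  have dpow: "\<exists>b\<in>B. d [^] k = b \<otimes> a [^] (c * k)" for k :: int
  proof -
    have "d [^] k = b0 [^] k \<otimes> (a [^] c) [^] k"
      unfolding d_def using b0A comm pA arep by (intro int_pow_mult_distrib) auto
    also have "(a [^] c) [^] k = a [^] (c * k)" using arep by (simp add: int_pow_pow)
    finally have "d [^] k = b0 [^] k \<otimes> a [^] (c * k)" .
    moreover have "b0 [^] k \<in> B" using b0(1) sB(1) by (simp add: subgroup_int_pow_closed)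
    ultimately show ?thesis by blast
  qed
  have cyc: "D \<subseteq> generate G {d}"
  proof
    fix x assume x: "x \<in> D"
    then have "x \<in> A" by (simp add: D_def)
    then obtain b i where b: "b \<in> B" "x = b \<otimes> a [^] (i::int)" using cover[of x] by blast
    then have "i \<in> I" using x unfolding I_def by blast
    then obtain k where k: "i = c * k" using c(2) by blast
    obtain b' where b': "b' \<in> B" "d [^] k = b' \<otimes> a [^] (c * k)" using dpow by blast
    have dk: "d [^] k \<in> D" using d(1) sD by (simp add: subgroup_int_pow_closed)
    \<comment> \<open>With equal exponents of \<open>a\<close>, the quotient of the two elements of
      \<open>D\<close> falls into \<open>B\<close>, which meets \<open>D\<close> trivially.\<close>
    have "x \<otimes> inv (d [^] k) = b \<otimes> inv b'"
      using diff[OF b(1) b'(1), of i "c * k"] b b' k subgroup.mem_carrier[OF sB(1)] by simp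
    then have "x \<otimes> inv (d [^] k) \<in> B" using b b' sB(1) by (simp add: subgroup.m_closed subgroup.m_inv_closed)
    then have "x \<otimes> inv (d [^] k) = \<one>" using DB Dd[OF x dk] by blast
    then have "x = d [^] k" using Dc[OF x] Dc[OF dk] by (metis inv_equality inv_inv inv_closed r_inv inv_unique')
    then show "x \<in> generate G {d}" using generate_pow[OF d(2)] by blast
  qed
  obtain L F' where L: "detects G (generate G {d}) L F'" using detects_cyclic[OF VRC d(2)] by blast
  have "detects G A (K \<inter> L) (F \<union> F')"
  proof -
    have 1: "detects G (generate G {d}) (K \<inter> L) (F \<union> F')" using detects_Int(2)[OF det L] .
    have "x = \<one>" if "x \<in> A \<inter> (K \<inter> L)" "\<forall>f\<in>F \<union> F'. f x = 0" for x
    proof -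
      have "x \<in> D" using that by (auto simp: D_def)
      then have "x \<in> generate G {d}" using cyc by blast
      then show ?thesis using 1 that unfolding detects_def by blast
    qed
    then show ?thesis using 1 unfolding detects_def by blast
  qed
  then show ?thesis by blast
qed

lemma generate_insert_commuting:
  assumes S: "insert a S \<subseteq> carrier G"
    and comm: "\<And>x y. x \<in> generate G (insert a S) \<Longrightarrow> y \<in> generate G (insert a S) \<Longrightarrow> x \<otimes> y = y \<otimes> x"
    and x: "x \<in> generate G (insert a S)"
  shows "\<exists>b\<in>generate G S. \<exists>i::int. x = b \<otimes> a [^] i"
proof -
  let ?A = "generate G (insert a S)" and ?B = "generate G S"
  have a: "a \<in> carrier G" "a \<in> ?A" using S by (auto intro: generate.incl)
  have sA: "subgroup ?A G" and sB: "subgroup ?B G" using S by (auto intro!: generate_is_subgroup)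
  have BA: "?B \<subseteq> ?A" by (rule mono_generate) auto
  have pA: "a [^] (i::int) \<in> ?A" for i using a(2) sA by (simp add: subgroup_int_pow_closed)
  show ?thesis using x
  proof (induction rule: generate.induct)
    case one
    have "\<one> = \<one> \<otimes> a [^] (0::int)" by simp
    then show ?case using generate.one by blast
  next
    case (incl h)
    show ?case
    proof (cases "h = a")
      case True
      then have "h = \<one> \<otimes> a [^] (1::int)" using a by (simp add: int_pow_1)
      then show ?thesis using generate.one by blast
    next
      case False
      then have "h \<in> ?B" "h = h \<otimes> a [^] (0::int)" using incl S by (auto intro: generate.incl)
      then show ?thesis by blast
    qed
  next
    case (inv h)
    show ?case
    proof (cases "h = a")
      case True
      then have "inv h = \<one> \<otimes> a [^] (-1::int)" using a by (simp add: int_pow_neg int_pow_1)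
      then show ?thesis using generate.one by blast
    next
      case False
      then have "inv h \<in> ?B" "inv h = inv h \<otimes> a [^] (0::int)" using inv S by (auto intro: generate.inv)
      then show ?thesis by blast
    qed
  next
    case (eng h1 h2)
    then obtain b1 i1 b2 i2 where b: "b1 \<in> ?B" "h1 = b1 \<otimes> a [^] (i1::int)" "b2 \<in> ?B" "h2 = b2 \<otimes> a [^] (i2::int)"
      by blast
    have c: "b1 \<in> carrier G" "b2 \<in> carrier G" using b subgroup.mem_carrier[OF sB] by auto
    have "h1 \<otimes> h2 = b1 \<otimes> (a [^] i1 \<otimes> b2) \<otimes> a [^] i2" using b c a by (simp add: m_assoc)
    also have "a [^] i1 \<otimes> b2 = b2 \<otimes> a [^] i1" using comm pA b BA by blast
    also have "b1 \<otimes> (b2 \<otimes> a [^] i1) \<otimes> a [^] i2 = (b1 \<otimes> b2) \<otimes> a [^] (i1 + i2)"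
      using c a by (simp add: m_assoc int_pow_mult)
    finally show ?case using b subgroup.m_closed[OF sB] by blast
  qed
qed

lemma detects_fg_abelian:
  assumes VRC: "VRC G" and "finite S" "S \<subseteq> carrier G"
    and "\<And>x y. x \<in> generate G S \<Longrightarrow> y \<in> generate G S \<Longrightarrow> x \<otimes> y = y \<otimes> x"
  shows "\<exists>K F. detects G (generate G S) K F"
  using assms(2-)
proof (induction S)
  case empty
  have "detects G (generate G {}) (carrier G) {}"
    using finite_index_carrier by (auto simp: detects_def generate_empty)
  then show ?case by blast
next
  case (insert a S)
  have BA: "generate G S \<subseteq> generate G (insert a S)" by (rule mono_generate) auto
  then have "x \<otimes> y = y \<otimes> x" if "x \<in> generate G S" "y \<in> generate G S" for x y
    using insert.prems(2) that by blast
  then obtain K F where "detects G (generate G S) K F" using insert.IH insert.prems(1) by auto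
  then show ?case
    by (rule detects_extend[OF VRC])
      (use insert BA generate_insert_commuting[OF insert.prems(1)] in
        \<open>auto intro!: generate_is_subgroup generate.incl\<close>)
qed

text \<open>Schreier's argument: passing the letters of a word one at a time through
  \<open>r\<close> writes the word as a product of elements of the finite set \<open>Y\<close>
  followed by a representative. Since \<open>f\<close> may be finer than the partition into cosets,
  several representatives may share a coset. Only \<open>A\<close> itself must have a single one,
  and for this reason \<open>r\<close> is \<open>\<one>\<close> on all of \<open>A\<close>.\<close>

lemma schreier_finitely_generated:
  assumes S: "finite S" "S \<subseteq> carrier G" and sA: "subgroup A G" and AV: "A \<subseteq> generate G S"
    and fin: "finite (f ` generate G S)"
    and fA: "\<And>x y. x \<in> generate G S \<Longrightarrow> y \<in> generate G S \<Longrightarrow> f x = f y \<Longrightarrow> x \<otimes> inv y \<in> A"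
  shows "\<exists>Y. finite Y \<and> Y \<subseteq> carrier G \<and> generate G Y = A"
proof -
  let ?V = "generate G S"
  have sV: "subgroup ?V G" using S generate_is_subgroup by blast
  define r where "r x = (if x \<in> A then \<one> else inv_into ?V f (f x))" for x
  define R where "R = r ` ?V"
  have "R \<subseteq> insert \<one> (inv_into ?V f ` (f ` ?V))" by (auto simp: R_def r_def)
  then have finR: "finite R" using fin by (meson finite_imageI finite_insert finite_subset)
  have rV: "r x \<in> ?V" "x \<otimes> inv (r x) \<in> A" if "x \<in> ?V" for x
  proof -
    have i: "inv_into ?V f (f x) \<in> ?V" "f (inv_into ?V f (f x)) = f x"
      using that by (simp_all add: inv_into_into f_inv_into_f)
    show "r x \<in> ?V" using i generate.one by (auto simp: r_def)
    show "x \<otimes> inv (r x) \<in> A" using fA[OF that i(1)] i that subgroup.mem_carrier[OF sV] by (auto simp: r_def)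
  qed
  define S' where "S' = S \<union> (\<lambda>x. inv x) ` S"
  have S'V: "S' \<subseteq> ?V" by (auto simp: S'_def intro: generate.incl generate.inv)
  define Y where "Y = (\<lambda>(q, s). q \<otimes> s \<otimes> inv (r (q \<otimes> s))) ` (R \<times> S')"
  have RV: "R \<subseteq> ?V" using rV by (auto simp: R_def)
  have YA: "Y \<subseteq> A" unfolding Y_def using RV S'V by (auto intro!: rV(2) subgroup.m_closed[OF sV])
  have Yc: "Y \<subseteq> carrier G" using YA subgroup.subset[OF sA] by blast
  have sY: "subgroup (generate G Y) G" using Yc generate_is_subgroup by blast
  have YgA: "generate G Y \<subseteq> A" using generate_subgroup_incl[OF YA sA] .
  have Vc: "x \<in> carrier G" if "x \<in> ?V" for x using that subgroup.mem_carrier[OF sV] by blast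
  have step: "\<exists>m\<in>generate G Y. \<exists>q\<in>R. x \<otimes> s = m \<otimes> q"
    if ex: "\<exists>m\<in>generate G Y. \<exists>q\<in>R. x = m \<otimes> q" and s: "s \<in> S'" for x s
  proof -
    obtain m q where m: "m \<in> generate G Y" "q \<in> R" "x = m \<otimes> q" using ex by blast
    define q' where "q' = r (q \<otimes> s)"
    have qs: "q \<otimes> s \<in> ?V" using m RV s S'V subgroup.m_closed[OF sV] by auto
    have y: "q \<otimes> s \<otimes> inv q' \<in> generate G Y" unfolding q'_def using m s by (auto simp: Y_def intro: generate.incl)
    have c: "m \<in> carrier G" "q \<in> carrier G" "s \<in> carrier G" "q' \<in> carrier G"
      using m RV s S'V Vc rV(1)[OF qs] subgroup.mem_carrier[OF sY] by (auto simp: q'_def)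
    have "x \<otimes> s = (m \<otimes> (q \<otimes> s \<otimes> inv q')) \<otimes> q'" using c m(3) by (simp add: m_assoc)
    moreover have "m \<otimes> (q \<otimes> s \<otimes> inv q') \<in> generate G Y" using m y subgroup.m_closed[OF sY] by blast
    moreover have "q' \<in> R" unfolding R_def q'_def using qs by blast
    ultimately show ?thesis by blast
  qed
  have 1: "\<exists>m\<in>generate G Y. \<exists>q\<in>R. y \<otimes> x = m \<otimes> q"
    if "x \<in> ?V" "y \<in> carrier G" "\<exists>m\<in>generate G Y. \<exists>q\<in>R. y = m \<otimes> q" for x y
    using that
  proof (induction arbitrary: y rule: generate.induct)
    case one then show ?case by simp
  next
    case (incl h) then show ?case using step[of y h] by (auto simp: S'_def)
  next
    case (inv h) then show ?case using step[of y "inv h"] by (auto simp: S'_def)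
  next
    case (eng h1 h2)
    have c: "h1 \<in> carrier G" "h2 \<in> carrier G" using eng Vc by auto
    then show ?case using eng.IH(2)[of "y \<otimes> h1"] eng.IH(1)[of y] eng.prems by (simp add: m_assoc)
  qed
  have oneR: "\<one> \<in> R"
  proof -
    have "r \<one> = \<one>" using subgroup.one_closed[OF sA] by (simp add: r_def)
    then show ?thesis unfolding R_def using generate.one by (metis imageI)
  qed
  have "A \<subseteq> generate G Y"
  proof
    fix x assume x: "x \<in> A"
    have "\<exists>m\<in>generate G Y. \<exists>q\<in>R. \<one> = m \<otimes> q"
      using oneR generate.one by (metis l_one one_closed)
    moreover have "x \<in> ?V" "x \<in> carrier G" using x AV subgroup.mem_carrier[OF sA] by auto
    ultimately have "\<exists>m\<in>generate G Y. \<exists>q\<in>R. x = m \<otimes> q" using 1[of x \<one>] by simp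
    then obtain m q where m: "m \<in> generate G Y" "q \<in> R" "x = m \<otimes> q" by blast
    have c: "m \<in> carrier G" "q \<in> carrier G" using m RV Vc subgroup.mem_carrier[OF sY] by auto
    \<comment> \<open>The leftover representative \<open>q\<close> lies in \<open>A\<close>. It is
      \<open>r z\<close> for some \<open>z\<close>, which then lies in \<open>A\<close> too, so
      \<open>q\<close> is \<open>\<one>\<close>.\<close>
    have "q = inv m \<otimes> x" using m c by (simp add: inv_solve_left)
    then have "q \<in> A" using m(1) YgA x subgroup.m_closed[OF sA] subgroup.m_inv_closed[OF sA] by blast
    obtain z where z: "z \<in> ?V" "q = r z" using m(2) by (auto simp: R_def)
    have "z \<otimes> inv q \<in> A" using rV(2)[OF z(1)] z(2) by simp
    then have "z \<otimes> inv q \<otimes> q \<in> A" using \<open>q \<in> A\<close> subgroup.m_closed[OF sA] by blast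
    then have "z \<in> A" using c Vc[OF z(1)] by (simp add: m_assoc)
    then have "q = \<one>" using z by (simp add: r_def)
    then show "x \<in> generate G Y" using m c by simp
  qed
  moreover have "finite Y" using finR S by (auto simp: Y_def S'_def)
  ultimately show ?thesis using YgA Yc by blast
qed

text \<open>Characters that detect the abelian subgroup \<open>A\<close> have a common kernel
  \<open>D\<close> in the larger group that meets \<open>A\<close> trivially. As \<open>A\<close>
  has finitely many cosets there, \<open>D\<close> is finite. Each of its nontrivial elements is
  then kept out by one more finite index subgroup, the kernel of a retraction onto the finite cyclic
  group generated by the element.\<close>

lemma detects_fg_virtually_abelian:
  assumes VRC: "VRC G" and S: "finite S" "S \<subseteq> carrier G"
    and sA: "subgroup A G" and AV: "A \<subseteq> generate G S"
    and fin: "finite (f ` generate G S)"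
    and fA: "\<And>x y. x \<in> generate G S \<Longrightarrow> y \<in> generate G S \<Longrightarrow> f x = f y \<Longrightarrow> x \<otimes> inv y \<in> A"
    and comm: "\<And>x y. x \<in> A \<Longrightarrow> y \<in> A \<Longrightarrow> x \<otimes> y = y \<otimes> x"
  shows "\<exists>K F. detects G (generate G S) K F"
proof -
  let ?V = "generate G S"
  have sV: "subgroup ?V G" using S generate_is_subgroup by blast
  obtain Y where Y: "finite Y" "Y \<subseteq> carrier G" "generate G Y = A"
    using schreier_finitely_generated[OF S sA AV fin fA] by blast
  obtain K F where det: "detects G A K F" using detects_fg_abelian[OF VRC Y(1,2)] Y(3) comm by blast
  have K: "subgroup K G" using det by (simp add: detects_def finite_index_subgroup_def)
  have add: "g (x \<otimes> y) = g x + g y" if "g \<in> F" "x \<in> K" "y \<in> K" for g x y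
    using det that by (simp add: detects_def)
  define D where "D = {x \<in> ?V \<inter> K. \<forall>g\<in>F. g x = 0}"
  have sD: "subgroup D G" unfolding D_def by (rule common_kernel_subgroup[OF sV K]) (use add in blast)
  have "inj_on f D"
  proof (rule inj_onI)
    fix x y assume xy: "x \<in> D" "y \<in> D" "f x = f y"
    then have c: "x \<in> carrier G" "y \<in> carrier G" using subgroup.mem_carrier[OF K] by (auto simp: D_def)
    have "x \<otimes> inv y \<in> A" using fA xy by (auto simp: D_def)
    moreover have "x \<otimes> inv y \<in> D"
      using xy by (simp add: subgroup.m_closed[OF sD] subgroup.m_inv_closed[OF sD])
    ultimately have "x \<otimes> inv y = \<one>" using det unfolding detects_def D_def by blast
    then show "x = y" using c by (metis inv_equality inv_inv inv_closed)
  qed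
  then have finD: "finite D" using fin by (metis (no_types, lifting) D_def finite_imageD finite_subset image_mono
      inf.cobounded1 mem_Collect_eq subsetI IntD1)
  have "\<exists>K. finite_index_subgroup K G \<and> d \<notin> K" if d: "d \<in> D" "d \<noteq> \<one>" for d
  proof -
    have dc: "d \<in> carrier G" using d subgroup.mem_carrier[OF K] by (auto simp: D_def)
    have "generate G {d} \<subseteq> D" using generate_subgroup_incl[OF _ sD] d by blast
    then have fd: "finite (generate G {d})" using finD finite_subset by blast
    obtain L \<rho> where sA': "subgroup (generate G {d}) G" and L: "finite_index_subgroup L G"
      and \<rho>: "\<rho> \<in> hom (G\<lparr>carrier := L\<rparr>) (G\<lparr>carrier := generate G {d}\<rparr>)"
      and ra: "\<forall>a\<in>generate G {d}. \<rho> a = a"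
      using VRC dc unfolding VRC_def virtual_retract_def by blast
    have "finite_index_subgroup {x \<in> L. \<rho> x = \<one>} G" using finite_index_kernel[OF L \<rho> sA' fd] .
    moreover have "\<rho> d = d" using ra generate.incl[of d "{d}" G] by blast
    then have "d \<notin> {x \<in> L. \<rho> x = \<one>}" using d by simp
    ultimately show ?thesis by blast
  qed
  then obtain N where N: "\<And>d. d \<in> D - {\<one>} \<Longrightarrow> finite_index_subgroup (N d) G \<and> d \<notin> N d"
    by (metis DiffE singletonI)
  define L where "L = K \<inter> (carrier G \<inter> (\<Inter>d\<in>D - {\<one>}. N d))"
  have fiL: "finite_index_subgroup L G"
    unfolding L_def using det finD N by (intro finite_index_Int finite_index_INT) (auto simp: detects_def)
  have ker: "x = \<one>" if x: "x \<in> ?V \<inter> L" "\<forall>g\<in>F. g x = 0" for x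
  proof (rule ccontr)
    assume "x \<noteq> \<one>"
    then have xD: "x \<in> D - {\<one>}" using x unfolding D_def L_def by blast
    then have "x \<in> N x" using x unfolding L_def by blast
    then show False using N[OF xD] by blast
  qed
  have "detects G ?V L F"
    unfolding detects_def
  proof (intro conjI ballI impI)
    show "finite F" using det by (simp add: detects_def)
    show "f (x \<otimes> y) = f x + f y" if "f \<in> F" "x \<in> L" "y \<in> L" for f x y
      using add that unfolding L_def by blast
    show "x = \<one>" if "x \<in> ?V \<inter> L" "\<forall>f\<in>F. f x = 0" for x using ker that by blast
  qed (rule fiL)
  then show ?thesis by blast
qed

section \<open>All conjugates at once, on a normal subgroup\<close>

lemma additive_conj:
  fixes f :: "'a \<Rightarrow> int"
  assumes N: "N \<lhd> G" and add: "\<And>x y. x \<in> N \<Longrightarrow> y \<in> N \<Longrightarrow> f (x \<otimes> y) = f x + f y"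
    and "g \<in> carrier G" "x \<in> N" "y \<in> N"
  shows "f (inv g \<otimes> (x \<otimes> y) \<otimes> g) = f (inv g \<otimes> x \<otimes> g) + f (inv g \<otimes> y \<otimes> g)"
proof -
  have c: "x \<in> carrier G" "y \<in> carrier G"
    using assms(4,5) subgroup.mem_carrier[OF normal_imp_subgroup[OF N]] by auto
  have "inv g \<otimes> (x \<otimes> y) \<otimes> g = (inv g \<otimes> x \<otimes> g) \<otimes> (inv g \<otimes> y \<otimes> g)"
    using c assms(3) by (simp add: m_assoc inv_cancel)
  then show ?thesis using add normal.inv_op_closed1[OF N assms(3)] assms(4,5) by simp
qed

text \<open>The conjugate of \<open>V\<close> by \<open>g\<close> is detected by the characters
  sending \<open>x\<close> to \<open>f (inv g \<otimes> x \<otimes> g)\<close>, which make sense on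
  a normal subgroup. Conjugating the argument by \<open>h\<close> in \<open>N\<close> changes the
  value by \<open>- f h + f h\<close>, so such a character depends only on the coset of
  \<open>g\<close>, and finitely many characters result.\<close>

lemma detecting_normal_subgroup:
  assumes "finite \<V>" and det: "\<And>V. V \<in> \<V> \<Longrightarrow> \<exists>K F. detects G V K F" and Vc: "\<And>V. V \<in> \<V> \<Longrightarrow> V \<subseteq> carrier G"
  shows "\<exists>N F. N \<lhd> G \<and> finite (rcosets N) \<and> finite F \<and>
    (\<forall>f\<in>F. \<forall>x\<in>N. \<forall>y\<in>N. f (x \<otimes> y) = (f x + f y :: int)) \<and>
    (\<forall>V\<in>\<V>. \<forall>g\<in>carrier G. \<forall>x\<in>N. inv g \<otimes> x \<otimes> g \<in> V \<longrightarrow> (\<forall>f\<in>F. f x = 0) \<longrightarrow> x = \<one>)"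
proof -
  obtain K F where KF: "\<And>V. V \<in> \<V> \<Longrightarrow> detects G V (K V) (F V)" using det by metis
  define M where "M = carrier G \<inter> (\<Inter>V\<in>\<V>. K V)"
  have M: "finite_index_subgroup M G"
    unfolding M_def using assms(1) KF by (intro finite_index_INT) (auto simp: detects_def)
  define N where "N = normal_core G M"
  have N: "N \<lhd> G" "finite_index_subgroup N G"
    unfolding N_def using M normal_core_normal normal_core_finite_index
    by (auto simp: finite_index_subgroup_def)
  have sN: "subgroup N G" using N(1) normal_imp_subgroup by blast
  have NM: "N \<subseteq> M" unfolding N_def by (rule normal_core_subset)
  define E where "E = (\<Union>V\<in>\<V>. F V)"
  have E: "finite E" unfolding E_def using assms(1) KF by (auto simp: detects_def)
  have Eadd: "f (x \<otimes> y) = f x + f y" if "f \<in> E" "x \<in> N" "y \<in> N" for f x y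
  proof -
    obtain V where V: "V \<in> \<V>" "f \<in> F V" using \<open>f \<in> E\<close> by (auto simp: E_def)
    have "x \<in> K V" "y \<in> K V" using that NM V by (auto simp: M_def)
    then show ?thesis using KF[OF V(1)] V(2) by (auto simp: detects_def)
  qed
  \<comment> \<open>The value \<open>0\<close> outside \<open>N\<close> makes the conjugates by two
    elements of one coset equal as functions on the whole type, so that \<open>F'\<close> below is a
    finite set.\<close>
  define c where "c f g x = (if x \<in> N then f (inv g \<otimes> x \<otimes> g) else 0)" for f :: "'a \<Rightarrow> int" and g x
  have cE: "c f g = c f g'" if f: "f \<in> E" and g: "g \<in> carrier G" "g' \<in> carrier G" and eq: "N #> g = N #> g'" for f g g'
  proof
    fix x
    show "c f g x = c f g' x"
    proof (cases "x \<in> N")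
      case x: True
      have xc: "x \<in> carrier G" using subgroup.mem_carrier[OF sN x] .
      have h: "g \<otimes> inv g' \<in> N" using rcos_eqD[OF sN g eq] .
      define h where "h = inv g' \<otimes> (g \<otimes> inv g') \<otimes> g'"
      have hN: "h \<in> N" unfolding h_def using normal.inv_op_closed1[OF N(1) g(2) h] .
      have h': "h = inv g' \<otimes> g" "h \<in> carrier G" unfolding h_def using g by (auto simp: m_assoc)
      have gh: "g = g' \<otimes> h" using h' g by (simp add: inv_solve_left)
      define z where "z = inv g' \<otimes> x \<otimes> g'"
      have zN: "z \<in> N" unfolding z_def using normal.inv_op_closed1[OF N(1) g(2) x] .
      have "inv g \<otimes> x \<otimes> g = inv h \<otimes> z \<otimes> h"
        unfolding gh z_def using g h'(2) xc by (simp add: inv_mult_group m_assoc)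
      moreover have "f (inv h \<otimes> z \<otimes> h) = - f h + f z + f h"
        using Eadd[OF f] hN zN subgroup.m_closed[OF sN] subgroup.m_inv_closed[OF sN]
          additive_zero(2)[OF Eadd[OF f] sN hN] by simp
      ultimately show ?thesis using x by (simp add: c_def z_def)
    qed (simp add: c_def)
  qed
  define F' where "F' = (\<Union>f\<in>E. c f ` carrier G)"
  have "finite (c f ` carrier G)" if f: "f \<in> E" for f
  proof -
    have "c f g \<in> (\<lambda>C. c f (SOME g. g \<in> carrier G \<and> N #> g = C)) ` ((\<lambda>g. N #> g) ` carrier G)"
      if g: "g \<in> carrier G" for g
    proof -
      have "(SOME h. h \<in> carrier G \<and> N #> h = N #> g) \<in> carrier G \<and>
         N #> (SOME h. h \<in> carrier G \<and> N #> h = N #> g) = N #> g"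
        by (rule someI[where x = g]) (use g in simp)
      then have "c f g = c f (SOME h. h \<in> carrier G \<and> N #> h = N #> g)" using cE[OF f g] by metis
      then show ?thesis using g by blast
    qed
    then have "c f ` carrier G \<subseteq> (\<lambda>C. c f (SOME g. g \<in> carrier G \<and> N #> g = C)) ` ((\<lambda>g. N #> g) ` carrier G)"
      by blast
    then show ?thesis using finite_index_cosets_finite[OF N(2)] finite_surj by blast
  qed
  then have finF: "finite F'" using E by (auto simp: F'_def)
  have addF: "\<forall>f\<in>F'. \<forall>x\<in>N. \<forall>y\<in>N. f (x \<otimes> y) = f x + f y"
  proof (intro ballI)
    fix f' x y assume "f' \<in> F'" and xy: "x \<in> N" "y \<in> N"
    then obtain f g where f: "f \<in> E" "g \<in> carrier G" "f' = c f g" by (auto simp: F'_def)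
    show "f' (x \<otimes> y) = f' x + f' y"
      using additive_conj[OF N(1) Eadd[OF f(1)] f(2) xy] subgroup.m_closed[OF sN] xy f
      by (simp add: c_def)
  qed
  have inj: "x = \<one>" if V: "V \<in> \<V>" and g: "g \<in> carrier G" and x: "x \<in> N" and xV: "inv g \<otimes> x \<otimes> g \<in> V"
    and z: "\<forall>f\<in>F'. f x = 0" for V g x
  proof -
    have xc: "x \<in> carrier G" using subgroup.mem_carrier[OF sN x] .
    have "inv g \<otimes> x \<otimes> g \<in> K V" using normal.inv_op_closed1[OF N(1) g x] NM V by (auto simp: M_def)
    moreover have "f (inv g \<otimes> x \<otimes> g) = 0" if "f \<in> F V" for f
    proof -
      have "f \<in> E" using that V by (auto simp: E_def)
      then have "c f g \<in> F'" using g by (auto simp: F'_def)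
      then have "c f g x = 0" using z by blast
      then show ?thesis using x by (simp add: c_def)
    qed
    ultimately have "inv g \<otimes> x \<otimes> g = \<one>" using KF[OF V] xV by (auto simp: detects_def)
    then have "x = g \<otimes> \<one> \<otimes> inv g" using g xc by (metis inv_closed inv_solve_left inv_solve_right m_assoc m_closed one_closed)
    then show ?thesis using g by simp
  qed
  have "finite (rcosets N)" using N(2) by (simp add: finite_index_subgroup_def)
  then show ?thesis using N(1) finF addF inj by (intro exI[of _ N] exI[of _ F'] conjI) blast+
qed

end

section \<open>Presented groups\<close>

definition word_inv :: "'x word \<Rightarrow> 'x word" where
  "word_inv w = rev (map (\<lambda>(x, s). (x, \<not> s)) w)"

locale presentation =
  fixes S :: "'x set" and R :: "('x word \<times> 'x word) set"
  assumes rels_words: "(u, v) \<in> R \<Longrightarrow> u \<in> lists (S \<times> UNIV) \<and> v \<in> lists (S \<times> UNIV)"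
begin

abbreviation "W \<equiv> lists (S \<times> (UNIV :: bool set))"
abbreviation "cls \<equiv> pres_class S R"
abbreviation "PG \<equiv> presented_group S R"

lemma pres_eq_words: "pres_eq S R u v \<Longrightarrow> u \<in> W \<and> v \<in> W"
  by (induction rule: pres_eq.induct) (auto simp: rels_words dest: rels_words)

lemma cls_eq_iff: "u \<in> W \<Longrightarrow> cls u = cls v \<longleftrightarrow> pres_eq S R u v"
  unfolding pres_class_def
  by (auto intro: pres_eq.refl pres_eq.sym pres_eq.trans dest: pres_eq_words)

lemma pres_eq_append:
  assumes "pres_eq S R u u'" "pres_eq S R v v'"
  shows "pres_eq S R (u @ v) (u' @ v')"
proof -
  have w: "u \<in> W" "u' \<in> W" "v \<in> W" "v' \<in> W" using assms pres_eq_words by blast+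
  have "pres_eq S R ([] @ u @ v) ([] @ u' @ v)" using assms(1) w by (intro pres_eq.cong) auto
  moreover have "pres_eq S R (u' @ v @ []) (u' @ v' @ [])" using assms(2) w by (intro pres_eq.cong) auto
  ultimately show ?thesis using pres_eq.trans by fastforce
qed

lemma cls_mult: "u \<in> W \<Longrightarrow> v \<in> W \<Longrightarrow> cls u \<otimes>\<^bsub>PG\<^esub> cls v = cls (u @ v)"
proof -
  assume w: "u \<in> W" "v \<in> W"
  have "cls (u' @ v') = cls (u @ v)" if "u' \<in> cls u" "v' \<in> cls v" for u' v'
    using that w pres_eq_append[of u u' v v'] cls_eq_iff[of "u @ v" "u' @ v'"] by (auto simp: pres_class_def)
  moreover have "u \<in> cls u" "v \<in> cls v" using w by (auto simp: pres_class_def intro: pres_eq.refl)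
  ultimately have "(\<Union>u'\<in>cls u. \<Union>v'\<in>cls v. cls (u' @ v')) = cls (u @ v)" by blast
  then show ?thesis by (simp add: presented_group_def)
qed

lemma cls_closed: "u \<in> W \<Longrightarrow> cls u \<in> carrier PG"
  by (auto simp: presented_group_def)

lemma cls_cases: "c \<in> carrier PG \<Longrightarrow> (\<And>w. w \<in> W \<Longrightarrow> c = cls w \<Longrightarrow> thesis) \<Longrightarrow> thesis"
  by (auto simp: presented_group_def)

lemma cls_one: "cls [] = \<one>\<^bsub>PG\<^esub>"
  by (simp add: presented_group_def)

lemma word_inv_words: "w \<in> W \<Longrightarrow> word_inv w \<in> W"
  by (auto simp: word_inv_def)

lemma word_inv_cancel: "w \<in> W \<Longrightarrow> pres_eq S R (word_inv w @ w) []"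
proof (induction w)
  case Nil then show ?case by (auto simp: word_inv_def intro: pres_eq.refl)
next
  case (Cons a w)
  obtain x s where a: "a = (x, s)" "x \<in> S" using Cons by (cases a) auto
  have w: "w \<in> W" "word_inv w \<in> W" using Cons.prems word_inv_words by auto
  have "pres_eq S R (word_inv w @ [(x, \<not> s), (x, \<not> \<not> s)] @ w) (word_inv w @ [] @ w)"
    using w a by (intro pres_eq.cong pres_eq.cancel) auto
  then have "pres_eq S R (word_inv w @ [(x, \<not> s), (x, \<not> \<not> s)] @ w) []"
    using Cons.IH w pres_eq.trans by fastforce
  then show ?case by (simp add: word_inv_def a)
qed

lemma group_presented: "group PG"
proof (rule groupI)
  show "\<And>x y. x \<in> carrier PG \<Longrightarrow> y \<in> carrier PG \<Longrightarrow> x \<otimes>\<^bsub>PG\<^esub> y \<in> carrier PG"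
    by (elim cls_cases) (auto simp: cls_mult intro!: cls_closed)
  show "\<one>\<^bsub>PG\<^esub> \<in> carrier PG" using cls_closed[of "[]"] by (simp add: cls_one)
  show "\<And>x y z. x \<in> carrier PG \<Longrightarrow> y \<in> carrier PG \<Longrightarrow> z \<in> carrier PG \<Longrightarrow>
      x \<otimes>\<^bsub>PG\<^esub> y \<otimes>\<^bsub>PG\<^esub> z = x \<otimes>\<^bsub>PG\<^esub> (y \<otimes>\<^bsub>PG\<^esub> z)"
    by (elim cls_cases) (simp add: cls_mult)
  show "\<And>x. x \<in> carrier PG \<Longrightarrow> \<one>\<^bsub>PG\<^esub> \<otimes>\<^bsub>PG\<^esub> x = x"
    by (elim cls_cases) (simp add: cls_mult flip: cls_one)
  fix x assume "x \<in> carrier PG"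
  then obtain w where w: "w \<in> W" "x = cls w" by (rule cls_cases)
  have "cls (word_inv w @ w) = cls []"
    using cls_eq_iff[of "word_inv w @ w" "[]"] w(1) word_inv_words[OF w(1)] word_inv_cancel[OF w(1)] by simp
  then have "cls (word_inv w) \<otimes>\<^bsub>PG\<^esub> x = \<one>\<^bsub>PG\<^esub>"
    unfolding w(2) cls_mult[OF word_inv_words[OF w(1)] w(1)] by (simp add: cls_one)
  then show "\<exists>y\<in>carrier PG. y \<otimes>\<^bsub>PG\<^esub> x = \<one>\<^bsub>PG\<^esub>"
    using cls_closed[OF word_inv_words[OF w(1)]] by (rule bexI)
qed

text \<open>The universal property of a presentation, for groups of permutations: letters that act
  invertibly and respect the relations give an action of the presented group. It is relative to a
  set \<open>X\<close> because the operators on normal forms are inverse to each other only on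
  well-formed ones.\<close>

lemma pres_eq_action:
  assumes closed: "\<And>l y. l \<in> S \<times> UNIV \<Longrightarrow> y \<in> X \<Longrightarrow> L l y \<in> X"
    and inv: "\<And>x s y. x \<in> S \<Longrightarrow> y \<in> X \<Longrightarrow> L (x, s) (L (x, \<not> s) y) = y"
    and rel: "\<And>u v y. (u, v) \<in> R \<Longrightarrow> y \<in> X \<Longrightarrow> foldr L u y = foldr L v y"
    and eq: "pres_eq S R u v" and y: "y \<in> X"
  shows "foldr L u y = foldr L v y"
proof -
  have cl: "foldr L w z \<in> X" if "w \<in> W" "z \<in> X" for w z
    using that by (induction w) (auto intro!: closed)
  show ?thesis using eq y
  proof (induction arbitrary: y rule: pres_eq.induct)
    case (sym u v) then show ?case by metis
  next
    case (trans u v w) then show ?case by metis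
  next
    case (cong u v a b) then show ?case using cl by simp
  next
    case (cancel x s) then show ?case using inv by simp
  next
    case (rel u v) then show ?case using assms(3) by blast
  qed simp
qed

end

section \<open>Paths in Serre graphs\<close>

lemma edge_path_append:
  "edge_path \<Gamma> u (a @ b) v \<longleftrightarrow> (\<exists>w. edge_path \<Gamma> u a w \<and> edge_path \<Gamma> w b v)"
  if "serre_graph \<Gamma>"
proof (induction a arbitrary: u)
  case Nil
  have "edge_path \<Gamma> u b v \<Longrightarrow> u \<in> Vert \<Gamma>" for u
    using that by (cases b) (auto simp: serre_graph_def)
  then show ?case by auto
qed auto

lemma edge_path_start: "serre_graph \<Gamma> \<Longrightarrow> edge_path \<Gamma> u b v \<Longrightarrow> u \<in> Vert \<Gamma>"
  by (cases b) (auto simp: serre_graph_def)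

lemma edge_path_end: "edge_path \<Gamma> u b v \<Longrightarrow> v \<in> Vert \<Gamma>"
  by (induction b arbitrary: u) auto

lemma edge_path_edges: "edge_path \<Gamma> u b v \<Longrightarrow> set b \<subseteq> Edge \<Gamma>"
  by (induction b arbitrary: u) auto

section \<open>Reversal and backtracking\<close>

definition path_rev :: "('v, 'e) sgraph \<Rightarrow> 'e list \<Rightarrow> 'e list" where
  "path_rev \<Gamma> es = rev (map (rev_edge \<Gamma>) es)"

lemma path_rev_simps: "path_rev \<Gamma> [] = []" "path_rev \<Gamma> (e # es) = path_rev \<Gamma> es @ [rev_edge \<Gamma> e]"
  by (simp_all add: path_rev_def)

lemma serre_rev:
  assumes "serre_graph \<Gamma>" "e \<in> Edge \<Gamma>"
  shows "rev_edge \<Gamma> e \<in> Edge \<Gamma>" "rev_edge \<Gamma> e \<noteq> e" "rev_edge \<Gamma> (rev_edge \<Gamma> e) = e"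
    "src \<Gamma> e \<in> Vert \<Gamma>" "tgt \<Gamma> e \<in> Vert \<Gamma>" "tgt \<Gamma> (rev_edge \<Gamma> e) = src \<Gamma> e"
    "src \<Gamma> (rev_edge \<Gamma> e) = tgt \<Gamma> e"
proof -
  show 1: "rev_edge \<Gamma> e \<in> Edge \<Gamma>" "rev_edge \<Gamma> e \<noteq> e" "rev_edge \<Gamma> (rev_edge \<Gamma> e) = e"
    "src \<Gamma> e \<in> Vert \<Gamma>" "tgt \<Gamma> e \<in> Vert \<Gamma>" "tgt \<Gamma> (rev_edge \<Gamma> e) = src \<Gamma> e"
    using assms by (auto simp: serre_graph_def)
  show "src \<Gamma> (rev_edge \<Gamma> e) = tgt \<Gamma> e" using assms(1) 1 unfolding serre_graph_def by metis
qed

lemma edge_path_rev: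
  assumes "serre_graph \<Gamma>" "edge_path \<Gamma> u es v"
  shows "edge_path \<Gamma> v (path_rev \<Gamma> es) u"
  using assms(2)
proof (induction es arbitrary: u)
  case (Cons e es)
  then show ?case using assms(1) serre_rev[OF assms(1), of e]
    by (auto simp: path_rev_simps edge_path_append)
qed (auto simp: path_rev_simps)

definition backtracks :: "('v, 'e) sgraph \<Rightarrow> 'e list \<Rightarrow> bool" where
  "backtracks \<Gamma> es \<longleftrightarrow> (\<exists>a e b. es = a @ [e, rev_edge \<Gamma> e] @ b)"

lemma backtracks_append: "backtracks \<Gamma> b \<Longrightarrow> backtracks \<Gamma> (a @ b @ c)"
  unfolding backtracks_def by (metis append.assoc)

lemma backtracks_nth:
  "(\<exists>i. Suc i < length es \<and> es ! Suc i = rev_edge \<Gamma> (es ! i)) \<longleftrightarrow> backtracks \<Gamma> es"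
proof
  assume "\<exists>i. Suc i < length es \<and> es ! Suc i = rev_edge \<Gamma> (es ! i)"
  then obtain i where i: "Suc i < length es" "es ! Suc i = rev_edge \<Gamma> (es ! i)" by blast
  have "es = take i es @ [es ! i, es ! Suc i] @ drop (Suc (Suc i)) es"
    using i(1) by (simp add: Cons_nth_drop_Suc)
  then show "backtracks \<Gamma> es" unfolding backtracks_def i(2) by blast
next
  assume "backtracks \<Gamma> es"
  then obtain a e b where "es = a @ [e, rev_edge \<Gamma> e] @ b" unfolding backtracks_def by blast
  then show "\<exists>i. Suc i < length es \<and> es ! Suc i = rev_edge \<Gamma> (es ! i)"
    by (intro exI[of _ "length a"]) (simp add: nth_append)
qed

lemma circuit_iff:
  "circuit \<Gamma> es \<longleftrightarrow> es \<noteq> [] \<and> (\<exists>u. edge_path \<Gamma> u es u) \<and> distinct (map (src \<Gamma>) es) \<and> \<not> backtracks \<Gamma> es"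
  unfolding circuit_def using backtracks_nth[of es \<Gamma>] by blast

text \<open>If the sources of the edges are distinct, only backtracking can prevent the path from
  being a circuit. Otherwise the stretch between two edges with the same source is a shorter closed
  path, and a backtrack in it is a backtrack of the whole path.\<close>

lemma closed_path_backtracks:
  assumes "serre_graph \<Gamma>" "\<And>es. \<not> circuit \<Gamma> es"
  shows "edge_path \<Gamma> u es u \<Longrightarrow> es \<noteq> [] \<Longrightarrow> backtracks \<Gamma> es"
proof (induction "length es" arbitrary: u es rule: less_induct)
  case less
  show ?case
  proof (cases "distinct (map (src \<Gamma>) es)")
    case True
    then show ?thesis using assms(2)[of es] less.prems circuit_iff by blast
  next
    case False
    then obtain xs s ys zs where "map (src \<Gamma>) es = xs @ [s] @ ys @ [s] @ zs"
      using not_distinct_decomp by blast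
    then have "\<exists>a x b y c. es = a @ [x] @ b @ [y] @ c \<and> src \<Gamma> x = src \<Gamma> y"
      by (auto simp: map_eq_append_conv map_eq_Cons_conv append_eq_map_conv Cons_eq_map_conv) blast
    then obtain a x b y c where es: "es = a @ [x] @ b @ [y] @ c" "src \<Gamma> x = src \<Gamma> y" by blast
    have "edge_path \<Gamma> (src \<Gamma> x) (x # b) (src \<Gamma> x)"
      using less.prems(1) es assms(1) by (auto simp: edge_path_append)
    moreover have "length (x # b) < length es" using es by simp
    ultimately have "backtracks \<Gamma> (x # b)" using less.hyps by blast
    then show ?thesis using backtracks_append[of \<Gamma> "x # b" a "[y] @ c"] es by simp
  qed
qed

section \<open>Maximal trees are spanning\<close>

lemma circuit_mono:
  assumes "circuit (\<Gamma>\<lparr>Vert := V, Edge := E\<rparr>) es" "set es \<subseteq> E'"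
    "\<And>e. e \<in> E' \<Longrightarrow> src \<Gamma> e \<in> V' \<and> tgt \<Gamma> e \<in> V'"
  shows "circuit (\<Gamma>\<lparr>Vert := V', Edge := E'\<rparr>) es"
proof -
  have "edge_path (\<Gamma>\<lparr>Vert := V', Edge := E'\<rparr>) u es v"
    if "edge_path (\<Gamma>\<lparr>Vert := V, Edge := E\<rparr>) u es v" "set es \<subseteq> E'" "u \<in> V'" for u es v
    using that by (induction es arbitrary: u) (auto simp: assms(3))
  moreover have "u \<in> V'" if "edge_path (\<Gamma>\<lparr>Vert := V, Edge := E\<rparr>) u es u" for u
    using assms that by (cases es) (auto simp: circuit_def)
  ultimately have "\<exists>u. edge_path (\<Gamma>\<lparr>Vert := V', Edge := E'\<rparr>) u es u"
    using assms(1,2) unfolding circuit_def by blast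
  then show ?thesis using assms(1) by (simp add: circuit_def)
qed

text \<open>The new vertex is entered only by \<open>e\<close> and left only by its inverse. A
  circuit through it would have to turn back there, and a circuit that misses it uses old edges
  only.\<close>

lemma tree_add_leaf:
  assumes \<Gamma>: "serre_graph \<Gamma>" and T: "tree_graph (\<Gamma>\<lparr>Vert := V, Edge := E\<rparr>)"
    and VE: "V \<subseteq> Vert \<Gamma>" "E \<subseteq> Edge \<Gamma>" and e: "e \<in> Edge \<Gamma>" "src \<Gamma> e \<in> V" "tgt \<Gamma> e \<notin> V"
  shows "tree_graph (\<Gamma>\<lparr>Vert := insert (tgt \<Gamma> e) V, Edge := insert e (insert (rev_edge \<Gamma> e) E)\<rparr>)"
    (is "tree_graph ?T'")
proof -
  let ?T = "\<Gamma>\<lparr>Vert := V, Edge := E\<rparr>"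
  let ?w = "tgt \<Gamma> e" and ?e' = "rev_edge \<Gamma> e"
  have sT: "serre_graph ?T" using T by (simp add: tree_graph_def)
  have ends: "src \<Gamma> f \<in> V" "tgt \<Gamma> f \<in> V" if "f \<in> E" for f using sT that by (auto simp: serre_graph_def)
  have sT': "serre_graph ?T'"
    using sT \<Gamma> e serre_rev[OF \<Gamma> e(1)] by (auto simp: serre_graph_def)
  have out: "f = ?e'" if "f \<in> Edge ?T'" "src \<Gamma> f = ?w" for f
    using that ends(1)[of f] e(2,3) by auto
  have into: "f = e" if "f \<in> Edge ?T'" "tgt \<Gamma> f = ?w" for f
    using that ends(2)[of f] e(2,3) serre_rev[OF \<Gamma> e(1)] by auto
  have lift: "edge_path ?T' u es v" if "edge_path ?T u es v" for u es v
    using that by (induction es arbitrary: u) auto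
  have conn: "\<exists>es. edge_path ?T' u es v" if "u \<in> V" "v \<in> V" for u v
  proof -
    have "\<exists>es. edge_path ?T u es v" using T that by (simp add: tree_graph_def connected_graph_def)
    then show ?thesis using lift by blast
  qed
  have toe: "\<exists>es. edge_path ?T' u es (src \<Gamma> e)" if "u \<in> Vert ?T'" for u
  proof (cases "u \<in> V")
    case True then show ?thesis using conn e by blast
  next
    case False
    then have "u = ?w" using that by auto
    then have "edge_path ?T' u [?e'] (src \<Gamma> e)" using serre_rev[OF \<Gamma> e(1)] e by simp
    then show ?thesis by blast
  qed
  have "connected_graph ?T'"
    unfolding connected_graph_def
  proof (intro ballI)
    fix u v assume "u \<in> Vert ?T'" "v \<in> Vert ?T'"
    then obtain a b where "edge_path ?T' u a (src \<Gamma> e)" "edge_path ?T' v b (src \<Gamma> e)" using toe by blast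
    then have "edge_path ?T' u (a @ path_rev ?T' b) v"
      using edge_path_append[OF sT'] edge_path_rev[OF sT'] by blast
    then show "\<exists>es. edge_path ?T' u es v" by blast
  qed
  moreover have "\<not> circuit ?T' es" for es
  proof
    assume c: "circuit ?T' es"
    then obtain u where u: "edge_path ?T' u es u" and ne: "es \<noteq> []" by (auto simp: circuit_def)
    have nb: "\<not> backtracks ?T' es" and dist: "distinct (map (src \<Gamma>) es)" using c by (auto simp: circuit_iff)
    have sub: "set es \<subseteq> Edge ?T'" using edge_path_edges[OF u] .
    \<comment> \<open>Backtracking is excluded for consecutive list entries only, so a turn at the
      base point of the closed path has to be refuted separately. Here the list begins with
      \<open>?e'\<close> and ends with \<open>e\<close>. Then its second and its last edge have the
      same source, so they coincide, and the list \<open>[?e', e]\<close> backtracks.\<close>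
    have last_e: False if "last es = e"
    proof -
      have "tgt \<Gamma> (last es) = u" using u ne sT'
        by (cases es rule: rev_cases) (auto simp: edge_path_append)
      then have "src \<Gamma> (hd es) = ?w" using u ne that by (cases es) auto
      then have hd: "hd es = ?e'" using out sub ne by (metis hd_in_set subsetD)
      obtain zs where zs: "es = ?e' # zs" using hd ne by (cases es) auto
      then have "zs \<noteq> []" using that serre_rev[OF \<Gamma> e(1)] by auto
      then obtain z ys where ys: "zs = z # ys" by (cases zs) auto
      have sz: "src \<Gamma> z = src \<Gamma> e" using u zs ys serre_rev[OF \<Gamma> e(1)] by auto
      show False
      proof (cases "ys = []")
        case True
        then have "es = [] @ [?e', rev_edge ?T' ?e'] @ []" using zs ys that serre_rev[OF \<Gamma> e(1)] by auto
        then show False using nb unfolding backtracks_def by blast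
      next
        case False
        then have "e \<in> set ys" using that zs ys by (metis last_ConsR last_in_set list.discI)
        then show False using dist zs ys sz by auto
      qed
    qed
    have no_e: "e \<notin> set es"
    proof
      assume "e \<in> set es"
      then obtain a b where ab: "es = a @ [e] @ b" by (metis append_Cons append_Nil split_list)
      show False
      proof (cases b)
        case Nil then show False using ab last_e by simp
      next
        case (Cons f b')
        have "src \<Gamma> f = ?w" "f \<in> Edge ?T'" using u ab Cons sT' by (auto simp: edge_path_append)
        then have "f = ?e'" using out by blast
        then have "es = a @ [e, rev_edge ?T' e] @ b'" using ab Cons by simp
        then show False using nb unfolding backtracks_def by blast
      qed
    qed
    have no_e': "?e' \<notin> set es"
    proof
      assume "?e' \<in> set es"
      then obtain a b where ab: "es = a @ [?e'] @ b" by (metis append_Cons append_Nil split_list)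
      show False
      proof (cases a rule: rev_cases)
        case Nil
        then have uw: "u = ?w" using u ab serre_rev[OF \<Gamma> e(1)] by auto
        have "tgt \<Gamma> (last es) = u" "last es \<in> Edge ?T'" using u ne sT'
          by (cases es rule: rev_cases; auto simp: edge_path_append)+
        then have "last es = e" using into uw by blast
        then show False by (rule last_e)
      next
        case (snoc a' f)
        have "tgt \<Gamma> f = ?w" "f \<in> Edge ?T'"
          using u ab snoc sT' serre_rev[OF \<Gamma> e(1)] by (auto simp: edge_path_append)
        then have "f = e" using into by blast
        then show False using no_e ab snoc by simp
      qed
    qed
    have "set es \<subseteq> E" using sub no_e no_e' by auto
    then have "circuit ?T es" using circuit_mono[OF c _ ] ends by blast
    then show False using T by (auto simp: tree_graph_def)
  qed
  ultimately show ?thesis using sT' by (simp add: tree_graph_def)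
qed

text \<open>A path from the tree to a vertex outside has an edge that leaves the vertex set of the
  tree; adjoining this edge contradicts maximality.\<close>

lemma maximal_tree_spanning:
  assumes \<Gamma>: "serre_graph \<Gamma>" "connected_graph \<Gamma>" and T: "maximal_tree T \<Gamma>"
  shows "Vert T = Vert \<Gamma>"
proof (rule ccontr)
  assume neq: "Vert T \<noteq> Vert \<Gamma>"
  obtain V E where VE: "V \<subseteq> Vert \<Gamma>" "E \<subseteq> Edge \<Gamma>" "T = \<Gamma>\<lparr>Vert := V, Edge := E\<rparr>" and tree: "tree_graph T"
    using T by (auto simp: maximal_tree_def subtree_def)
  obtain u where u: "u \<in> V" using tree VE by (auto simp: tree_graph_def)
  obtain w where w: "w \<in> Vert \<Gamma>" "w \<notin> V" using neq VE by auto
  have "u \<in> Vert \<Gamma>" using u VE by blast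
  then obtain es where es: "edge_path \<Gamma> u es w"
    using \<Gamma>(2) w(1) unfolding connected_graph_def by blast
  have "\<exists>e\<in>Edge \<Gamma>. src \<Gamma> e \<in> V \<and> tgt \<Gamma> e \<notin> V" using es u w(2)
    by (induction es arbitrary: u) auto
  then obtain e where e: "e \<in> Edge \<Gamma>" "src \<Gamma> e \<in> V" "tgt \<Gamma> e \<notin> V" by blast
  let ?T' = "\<Gamma>\<lparr>Vert := insert (tgt \<Gamma> e) V, Edge := insert e (insert (rev_edge \<Gamma> e) E)\<rparr>"
  have "tree_graph ?T'" using tree_add_leaf[OF \<Gamma>(1) _ VE(1,2) e] tree VE by simp
  then have "subtree ?T' \<Gamma>" unfolding subtree_def using VE serre_rev[OF \<Gamma>(1) e(1)] e(1)
    by (intro conjI exI[of _ "insert (tgt \<Gamma> e) V"] exI[of _ "insert e (insert (rev_edge \<Gamma> e) E)"]) auto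
  then have "?T' = T" using T VE unfolding maximal_tree_def by auto
  then have "Vert ?T' = Vert T" by simp
  then show False using VE e by auto
qed

section \<open>The fundamental group of a graph of groups\<close>

locale splitting =
  fixes \<GG> :: "('v, 'e, 'g, 'k) graph_of_groups" and T :: "('v, 'e) sgraph" and P :: "'e set"
  assumes gog: "finite_graph_of_groups \<GG>"
    and tree: "maximal_tree T (graph \<GG>)"
    and orient: "orientation (graph \<GG>) P"
begin

abbreviation "\<Gamma> \<equiv> graph \<GG>"
abbreviation "rv \<equiv> rev_edge \<Gamma>"
abbreviation "vg \<equiv> vgroup \<GG>"
abbreviation "H \<equiv> fundamental_group \<GG> T P"
abbreviation "cl \<equiv> fund_class \<GG> T P"

lemma serre: "serre_graph \<Gamma>"
  using gog by (simp add: finite_graph_of_groups_def)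

lemmas rv = serre_rev[OF serre]

lemma vgroup_group: "v \<in> Vert \<Gamma> \<Longrightarrow> group (vg v)"
  using gog by (simp add: finite_graph_of_groups_def)

lemma egroup_group: "e \<in> Edge \<Gamma> \<Longrightarrow> group (egroup \<GG> e)" "e \<in> Edge \<Gamma> \<Longrightarrow> egroup \<GG> (rv e) = egroup \<GG> e"
  and emono_hom: "e \<in> Edge \<Gamma> \<Longrightarrow> emono \<GG> e \<in> hom (egroup \<GG> e) (vg (src \<Gamma> e))"
  and emono_inj: "e \<in> Edge \<Gamma> \<Longrightarrow> inj_on (emono \<GG> e) (carrier (egroup \<GG> e))"
  using gog by (simp_all add: finite_graph_of_groups_def)

lemma emono_group_hom: "e \<in> Edge \<Gamma> \<Longrightarrow> group_hom (egroup \<GG> e) (vg (src \<Gamma> e)) (emono \<GG> e)"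
  by (simp add: group_hom_def group_hom_axioms_def egroup_group vgroup_group emono_hom rv)

lemma emono_rev_group_hom: "e \<in> Edge \<Gamma> \<Longrightarrow> group_hom (egroup \<GG> e) (vg (tgt \<Gamma> e)) (emono \<GG> (rv e))"
  using emono_group_hom[of "rv e"] rv[of e] egroup_group[of e] by simp

lemma emono_closed: "e \<in> Edge \<Gamma> \<Longrightarrow> a \<in> carrier (egroup \<GG> e) \<Longrightarrow> emono \<GG> e a \<in> carrier (vg (src \<Gamma> e))"
  using emono_hom by (auto simp: hom_def)

lemma emono_rev_closed:
  "e \<in> Edge \<Gamma> \<Longrightarrow> a \<in> carrier (egroup \<GG> e) \<Longrightarrow> emono \<GG> (rv e) a \<in> carrier (vg (tgt \<Gamma> e))"
  using emono_closed[of "rv e" a] rv[of e] egroup_group[of e] by simp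

lemma P_edges: "e \<in> P \<Longrightarrow> e \<in> Edge \<Gamma>"
  using orient by (auto simp: orientation_def)

lemma P_rv: "e \<in> Edge \<Gamma> \<Longrightarrow> rv e \<in> P \<longleftrightarrow> e \<notin> P"
proof
  assume e: "e \<in> Edge \<Gamma>"
  show "e \<notin> P" if "rv e \<in> P"
    using orient that unfolding orientation_def by blast
  assume "e \<notin> P"
  then obtain f where "f \<in> P" "e = rv f" using orient e unfolding orientation_def by blast
  then show "rv e \<in> P" using rv[OF P_edges] by simp
qed

sublocale presentation "fund_gens \<GG> P" "fund_rels \<GG> T P"
  using rv(4,5)[OF P_edges] emono_closed emono_rev_closed P_edges
    group.is_monoid[OF vgroup_group, THEN monoid.m_closed]
  by unfold_locales (auto simp: fund_rels_def fund_gens_def)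

lemma H_group: "group H"
  using group_presented by (simp add: fundamental_group_def)

sublocale H: group H by (rule H_group)

lemma cl_mult: "u \<in> W \<Longrightarrow> v \<in> W \<Longrightarrow> cl u \<otimes>\<^bsub>H\<^esub> cl v = cl (u @ v)"
  using cls_mult by (simp add: fundamental_group_def fund_class_def)

lemma cl_one: "cl [] = \<one>\<^bsub>H\<^esub>"
  using cls_one by (simp add: fundamental_group_def fund_class_def)

lemma cl_closed: "u \<in> W \<Longrightarrow> cl u \<in> carrier H"
  using cls_closed by (simp add: fundamental_group_def fund_class_def)

lemma cl_cases: "c \<in> carrier H \<Longrightarrow> (\<And>w. w \<in> W \<Longrightarrow> c = cl w \<Longrightarrow> thesis) \<Longrightarrow> thesis"
  using cls_cases by (auto simp: fundamental_group_def fund_class_def)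

lemma cl_eq_iff: "u \<in> W \<Longrightarrow> cl u = cl v \<longleftrightarrow> pres_eq (fund_gens \<GG> P) (fund_rels \<GG> T P) u v"
  using cls_eq_iff by (simp add: fund_class_def)

lemma cl_rel: "(u, v) \<in> fund_rels \<GG> T P \<Longrightarrow> cl u = cl v"
  using rels_words cl_eq_iff by (blast intro: pres_eq.rel)

section \<open>Vertex elements and stable letters\<close>

definition vh :: "'v \<Rightarrow> 'g \<Rightarrow> ('v, 'e, 'g) fgen word set" where
  "vh v g = cl [(VElt v g, True)]"

definition te :: "'e \<Rightarrow> ('v, 'e, 'g) fgen word set" where
  "te e = stable_letter \<GG> T P e"

lemma vgen: "v \<in> Vert \<Gamma> \<Longrightarrow> g \<in> carrier (vg v) \<Longrightarrow> VElt v g \<in> fund_gens \<GG> P"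
  by (auto simp: fund_gens_def)

lemma sgen: "e \<in> P \<Longrightarrow> Stable e \<in> fund_gens \<GG> P"
  by (auto simp: fund_gens_def)

lemma vh_closed: "v \<in> Vert \<Gamma> \<Longrightarrow> g \<in> carrier (vg v) \<Longrightarrow> vh v g \<in> carrier H"
  unfolding vh_def by (rule cl_closed) (auto intro: vgen)

lemma vh_mult:
  assumes "v \<in> Vert \<Gamma>" "g \<in> carrier (vg v)" "h \<in> carrier (vg v)"
  shows "vh v (g \<otimes>\<^bsub>vg v\<^esub> h) = vh v g \<otimes>\<^bsub>H\<^esub> vh v h"
proof -
  have "vh v g \<otimes>\<^bsub>H\<^esub> vh v h = cl [(VElt v g, True), (VElt v h, True)]"
    unfolding vh_def using assms by (subst cl_mult) (auto intro: vgen)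
  also have "\<dots> = vh v (g \<otimes>\<^bsub>vg v\<^esub> h)"
    unfolding vh_def by (rule cl_rel) (use assms in \<open>auto simp: fund_rels_def\<close>)
  finally show ?thesis ..
qed

lemma vh_group_hom: "v \<in> Vert \<Gamma> \<Longrightarrow> group_hom (vg v) H (vh v)"
  by (auto simp: group_hom_def group_hom_axioms_def vgroup_group H_group hom_def vh_closed vh_mult)

lemma vh_inv: "v \<in> Vert \<Gamma> \<Longrightarrow> g \<in> carrier (vg v) \<Longrightarrow> vh v (inv\<^bsub>vg v\<^esub> g) = inv\<^bsub>H\<^esub> (vh v g)"
  using group_hom.hom_inv[OF vh_group_hom] .

lemma cl_inverse_letter:
  assumes "x \<in> fund_gens \<GG> P"
  shows "cl [(x, False)] = inv\<^bsub>H\<^esub> (cl [(x, True)])"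
proof -
  have "cl [(x, False)] \<otimes>\<^bsub>H\<^esub> cl [(x, True)] = cl [(x, False), (x, \<not> False)]"
    using assms by (subst cl_mult) auto
  also have "\<dots> = cl []"
    using assms pres_eq.cancel[OF assms, of "fund_rels \<GG> T P" False] by (subst cl_eq_iff) auto
  finally have "cl [(x, False)] \<otimes>\<^bsub>H\<^esub> cl [(x, True)] = \<one>\<^bsub>H\<^esub>" by (simp add: cl_one)
  then show ?thesis using assms H.inv_equality cl_closed by (metis Cons_in_lists_iff Nil SigmaI UNIV_I lists.Nil)
qed

lemma te_P: "e \<in> P \<Longrightarrow> te e = cl [(Stable e, True)]"
  by (simp add: te_def stable_letter_def)

lemma te_closed: "e \<in> Edge \<Gamma> \<Longrightarrow> te e \<in> carrier H"
  using P_rv sgen by (auto simp: te_def stable_letter_def intro!: cl_closed)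

lemma te_rv: "e \<in> Edge \<Gamma> \<Longrightarrow> te (rv e) = inv\<^bsub>H\<^esub> (te e)"
proof -
  assume e: "e \<in> Edge \<Gamma>"
  have *: "te (rv f) = inv\<^bsub>H\<^esub> (te f)" if "f \<in> P" for f
    using P_rv[OF P_edges[OF that]] that rv[OF P_edges[OF that]] cl_inverse_letter[OF sgen[OF that]]
    by (simp add: te_def stable_letter_def)
  show ?thesis
  proof (cases "e \<in> P")
    case False
    then show ?thesis using *[of "rv e"] P_rv[OF e] rv[OF e] te_closed by simp
  qed (rule *)
qed

text \<open>For an edge outside \<open>P\<close> this is the defining relation of the inverse edge,
  solved for the other side. From here on edges need no orientation in computations with
  \<open>te\<close>.\<close>

lemma te_relation:
  assumes "e \<in> Edge \<Gamma>" "a \<in> carrier (egroup \<GG> e)"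
  shows "te e \<otimes>\<^bsub>H\<^esub> vh (tgt \<Gamma> e) (emono \<GG> (rv e) a) \<otimes>\<^bsub>H\<^esub> inv\<^bsub>H\<^esub> (te e) = vh (src \<Gamma> e) (emono \<GG> e a)"
proof -
  have *: "te e \<otimes>\<^bsub>H\<^esub> vh (tgt \<Gamma> e) (emono \<GG> (rv e) a) \<otimes>\<^bsub>H\<^esub> inv\<^bsub>H\<^esub> (te e) = vh (src \<Gamma> e) (emono \<GG> e a)"
    if e: "e \<in> P" and a: "a \<in> carrier (egroup \<GG> e)" for e a
  proof -
    have g: "VElt (tgt \<Gamma> e) (emono \<GG> (rv e) a) \<in> fund_gens \<GG> P"
      using emono_rev_closed[OF P_edges[OF e] a] rv[OF P_edges[OF e]] vgen by blast
    have "te e \<otimes>\<^bsub>H\<^esub> vh (tgt \<Gamma> e) (emono \<GG> (rv e) a) \<otimes>\<^bsub>H\<^esub> inv\<^bsub>H\<^esub> (te e) =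
      cl [(Stable e, True), (VElt (tgt \<Gamma> e) (emono \<GG> (rv e) a), True), (Stable e, False)]"
      using g sgen[OF e] unfolding te_P[OF e] vh_def cl_inverse_letter[OF sgen[OF e], symmetric]
      by (simp add: cl_mult)
    also have "\<dots> = vh (src \<Gamma> e) (emono \<GG> e a)"
      unfolding vh_def by (rule cl_rel) (use e a in \<open>auto simp: fund_rels_def\<close>)
    finally show ?thesis .
  qed
  show ?thesis
  proof (cases "e \<in> P")
    case True then show ?thesis using * assms by blast
  next
    case False
    let ?x = "vh (src \<Gamma> e) (emono \<GG> e a)" and ?y = "vh (tgt \<Gamma> e) (emono \<GG> (rv e) a)"
    have eq: "inv\<^bsub>H\<^esub> (te e) \<otimes>\<^bsub>H\<^esub> ?x \<otimes>\<^bsub>H\<^esub> te e = ?y"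
      using *[of "rv e" a] P_rv assms False rv[OF assms(1)] te_rv egroup_group te_closed by simp
    have c: "te e \<in> carrier H" "?x \<in> carrier H"
      using assms te_closed vh_closed emono_closed rv by auto
    have "te e \<otimes>\<^bsub>H\<^esub> (inv\<^bsub>H\<^esub> (te e) \<otimes>\<^bsub>H\<^esub> ?x \<otimes>\<^bsub>H\<^esub> te e) \<otimes>\<^bsub>H\<^esub> inv\<^bsub>H\<^esub> (te e) = ?x"
    proof -
      have "te e \<otimes>\<^bsub>H\<^esub> (inv\<^bsub>H\<^esub> (te e) \<otimes>\<^bsub>H\<^esub> ?x) = ?x" using c by (simp flip: H.m_assoc)
      then show ?thesis using c by (simp add: H.m_assoc)
    qed
    then show ?thesis using eq by simp
  qed
qed

lemma T_form: obtains V E where "V \<subseteq> Vert \<Gamma>" "E \<subseteq> Edge \<Gamma>" "T = \<Gamma>\<lparr>Vert := V, Edge := E\<rparr>" "tree_graph T"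
  using tree by (auto simp: maximal_tree_def subtree_def)

lemma T_serre: "serre_graph T" and T_edges: "e \<in> Edge T \<Longrightarrow> e \<in> Edge \<Gamma>"
  and T_maps: "rev_edge T = rv" "src T = src \<Gamma>" "tgt T = tgt \<Gamma>"
  and T_conn: "connected_graph T" and T_acyclic: "\<not> circuit T es"
  by (rule T_form; auto simp: tree_graph_def)+

lemma T_vert: "Vert T = Vert \<Gamma>"
  using maximal_tree_spanning[OF serre _ tree] gog by (simp add: finite_graph_of_groups_def)

lemma te_tree: "e \<in> Edge T \<Longrightarrow> te e = \<one>\<^bsub>H\<^esub>"
proof -
  assume e: "e \<in> Edge T"
  have *: "te f = \<one>\<^bsub>H\<^esub>" if "f \<in> Edge T" "f \<in> P" for f
  proof -
    have "te f = cl []" unfolding te_P[OF that(2)] by (rule cl_rel) (use that in \<open>auto simp: fund_rels_def\<close>)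
    then show ?thesis by (simp add: cl_one)
  qed
  show ?thesis
  proof (cases "e \<in> P")
    case False
    have "rv e \<in> Edge T" using serre_rev(1)[OF T_serre e] by (simp add: T_maps)
    moreover have "rv e \<in> P" using False P_rv T_edges[OF e] by blast
    ultimately have "inv\<^bsub>H\<^esub> (te e) = \<one>\<^bsub>H\<^esub>" using * te_rv[OF T_edges[OF e]] by metis
    then show ?thesis using te_closed[OF T_edges[OF e]] by (metis H.inv_inv H.inv_one)
  qed (use e * in blast)
qed

text \<open>Inverse letters need no cases of their own: the inverse of a vertex element is a vertex
  element, and the inverse of a stable letter is the stable letter of the inverse edge.\<close>

lemma H_induct [consumes 1, case_names one vertex edge]:
  assumes "x \<in> carrier H" and one: "Q \<one>\<^bsub>H\<^esub>"
    and vert: "\<And>v g x. v \<in> Vert \<Gamma> \<Longrightarrow> g \<in> carrier (vg v) \<Longrightarrow> x \<in> carrier H \<Longrightarrow> Q x \<Longrightarrow> Q (vh v g \<otimes>\<^bsub>H\<^esub> x)"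
    and edge: "\<And>e x. e \<in> Edge \<Gamma> \<Longrightarrow> x \<in> carrier H \<Longrightarrow> Q x \<Longrightarrow> Q (te e \<otimes>\<^bsub>H\<^esub> x)"
  shows "Q x"
proof -
  have "Q (cl w)" if "w \<in> W" for w
    using that
  proof (induction w)
    case Nil then show ?case using one by (simp add: cl_one)
  next
    case (Cons l w)
    obtain y s where l: "l = (y, s)" "y \<in> fund_gens \<GG> P" using Cons by (cases l) auto
    have w: "w \<in> W" "cl w \<in> carrier H" "Q (cl w)" using Cons cl_closed by auto
    have eq: "cl (l # w) = cl [l] \<otimes>\<^bsub>H\<^esub> cl w" using cl_mult[of "[l]" w] l w(1) by simp
    consider v g where "y = VElt v g" "v \<in> Vert \<Gamma>" "g \<in> carrier (vg v)" | e where "y = Stable e" "e \<in> P"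
      using l(2) by (auto simp: fund_gens_def)
    then show ?case
    proof cases
      case 1
      have "cl [l] = vh v (if s then g else inv\<^bsub>vg v\<^esub> g)"
        using 1 l cl_inverse_letter[OF l(2)] by (cases s) (simp_all add: vh_inv, simp_all add: vh_def)
      then show ?thesis unfolding eq using 1 w vert group.inv_closed[OF vgroup_group] by simp
    next
      case 2
      have "cl [l] = te (if s then e else rv e)"
        using 2 l cl_inverse_letter[OF l(2)] P_edges by (cases s) (simp_all add: te_rv te_P)
      then show ?thesis unfolding eq using 2 w edge P_edges rv by simp
    qed
  qed
  then show ?thesis using assms(1) by (metis cl_cases)
qed

end

section \<open>Normal forms\<close>

datatype ('g, 'e) nform = NEnd 'g | NStep 'g 'e "('g, 'e) nform"

context splitting
begin

definition imE :: "'e \<Rightarrow> 'g set" where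
  "imE e = emono \<GG> e ` carrier (egroup \<GG> e)"

text \<open>The trivial coset is represented by the neutral element, so that a possible cancellation
  shows in the form itself, through the predicate \<open>starts\<close>. Elements of one coset
  receive the same representative because the choice depends on the coset only.\<close>

definition rep :: "'e \<Rightarrow> 'g \<Rightarrow> 'g" where
  "rep e x = (if x \<in> imE e then \<one>\<^bsub>vg (src \<Gamma> e)\<^esub>
     else (SOME y. y \<in> x <#\<^bsub>vg (src \<Gamma> e)\<^esub> imE e))"

text \<open>The isomorphism between the two images of the edge group. By the edge relation,
  \<open>x t\<^sub>e = t\<^sub>e (trans_edge e x)\<close> in the fundamental group for
  \<open>x\<close> in \<open>imE e\<close>.\<close>

definition trans_edge :: "'e \<Rightarrow> 'g \<Rightarrow> 'g" where
  "trans_edge e x = emono \<GG> (rv e) (inv_into (carrier (egroup \<GG> e)) (emono \<GG> e) x)"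

lemma imE_subgroup: "e \<in> Edge \<Gamma> \<Longrightarrow> subgroup (imE e) (vg (src \<Gamma> e))"
  unfolding imE_def using group_hom.img_is_subgroup[OF emono_group_hom] .

lemma vsrc: "e \<in> Edge \<Gamma> \<Longrightarrow> group (vg (src \<Gamma> e))" and vtgt: "e \<in> Edge \<Gamma> \<Longrightarrow> group (vg (tgt \<Gamma> e))"
  using vgroup_group rv by auto

lemma
  assumes e: "e \<in> Edge \<Gamma>" and x: "x \<in> carrier (vg (src \<Gamma> e))"
  shows rep_closed: "rep e x \<in> carrier (vg (src \<Gamma> e))"
    and rep_in: "inv\<^bsub>vg (src \<Gamma> e)\<^esub> (rep e x) \<otimes>\<^bsub>vg (src \<Gamma> e)\<^esub> x \<in> imE e"
proof -
  interpret G: group "vg (src \<Gamma> e)" using e by (rule vsrc)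
  interpret A: subgroup "imE e" "vg (src \<Gamma> e)" using e by (rule imE_subgroup)
  have "rep e x \<in> carrier (vg (src \<Gamma> e)) \<and> inv\<^bsub>vg (src \<Gamma> e)\<^esub> (rep e x) \<otimes>\<^bsub>vg (src \<Gamma> e)\<^esub> x \<in> imE e"
  proof (cases "x \<in> imE e")
    case True then show ?thesis by (simp add: rep_def)
  next
    case False
    have "x \<in> x <#\<^bsub>vg (src \<Gamma> e)\<^esub> imE e"
      using x A.one_closed unfolding l_coset_def by force
    then have "rep e x \<in> x <#\<^bsub>vg (src \<Gamma> e)\<^esub> imE e"
      using False unfolding rep_def by (metis someI)
    then obtain a where a: "a \<in> imE e" "rep e x = x \<otimes>\<^bsub>vg (src \<Gamma> e)\<^esub> a" by (auto simp: l_coset_def)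
    then have "inv\<^bsub>vg (src \<Gamma> e)\<^esub> (rep e x) \<otimes>\<^bsub>vg (src \<Gamma> e)\<^esub> x = inv\<^bsub>vg (src \<Gamma> e)\<^esub> a"
      using x by (simp add: G.inv_mult_group G.m_assoc)
    then show ?thesis using a x by simp
  qed
  then show "rep e x \<in> carrier (vg (src \<Gamma> e))"
    "inv\<^bsub>vg (src \<Gamma> e)\<^esub> (rep e x) \<otimes>\<^bsub>vg (src \<Gamma> e)\<^esub> x \<in> imE e" by auto
qed

lemma rep_mult_right:
  assumes e: "e \<in> Edge \<Gamma>" and x: "x \<in> carrier (vg (src \<Gamma> e))" and a: "a \<in> imE e"
  shows "rep e (x \<otimes>\<^bsub>vg (src \<Gamma> e)\<^esub> a) = rep e x"
proof -
  interpret G: group "vg (src \<Gamma> e)" using e by (rule vsrc)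
  interpret A: subgroup "imE e" "vg (src \<Gamma> e)" using e by (rule imE_subgroup)
  have ac: "a \<in> carrier (vg (src \<Gamma> e))" using a by simp
  have "x \<otimes>\<^bsub>vg (src \<Gamma> e)\<^esub> a \<in> imE e \<longleftrightarrow> x \<in> imE e"
  proof
    assume "x \<otimes>\<^bsub>vg (src \<Gamma> e)\<^esub> a \<in> imE e"
    then have "x \<otimes>\<^bsub>vg (src \<Gamma> e)\<^esub> a \<otimes>\<^bsub>vg (src \<Gamma> e)\<^esub> inv\<^bsub>vg (src \<Gamma> e)\<^esub> a \<in> imE e" using a by blast
    then show "x \<in> imE e" using x ac by (simp add: G.m_assoc)
  qed (use a in blast)
  moreover have "(x \<otimes>\<^bsub>vg (src \<Gamma> e)\<^esub> a) <#\<^bsub>vg (src \<Gamma> e)\<^esub> imE e = x <#\<^bsub>vg (src \<Gamma> e)\<^esub> imE e"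
    using G.l_repr_independence[of "x \<otimes>\<^bsub>vg (src \<Gamma> e)\<^esub> a" x "imE e"] x a A.subgroup_axioms
    by (force simp: l_coset_def)
  ultimately show ?thesis by (simp add: rep_def)
qed

lemma rep_eq_one_iff:
  assumes e: "e \<in> Edge \<Gamma>" and x: "x \<in> carrier (vg (src \<Gamma> e))"
  shows "rep e x = \<one>\<^bsub>vg (src \<Gamma> e)\<^esub> \<longleftrightarrow> x \<in> imE e"
proof -
  interpret G: group "vg (src \<Gamma> e)" using e by (rule vsrc)
  show ?thesis using rep_in[OF e x] x by (auto simp: rep_def)
qed

lemma rep_decomp:
  assumes e: "e \<in> Edge \<Gamma>" and x: "x \<in> carrier (vg (src \<Gamma> e))"
  shows "x = rep e x \<otimes>\<^bsub>vg (src \<Gamma> e)\<^esub> (inv\<^bsub>vg (src \<Gamma> e)\<^esub> (rep e x) \<otimes>\<^bsub>vg (src \<Gamma> e)\<^esub> x)"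
proof -
  interpret G: group "vg (src \<Gamma> e)" using e by (rule vsrc)
  show ?thesis using rep_closed[OF e x] x by (simp flip: G.m_assoc)
qed

lemma rep_rep:
  assumes e: "e \<in> Edge \<Gamma>" and x: "x \<in> carrier (vg (src \<Gamma> e))"
  shows "rep e (rep e x) = rep e x"
  using rep_mult_right[OF e rep_closed[OF e x] rep_in[OF e x]] rep_decomp[OF e x] by simp

lemma trans_edge_emono:
  "e \<in> Edge \<Gamma> \<Longrightarrow> a \<in> carrier (egroup \<GG> e) \<Longrightarrow> trans_edge e (emono \<GG> e a) = emono \<GG> (rv e) a"
  by (simp add: trans_edge_def emono_inj)

lemma trans_edge_closed: "e \<in> Edge \<Gamma> \<Longrightarrow> x \<in> imE e \<Longrightarrow> trans_edge e x \<in> imE (rv e)"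
  using egroup_group(2) by (auto simp: imE_def trans_edge_emono)

lemma imE_rv_carrier: "e \<in> Edge \<Gamma> \<Longrightarrow> x \<in> imE (rv e) \<Longrightarrow> x \<in> carrier (vg (tgt \<Gamma> e))"
  using egroup_group(2) by (auto simp: imE_def emono_rev_closed)

lemma imE_carrier: "e \<in> Edge \<Gamma> \<Longrightarrow> x \<in> imE e \<Longrightarrow> x \<in> carrier (vg (src \<Gamma> e))"
  by (auto simp: imE_def emono_closed)

lemma trans_edge_carrier: "e \<in> Edge \<Gamma> \<Longrightarrow> x \<in> imE e \<Longrightarrow> trans_edge e x \<in> carrier (vg (tgt \<Gamma> e))"
  using trans_edge_closed imE_rv_carrier by blast

lemma trans_edge_mult:
  assumes e: "e \<in> Edge \<Gamma>" and x: "x \<in> imE e" "y \<in> imE e"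
  shows "trans_edge e (x \<otimes>\<^bsub>vg (src \<Gamma> e)\<^esub> y) = trans_edge e x \<otimes>\<^bsub>vg (tgt \<Gamma> e)\<^esub> trans_edge e y"
proof -
  interpret h: group_hom "egroup \<GG> e" "vg (src \<Gamma> e)" "emono \<GG> e" using e by (rule emono_group_hom)
  interpret h': group_hom "egroup \<GG> e" "vg (tgt \<Gamma> e)" "emono \<GG> (rv e)" using e by (rule emono_rev_group_hom)
  show ?thesis using x e
    by (auto simp: imE_def trans_edge_emono simp flip: h.hom_mult)
qed

lemma trans_edge_one:
  assumes e: "e \<in> Edge \<Gamma>" shows "trans_edge e \<one>\<^bsub>vg (src \<Gamma> e)\<^esub> = \<one>\<^bsub>vg (tgt \<Gamma> e)\<^esub>"
proof -
  interpret h: group_hom "egroup \<GG> e" "vg (src \<Gamma> e)" "emono \<GG> e" using e by (rule emono_group_hom)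
  interpret h': group_hom "egroup \<GG> e" "vg (tgt \<Gamma> e)" "emono \<GG> (rv e)" using e by (rule emono_rev_group_hom)
  show ?thesis using trans_edge_emono[OF e, of "\<one>\<^bsub>egroup \<GG> e\<^esub>"] by simp
qed

text \<open>This is the situation in which a stable letter of the inverse edge, placed in front,
  cancels.\<close>

definition starts :: "'e \<Rightarrow> ('g, 'e) nform \<Rightarrow> bool" where
  "starts e w \<longleftrightarrow> (\<exists>y. w = NStep \<one>\<^bsub>vg (src \<Gamma> e)\<^esub> e y)"

text \<open>\<open>NStep s\<^sub>1 e\<^sub>1 (\<dots> (NStep s\<^sub>n e\<^sub>n (NEnd g)))\<close> stands for the reduced word \<open>s\<^sub>1 t\<^sub>1 \<dots> s\<^sub>n t\<^sub>n g\<close> in which the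
  \<open>s\<^sub>i\<close> are the chosen representatives of the left cosets of the edge groups.\<close>

primrec ok :: "'v \<Rightarrow> ('g, 'e) nform \<Rightarrow> bool" where
  "ok v (NEnd g) \<longleftrightarrow> v \<in> Vert \<Gamma> \<and> g \<in> carrier (vg v)"
| "ok v (NStep s e w) \<longleftrightarrow> e \<in> Edge \<Gamma> \<and> src \<Gamma> e = v \<and> s \<in> carrier (vg v) \<and> rep e s = s \<and>
     ok (tgt \<Gamma> e) w \<and> \<not> starts (rv e) w"

text \<open>Left multiplication by \<open>g\<close>: the first representative is replaced by that of
  \<open>g s\<close>, and the remaining element of the edge group is moved across the stable letter
  and multiplied into the tail.\<close>

primrec act :: "('g, 'e) nform \<Rightarrow> 'v \<Rightarrow> 'g \<Rightarrow> ('g, 'e) nform" where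
  "act (NEnd h) v g = NEnd (g \<otimes>\<^bsub>vg v\<^esub> h)"
| "act (NStep s e w) v g = NStep (rep e (g \<otimes>\<^bsub>vg v\<^esub> s)) e
     (act w (tgt \<Gamma> e) (trans_edge e (inv\<^bsub>vg v\<^esub> (rep e (g \<otimes>\<^bsub>vg v\<^esub> s)) \<otimes>\<^bsub>vg v\<^esub> (g \<otimes>\<^bsub>vg v\<^esub> s))))"

text \<open>Multiplication by an element of the edge group neither moves a representative into the
  trivial coset nor out of it. This keeps forms reduced when \<open>act\<close> passes such an
  element to the tail.\<close>

lemma starts_act:
  assumes "ok v w" "e \<in> Edge \<Gamma>" "src \<Gamma> e = v" "a \<in> imE e"
  shows "starts e (act w v a) \<longleftrightarrow> starts e w"
proof (cases w)
  case (NStep s e' y)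
  interpret G: group "vg v" using vsrc assms by auto
  interpret A: subgroup "imE e" "vg v" using imE_subgroup assms by auto
  show ?thesis
  proof (cases "e' = e")
    case True
    then have s: "s \<in> carrier (vg v)" "rep e s = s" using assms NStep by auto
    have "a \<otimes>\<^bsub>vg v\<^esub> s \<in> imE e \<longleftrightarrow> s \<in> imE e"
    proof
      assume "a \<otimes>\<^bsub>vg v\<^esub> s \<in> imE e"
      then have "inv\<^bsub>vg v\<^esub> a \<otimes>\<^bsub>vg v\<^esub> (a \<otimes>\<^bsub>vg v\<^esub> s) \<in> imE e" using assms(4) by blast
      then show "s \<in> imE e" using s assms(4) by (simp flip: G.m_assoc)
    qed (use assms(4) in blast)
    then have "rep e (a \<otimes>\<^bsub>vg v\<^esub> s) = \<one>\<^bsub>vg v\<^esub> \<longleftrightarrow> s = \<one>\<^bsub>vg v\<^esub>"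
      using rep_eq_one_iff[OF assms(2)] s assms(3,4) A.mem_carrier by (metis G.m_closed)
    then show ?thesis using NStep True assms(3) by (simp add: starts_def)
  qed (use NStep in \<open>auto simp: starts_def\<close>)
qed (simp add: starts_def)

lemma act_ok: "ok v w \<Longrightarrow> g \<in> carrier (vg v) \<Longrightarrow> ok v (act w v g)"
proof (induction w arbitrary: v g)
  case (NEnd h)
  then show ?case using group.is_monoid[OF vgroup_group, THEN monoid.m_closed] by simp
next
  case (NStep s e w)
  then have e: "e \<in> Edge \<Gamma>" "v = src \<Gamma> e" "s \<in> carrier (vg v)" "ok (tgt \<Gamma> e) w" "\<not> starts (rv e) w" by auto
  interpret G: group "vg v" using vsrc e by auto
  have gs: "g \<otimes>\<^bsub>vg v\<^esub> s \<in> carrier (vg (src \<Gamma> e))"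
    using G.m_closed[OF NStep.prems(2) e(3)] e(2) by simp
  let ?a = "inv\<^bsub>vg v\<^esub> (rep e (g \<otimes>\<^bsub>vg v\<^esub> s)) \<otimes>\<^bsub>vg v\<^esub> (g \<otimes>\<^bsub>vg v\<^esub> s)"
  have a: "?a \<in> imE e" using rep_in[OF e(1) gs] e(2) by simp
  show ?case
    using e rep_closed[OF e(1) gs] rep_rep[OF e(1) gs] NStep.IH[OF e(4) trans_edge_carrier[OF e(1) a]]
      starts_act[OF e(4), of "rv e" "trans_edge e ?a"] rv[OF e(1)] trans_edge_closed[OF e(1) a] by simp
qed

text \<open>If \<open>h s = s1 a\<close> and \<open>g s1 = s2 b\<close> with \<open>a\<close> and
  \<open>b\<close> in the edge group, then \<open>g h s = s2 (b a)\<close>. So the element passed to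
  the tail is the product of the elements passed on separately, and induction applies.\<close>

lemma act_mult:
  "ok v w \<Longrightarrow> g \<in> carrier (vg v) \<Longrightarrow> h \<in> carrier (vg v) \<Longrightarrow> act w v (g \<otimes>\<^bsub>vg v\<^esub> h) = act (act w v h) v g"
proof (induction w arbitrary: v g h)
  case (NEnd k)
  then interpret G: group "vg v" using vgroup_group by simp
  show ?case using NEnd by (simp add: G.m_assoc)
next
  case (NStep s e w)
  then have e: "e \<in> Edge \<Gamma>" "v = src \<Gamma> e" "s \<in> carrier (vg v)" "ok (tgt \<Gamma> e) w" by auto
  interpret G: group "vg v" using vsrc e by auto
  let ?m = "(\<otimes>\<^bsub>vg v\<^esub>)" and ?i = "\<lambda>x. inv\<^bsub>vg v\<^esub> x"
  define s1 where "s1 = rep e (?m h s)"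
  define a where "a = ?m (?i s1) (?m h s)"
  have hs: "?m h s \<in> carrier (vg (src \<Gamma> e))"
    using G.m_closed[OF NStep.prems(3) e(3)] e(2) by simp
  have s1: "s1 \<in> carrier (vg v)" using rep_closed[OF e(1) hs] e(2) by (simp add: s1_def)
  have a: "a \<in> imE e" using rep_in[OF e(1) hs] e(2) by (simp add: a_def s1_def)
  have ac: "a \<in> carrier (vg v)" using imE_carrier a e by simp
  have hs_eq: "?m h s = ?m s1 a"
    unfolding a_def s1_def e(2) by (rule rep_decomp[OF e(1) hs[unfolded e(2)]])
  have ghs: "?m (?m g h) s = ?m (?m g s1) a" using NStep.prems(2,3) e(3) s1 ac hs_eq by (simp add: G.m_assoc)
  have gs1: "?m g s1 \<in> carrier (vg (src \<Gamma> e))"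
    using G.m_closed[OF NStep.prems(2) s1] e(2) by simp
  define s2 where "s2 = rep e (?m g s1)"
  have s2: "s2 \<in> carrier (vg v)" using rep_closed[OF e(1) gs1] e(2) by (simp add: s2_def)
  have s2': "rep e (?m (?m g h) s) = s2"
    unfolding ghs s2_def using rep_mult_right[OF e(1) gs1 a] e(2) by simp
  define b where "b = ?m (?i s2) (?m g s1)"
  have b: "b \<in> imE e" using rep_in[OF e(1) gs1] e(2) by (simp add: b_def s2_def)
  have ab: "?m (?i s2) (?m (?m g h) s) = ?m b a"
    unfolding ghs b_def using s2 NStep.prems(2) s1 ac by (simp add: G.m_assoc)
  have "act w (tgt \<Gamma> e) (trans_edge e (?m b a)) =
      act (act w (tgt \<Gamma> e) (trans_edge e a)) (tgt \<Gamma> e) (trans_edge e b)"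
    using NStep.IH[OF e(4) trans_edge_carrier[OF e(1) b] trans_edge_carrier[OF e(1) a]]
      trans_edge_mult[OF e(1) b a] e(2) by simp
  then show ?case
    by (simp add: s2' ab flip: s1_def a_def s2_def b_def)
qed

lemma act_one: "ok v w \<Longrightarrow> act w v \<one>\<^bsub>vg v\<^esub> = w"
proof (induction w arbitrary: v)
  case (NEnd k)
  then interpret G: group "vg v" using vgroup_group by simp
  show ?case using NEnd by simp
next
  case (NStep s e w)
  then interpret G: group "vg v" using vsrc by auto
  show ?case using NStep by (auto simp: trans_edge_one)
qed

section \<open>Multiplication by a stable letter\<close>

primrec ntl :: "('g, 'e) nform \<Rightarrow> ('g, 'e) nform" where
  "ntl (NEnd g) = NEnd g" | "ntl (NStep s e w) = w"

definition tq :: "'e \<Rightarrow> ('g, 'e) nform \<Rightarrow> ('g, 'e) nform" where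
  "tq e w = (if starts (rv e) w then ntl w else NStep \<one>\<^bsub>vg (src \<Gamma> e)\<^esub> e w)"

lemma rep_one: "e \<in> Edge \<Gamma> \<Longrightarrow> rep e \<one>\<^bsub>vg (src \<Gamma> e)\<^esub> = \<one>\<^bsub>vg (src \<Gamma> e)\<^esub>"
  using rep_eq_one_iff subgroup.one_closed[OF imE_subgroup] group.is_monoid[OF vsrc, THEN monoid.one_closed]
  by blast

lemma tq_ok: "e \<in> Edge \<Gamma> \<Longrightarrow> ok (tgt \<Gamma> e) w \<Longrightarrow> ok (src \<Gamma> e) (tq e w)"
  using rv[of e] rep_one[of e] group.is_monoid[OF vsrc[of e], THEN monoid.one_closed]
  by (auto simp: tq_def starts_def)

lemma tq_inverse: "e \<in> Edge \<Gamma> \<Longrightarrow> ok (tgt \<Gamma> e) w \<Longrightarrow> tq (rv e) (tq e w) = w"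
  using rv[of e] by (auto simp: tq_def starts_def)

text \<open>The relation of an edge, realized on normal forms. Both cases of \<open>tq\<close> occur
  on the two sides together, because an element of the edge group does not affect
  \<open>starts\<close>.\<close>

lemma tq_act:
  assumes e: "e \<in> Edge \<Gamma>" and w: "ok (tgt \<Gamma> e) w" and a: "a \<in> carrier (egroup \<GG> e)"
  shows "tq e (act w (tgt \<Gamma> e) (emono \<GG> (rv e) a)) = act (tq e w) (src \<Gamma> e) (emono \<GG> e a)"
proof -
  have r: "rv e \<in> Edge \<Gamma>" "src \<Gamma> (rv e) = tgt \<Gamma> e" "tgt \<Gamma> (rv e) = src \<Gamma> e" "rv (rv e) = e" using rv[OF e] by auto
  interpret G: group "vg (src \<Gamma> e)" using e by (rule vsrc)
  interpret G': group "vg (tgt \<Gamma> e)" using e by (rule vtgt)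
  have ia: "emono \<GG> e a \<in> imE e" "emono \<GG> (rv e) a \<in> imE (rv e)"
    using a egroup_group(2)[OF e] by (auto simp: imE_def)
  have ca: "emono \<GG> e a \<in> carrier (vg (src \<Gamma> e))" "emono \<GG> (rv e) a \<in> carrier (vg (tgt \<Gamma> e))"
    using a e emono_closed emono_rev_closed by auto
  have st: "starts (rv e) (act w (tgt \<Gamma> e) (emono \<GG> (rv e) a)) \<longleftrightarrow> starts (rv e) w"
    using starts_act[OF w r(1,2) ia(2)] .
  have r1: "rep e (emono \<GG> e a) = \<one>\<^bsub>vg (src \<Gamma> e)\<^esub>" using rep_eq_one_iff[OF e ca(1)] ia by simp
  have r2: "rep (rv e) (emono \<GG> (rv e) a) = \<one>\<^bsub>vg (tgt \<Gamma> e)\<^esub>" using rep_eq_one_iff[OF r(1)] ca ia r by simp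
  have t2: "trans_edge (rv e) (emono \<GG> (rv e) a) = emono \<GG> e a"
    using trans_edge_emono[OF r(1)] r a egroup_group(2)[OF e] by simp
  show ?thesis
  proof (cases "starts (rv e) w")
    case True
    then obtain y where y: "w = NStep \<one>\<^bsub>vg (tgt \<Gamma> e)\<^esub> (rv e) y" using r by (auto simp: starts_def)
    show ?thesis using True st unfolding tq_def by (simp add: y r2 ca t2 r)
  next
    case False
    then show ?thesis using st ca unfolding tq_def by (simp add: r1 trans_edge_emono[OF e a])
  qed
qed

lemma foldr_tq_ok: "edge_path \<Gamma> u es v \<Longrightarrow> ok v w \<Longrightarrow> ok u (foldr tq es w)"
  by (induction es arbitrary: u) (auto intro!: tq_ok)

lemma T_path: "edge_path T u es v \<Longrightarrow> edge_path \<Gamma> u es v"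
  by (induction es arbitrary: u) (auto simp: T_maps T_vert T_edges)

text \<open>A closed path in the tree backtracks, and at that place two operators \<open>tq\<close>
  cancel, so the path can be shortened. Hence transport along the maximal tree depends on the end
  points only.\<close>

lemma foldr_tq_closed: "edge_path T u es u \<Longrightarrow> ok u w \<Longrightarrow> foldr tq es w = w"
proof (induction "length es" arbitrary: es rule: less_induct)
  case less
  show ?case
  proof (cases "es = []")
    case False
    then have "backtracks T es" using closed_path_backtracks[OF T_serre T_acyclic] less.prems by blast
    then obtain a e b where es: "es = a @ [e, rv e] @ b" unfolding backtracks_def T_maps by blast
    then obtain x where x: "edge_path T u a x" "edge_path T x ([e, rv e] @ b) u"
      using less.prems edge_path_append[OF T_serre] by blast
    then have e: "e \<in> Edge T" "src T e = x" by auto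
    have b: "edge_path T x b u" using x serre_rev[OF T_serre e(1)] e(2) T_maps by simp
    have "ok x (foldr tq b w)" using foldr_tq_ok[OF T_path[OF b]] less.prems by blast
    then have "tq e (tq (rv e) (foldr tq b w)) = foldr tq b w"
      using tq_inverse[of "rv e" "foldr tq b w"] rv[OF T_edges[OF e(1)]] e T_maps by simp
    then have "foldr tq es w = foldr tq (a @ b) w" using es by simp
    moreover have "edge_path T u (a @ b) u" using x b edge_path_append[OF T_serre] by blast
    ultimately show ?thesis using less.hyps[of "a @ b"] less.prems es by simp
  qed simp
qed

lemma foldr_tq_rev:
  "edge_path \<Gamma> u es v \<Longrightarrow> ok u w \<Longrightarrow> foldr tq es (foldr tq (path_rev \<Gamma> es) w) = w"
proof (induction es arbitrary: u w)
  case (Cons e es)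
  then have e: "e \<in> Edge \<Gamma>" "src \<Gamma> e = u" "edge_path \<Gamma> (tgt \<Gamma> e) es v" by auto
  have w: "ok (tgt \<Gamma> e) (tq (rv e) w)" using tq_ok[of "rv e" w] rv[OF e(1)] e Cons by simp
  show ?case using Cons.IH[OF e(3) w] tq_inverse[of "rv e" w] rv[OF e(1)] e Cons.prems
    by (simp add: path_rev_simps)
qed (simp add: path_rev_simps)

lemma path_rev_rev: "edge_path \<Gamma> u es v \<Longrightarrow> path_rev \<Gamma> (path_rev \<Gamma> es) = es"
  by (induction es arbitrary: u) (auto simp: path_rev_def rev_map rv)

lemma foldr_tq_eq:
  assumes "edge_path T u a v" "edge_path T u b v" "ok v w"
  shows "foldr tq a w = foldr tq b w"
proof -
  have r: "path_rev T b = path_rev \<Gamma> b" by (simp add: path_rev_def T_maps)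
  have rb: "edge_path T v (path_rev \<Gamma> b) u" using edge_path_rev[OF T_serre assms(2)] r by simp
  have oka: "ok u (foldr tq a w)" "ok u (foldr tq b w)" using foldr_tq_ok T_path assms by blast+
  have "edge_path T u (a @ path_rev \<Gamma> b) u" using assms(1) rb edge_path_append[OF T_serre] by blast
  then have "foldr tq (a @ path_rev \<Gamma> b) (foldr tq b w) = foldr tq b w" using foldr_tq_closed oka by blast
  moreover have "foldr tq (path_rev \<Gamma> b) (foldr tq b w) = w"
    using foldr_tq_rev[OF T_path[OF rb] assms(3)] path_rev_rev[OF T_path[OF assms(2)]] by simp
  ultimately show ?thesis by simp
qed

section \<open>Transport to a base vertex\<close>

definition v0 :: 'v where "v0 = (SOME v. v \<in> Vert \<Gamma>)"

lemma v0: "v0 \<in> Vert \<Gamma>"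
  using gog unfolding v0_def finite_graph_of_groups_def by (metis ex_in_conv someI)

definition tpath :: "'v \<Rightarrow> 'e list" where "tpath v = (SOME es. edge_path T v0 es v)"

lemma tpath: "v \<in> Vert \<Gamma> \<Longrightarrow> edge_path T v0 (tpath v) v"
  unfolding tpath_def by (rule someI_ex) (use T_conn v0 in \<open>auto simp: connected_graph_def T_vert\<close>)

text \<open>Forms at different vertices make up different sets. Transport along the maximal tree
  identifies each of them with the forms at \<open>v0\<close>, so that all generators act on a
  single set: every letter acts at its own vertex, between \<open>from_base\<close> and
  \<open>to_base\<close>.\<close>

definition to_base :: "'v \<Rightarrow> ('g, 'e) nform \<Rightarrow> ('g, 'e) nform" where
  "to_base v = foldr tq (tpath v)"
definition from_base :: "'v \<Rightarrow> ('g, 'e) nform \<Rightarrow> ('g, 'e) nform" where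
  "from_base v = foldr tq (path_rev \<Gamma> (tpath v))"

lemma base_ok: "v \<in> Vert \<Gamma> \<Longrightarrow> ok v w \<Longrightarrow> ok v0 (to_base v w)"
  "v \<in> Vert \<Gamma> \<Longrightarrow> ok v0 w \<Longrightarrow> ok v (from_base v w)"
  unfolding to_base_def from_base_def
  using foldr_tq_ok T_path[OF tpath] edge_path_rev[OF serre] by blast+

lemma to_from_base: "v \<in> Vert \<Gamma> \<Longrightarrow> ok v0 w \<Longrightarrow> to_base v (from_base v w) = w"
  unfolding to_base_def from_base_def using foldr_tq_rev T_path[OF tpath] by blast

lemma from_to_base: "v \<in> Vert \<Gamma> \<Longrightarrow> ok v w \<Longrightarrow> from_base v (to_base v w) = w"
  unfolding to_base_def from_base_def
  using foldr_tq_rev[OF edge_path_rev[OF serre T_path[OF tpath]]] path_rev_rev[OF T_path[OF tpath]] by metis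

text \<open>The tree path to the source, extended by \<open>e\<close>, is one more tree path to the
  target, so both transports agree. This is the relation that makes stable letters of tree edges
  trivial.\<close>

lemma to_base_tree_edge:
  assumes "e \<in> Edge T" "ok (tgt \<Gamma> e) w"
  shows "to_base (src \<Gamma> e) (tq e w) = to_base (tgt \<Gamma> e) w"
proof -
  have e: "e \<in> Edge \<Gamma>" using T_edges assms by blast
  have "edge_path T v0 (tpath (src \<Gamma> e) @ [e]) (tgt \<Gamma> e)"
    using tpath[of "src \<Gamma> e"] assms rv[OF e] by (auto simp: edge_path_append[OF T_serre] T_maps T_vert)
  then show ?thesis using foldr_tq_eq[OF _ tpath[OF rv(5)[OF e]] assms(2)]
    unfolding to_base_def by (metis foldr.simps foldr_append comp_apply id_apply)
qed

fun letter_act :: "('v, 'e, 'g) fgen \<times> bool \<Rightarrow> ('g, 'e) nform \<Rightarrow> ('g, 'e) nform" where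
  "letter_act (VElt v g, s) w = to_base v (act (from_base v w) v (if s then g else inv\<^bsub>vg v\<^esub> g))"
| "letter_act (Stable e, True) w = to_base (src \<Gamma> e) (tq e (from_base (tgt \<Gamma> e) w))"
| "letter_act (Stable e, False) w = to_base (tgt \<Gamma> e) (tq (rv e) (from_base (src \<Gamma> e) w))"

lemma letter_act_cases:
  assumes "l \<in> fund_gens \<GG> P \<times> UNIV"
  obtains v g s where "l = (VElt v g, s)" "v \<in> Vert \<Gamma>" "g \<in> carrier (vg v)" | e where "l = (Stable e, True)" "e \<in> P"
  | e where "l = (Stable e, False)" "e \<in> P"
  using assms by (cases l; cases "snd l") (auto simp: fund_gens_def)

lemma letter_act_ok: "l \<in> fund_gens \<GG> P \<times> UNIV \<Longrightarrow> ok v0 w \<Longrightarrow> ok v0 (letter_act l w)"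
proof (erule letter_act_cases)
  fix v g s assume "ok v0 w" "l = (VElt v g, s)" "v \<in> Vert \<Gamma>" "g \<in> carrier (vg v)"
  then show ?thesis using group.inv_closed[OF vgroup_group] by (auto intro!: base_ok act_ok)
next
  fix e assume "ok v0 w" "l = (Stable e, True)" "e \<in> P"
  then show ?thesis using rv[OF P_edges[of e]] P_edges[of e] by (auto intro!: base_ok tq_ok)
next
  fix e assume a: "ok v0 w" "l = (Stable e, False)" "e \<in> P"
  then show ?thesis using rv[OF P_edges[of e]] P_edges[of e] tq_ok[of "rv e"] base_ok by simp
qed

lemma letter_act_inverse:
  assumes "x \<in> fund_gens \<GG> P" "ok v0 w"
  shows "letter_act (x, s) (letter_act (x, \<not> s) w) = w"
proof -
  have "(x, s) \<in> fund_gens \<GG> P \<times> UNIV" using assms by simp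
  then show ?thesis
  proof (cases rule: letter_act_cases)
    case (1 v g s')
    interpret G: group "vg v" using 1 vgroup_group by blast
    have o: "ok v (from_base v w)" using base_ok 1 assms by blast
    define g' where "g' = (if s then g else inv\<^bsub>vg v\<^esub> g)"
    have g': "g' \<in> carrier (vg v)" "(if s then inv\<^bsub>vg v\<^esub> g else g) = inv\<^bsub>vg v\<^esub> g'" using 1 by (auto simp: g'_def)
    have "letter_act (x, s) (letter_act (x, \<not> s) w) =
      to_base v (act (from_base v (to_base v (act (from_base v w) v (inv\<^bsub>vg v\<^esub> g')))) v g')"
      using 1 g' by (cases s) (auto simp: g'_def)
    also have "\<dots> = to_base v (act (act (from_base v w) v (inv\<^bsub>vg v\<^esub> g')) v g')"
      using 1 o g' by (simp add: from_to_base act_ok)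
    also have "\<dots> = to_base v (act (from_base v w) v (g' \<otimes>\<^bsub>vg v\<^esub> inv\<^bsub>vg v\<^esub> g'))"
      using o g' by (subst act_mult) auto
    also have "\<dots> = w" using g' o act_one to_from_base 1 assms by simp
    finally show ?thesis .
  next
    case (2 e)
    have e: "e \<in> Edge \<Gamma>" using 2 P_edges by blast
    have o: "ok (src \<Gamma> e) (from_base (src \<Gamma> e) w)" using base_ok rv[OF e] assms by blast
    then have o2: "ok (tgt \<Gamma> e) (tq (rv e) (from_base (src \<Gamma> e) w))" using tq_ok[of "rv e"] rv[OF e] by simp
    show ?thesis using 2 o o2 rv[OF e] tq_inverse[of "rv e"] assms by (simp add: from_to_base to_from_base)
  next
    case (3 e)
    have e: "e \<in> Edge \<Gamma>" using 3 P_edges by blast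
    have o: "ok (tgt \<Gamma> e) (from_base (tgt \<Gamma> e) w)" using base_ok rv[OF e] assms by blast
    then have o2: "ok (src \<Gamma> e) (tq e (from_base (tgt \<Gamma> e) w))" using tq_ok[of e] rv[OF e] e by simp
    show ?thesis using 3 o o2 rv[OF e] tq_inverse[OF e] assms by (simp add: from_to_base to_from_base)
  qed
qed

lemma letter_act_rel:
  assumes "(u, v) \<in> fund_rels \<GG> T P" and w: "ok v0 w"
  shows "foldr letter_act u w = foldr letter_act v w"
proof -
  consider x g h where "u = [(VElt x g, True), (VElt x h, True)]" "v = [(VElt x (g \<otimes>\<^bsub>vg x\<^esub> h), True)]"
      "x \<in> Vert \<Gamma>" "g \<in> carrier (vg x)" "h \<in> carrier (vg x)"
    | e a where "u = [(Stable e, True), (VElt (tgt \<Gamma> e) (emono \<GG> (rv e) a), True), (Stable e, False)]"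
      "v = [(VElt (src \<Gamma> e) (emono \<GG> e a), True)]" "e \<in> P" "a \<in> carrier (egroup \<GG> e)"
    | f where "u = [(Stable f, True)]" "v = []" "f \<in> Edge T"
    using assms(1) unfolding fund_rels_def by blast
  then show ?thesis
  proof cases
    case 1
    have "ok x (from_base x w)" using base_ok 1 w by blast
    then show ?thesis using 1 by (simp add: from_to_base act_ok act_mult)
  next
    case 2
    have e: "e \<in> Edge \<Gamma>" using 2 P_edges by blast
    let ?y = "from_base (src \<Gamma> e) w"
    have o: "ok (src \<Gamma> e) ?y" using base_ok rv[OF e] w by blast
    then have o2: "ok (tgt \<Gamma> e) (tq (rv e) ?y)" using tq_ok[of "rv e"] rv[OF e] by simp
    have o3: "ok (tgt \<Gamma> e) (act (tq (rv e) ?y) (tgt \<Gamma> e) (emono \<GG> (rv e) a))"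
      using act_ok o2 emono_rev_closed[OF e] 2 by blast
    have "tq e (act (tq (rv e) ?y) (tgt \<Gamma> e) (emono \<GG> (rv e) a)) = act ?y (src \<Gamma> e) (emono \<GG> e a)"
      using tq_act[OF e o2] 2 tq_inverse[of "rv e"] o rv[OF e] by simp
    then show ?thesis using 2 o2 o3 rv[OF e] by (simp add: from_to_base)
  next
    case 3
    have f: "f \<in> Edge \<Gamma>" using 3 T_edges by blast
    then show ?thesis using 3 to_base_tree_edge[OF 3(3)] base_ok rv[OF f] w to_from_base by simp
  qed
qed

section \<open>The fundamental group acting on normal forms\<close>

definition Hact :: "('v, 'e, 'g) fgen word set \<Rightarrow> ('g, 'e) nform \<Rightarrow> ('g, 'e) nform" where
  "Hact c y = foldr letter_act (SOME u. u \<in> W \<and> c = cl u) y"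

lemma Hact_cl:
  assumes "u \<in> W" "ok v0 y"
  shows "Hact (cl u) y = foldr letter_act u y"
proof -
  let ?u = "SOME u'. u' \<in> W \<and> cl u = cl u'"
  have "?u \<in> W \<and> cl u = cl ?u" by (rule someI[of _ u]) (use assms in simp)
  then have "pres_eq (fund_gens \<GG> P) (fund_rels \<GG> T P) u ?u" using cl_eq_iff[OF assms(1)] by simp
  then have "foldr letter_act u y = foldr letter_act ?u y"
  proof (rule pres_eq_action[where X = "{y. ok v0 y}" and L = letter_act, rotated 3])
    show "y \<in> {y. ok v0 y}" using assms(2) by simp
  qed (simp_all only: mem_Collect_eq letter_act_ok letter_act_inverse letter_act_rel)
  then show ?thesis by (simp add: Hact_def)
qed

lemma foldr_letter_ok: "u \<in> W \<Longrightarrow> ok v0 y \<Longrightarrow> ok v0 (foldr letter_act u y)"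
  by (induction u) (auto intro!: letter_act_ok)

lemma Hact_mult: "c \<in> carrier H \<Longrightarrow> d \<in> carrier H \<Longrightarrow> ok v0 y \<Longrightarrow> Hact (c \<otimes>\<^bsub>H\<^esub> d) y = Hact c (Hact d y)"
  by (elim cl_cases) (simp add: cl_mult Hact_cl foldr_letter_ok)

lemma Hact_vh: "v \<in> Vert \<Gamma> \<Longrightarrow> g \<in> carrier (vg v) \<Longrightarrow> ok v y \<Longrightarrow> Hact (vh v g) (to_base v y) = to_base v (act y v g)"
  unfolding vh_def by (subst Hact_cl) (auto simp: from_to_base base_ok intro: vgen)

lemma Hact_te: "e \<in> Edge \<Gamma> \<Longrightarrow> ok (tgt \<Gamma> e) y \<Longrightarrow> Hact (te e) (to_base (tgt \<Gamma> e) y) = to_base (src \<Gamma> e) (tq e y)"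
proof -
  assume e: "e \<in> Edge \<Gamma>" and y: "ok (tgt \<Gamma> e) y"
  show ?thesis
  proof (cases "e \<in> P")
    case True
    then show ?thesis unfolding te_P[OF True] using y rv[OF e]
      by (subst Hact_cl) (auto simp: from_to_base base_ok intro: sgen)
  next
    case False
    then have "te e = cl [(Stable (rv e), False)]" by (simp add: te_def stable_letter_def)
    then show ?thesis using y rv[OF e] sgen[of "rv e"] P_rv[OF e] False
      by (simp add: Hact_cl from_to_base base_ok)
  qed
qed

text \<open>The pairs \<open>(g\<^sub>i, e\<^sub>i)\<close> encode the word \<open>g\<^sub>1 t\<^sub>1 \<dots> g\<^sub>n t\<^sub>n\<close>.\<close>

fun word_path :: "'v \<Rightarrow> ('g \<times> 'e) list \<Rightarrow> 'v \<Rightarrow> bool" where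
  "word_path u [] v \<longleftrightarrow> u = v"
| "word_path u ((g, e) # xs) v \<longleftrightarrow> e \<in> Edge \<Gamma> \<and> src \<Gamma> e = u \<and> g \<in> carrier (vg u) \<and> word_path (tgt \<Gamma> e) xs v"

fun word_val :: "('g \<times> 'e) list \<Rightarrow> ('v, 'e, 'g) fgen word set" where
  "word_val [] = \<one>\<^bsub>H\<^esub>"
| "word_val ((g, e) # xs) = vh (src \<Gamma> e) g \<otimes>\<^bsub>H\<^esub> te e \<otimes>\<^bsub>H\<^esub> word_val xs"

fun reduced :: "('g \<times> 'e) list \<Rightarrow> bool" where
  "reduced ((g, e) # (h, f) # xs) \<longleftrightarrow> (f = rv e \<longrightarrow> h \<notin> imE f) \<and> reduced ((h, f) # xs)"
| "reduced _ \<longleftrightarrow> True"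

lemma word_val_closed: "word_path u xs v \<Longrightarrow> word_val xs \<in> carrier H"
  by (induction xs arbitrary: u) (auto simp: vh_closed te_closed rv)

text \<open>Built up from the trivial form, a reduced word never meets the cancelling case of
  \<open>tq\<close>, so each pair adds a step. Recording the leading representative
  \<open>rep e g\<close> carries the induction: it is trivial only if \<open>g\<close> lies in the
  edge group, which reducedness forbids after the inverse edge.\<close>

lemma Hact_word_val:
  assumes "word_path u ((g, e) # xs) v" "reduced ((g, e) # xs)" "v \<in> Vert \<Gamma>"
  shows "\<exists>y. ok u (NStep (rep e g) e y) \<and>
    Hact (word_val ((g, e) # xs)) (to_base v (NEnd \<one>\<^bsub>vg v\<^esub>)) = to_base u (NStep (rep e g) e y)"
  using assms
proof (induction xs arbitrary: u g e)
  case Nil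
  then have e: "e \<in> Edge \<Gamma>" "src \<Gamma> e = u" "g \<in> carrier (vg u)" "tgt \<Gamma> e = v" by auto
  interpret G: group "vg u" using vsrc e by auto
  interpret G': group "vg v" using vtgt e by auto
  let ?y = "NEnd \<one>\<^bsub>vg v\<^esub>"
  have o: "ok (tgt \<Gamma> e) ?y" using e Nil by simp
  have t: "tq e ?y = NStep \<one>\<^bsub>vg u\<^esub> e ?y" using e by (simp add: tq_def starts_def)
  have o2: "ok u (tq e ?y)" using tq_ok[OF e(1) o] e by simp
  have b: "ok v0 (to_base v ?y)" using base_ok o e Nil by simp
  have "Hact (word_val [(g, e)]) (to_base v ?y) = Hact (vh u g) (Hact (te e) (to_base v ?y))"
    using e te_closed vh_closed[of u g] rv(4)[OF e(1)] b by (simp add: Hact_mult)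
  also have "\<dots> = to_base u (act (tq e ?y) u g)"
    using Hact_te[OF e(1) o] e Hact_vh[OF _ e(3) o2] rv(4)[OF e(1)] by simp
  finally have "Hact (word_val [(g, e)]) (to_base v ?y) = to_base u (act (tq e ?y) u g)" .
  moreover obtain y where "act (tq e ?y) u g = NStep (rep e g) e y" using t e by simp
  ultimately show ?case using act_ok[OF o2 e(3)] by metis
next
  case (Cons hf xs)
  obtain h f where hf: "hf = (h, f)" by force
  have e: "e \<in> Edge \<Gamma>" "src \<Gamma> e = u" "g \<in> carrier (vg u)" and p: "word_path (tgt \<Gamma> e) ((h, f) # xs) v"
    and red: "f = rv e \<longrightarrow> h \<notin> imE f" "reduced ((h, f) # xs)" using Cons.prems hf by auto
  interpret G: group "vg u" using vsrc e by auto
  let ?b = "to_base v (NEnd \<one>\<^bsub>vg v\<^esub>)"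
  obtain z where z: "ok (tgt \<Gamma> e) (NStep (rep f h) f z)"
    "Hact (word_val ((h, f) # xs)) ?b = to_base (tgt \<Gamma> e) (NStep (rep f h) f z)"
    using Cons.IH[OF p red(2) Cons.prems(3)] by blast
  let ?y = "NStep (rep f h) f z"
  have f: "f \<in> Edge \<Gamma>" "h \<in> carrier (vg (src \<Gamma> f))" using p by auto
  have "\<not> starts (rv e) ?y"
    using red(1) rep_eq_one_iff[OF f] rv[OF e(1)] by (auto simp: starts_def)
  then have t: "tq e ?y = NStep \<one>\<^bsub>vg u\<^esub> e ?y" using e by (simp add: tq_def)
  have o2: "ok u (tq e ?y)" using tq_ok[OF e(1) z(1)] e by simp
  have vo: "ok v0 ?b"
    using base_ok(1)[OF Cons.prems(3)] Cons.prems(3) group.is_monoid[OF vgroup_group, THEN monoid.one_closed] by simp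
  have wc: "word_val ((h, f) # xs) \<in> carrier H" using word_val_closed[OF p] .
  have b: "ok v0 (to_base (tgt \<Gamma> e) ?y)" using base_ok z rv[OF e(1)] by blast
  have "Hact (word_val ((g, e) # (h, f) # xs)) ?b = Hact (vh u g) (Hact (te e) (Hact (word_val ((h, f) # xs)) ?b))"
    unfolding word_val.simps(2)[of g e]
    using e te_closed vh_closed[of u g] rv(4)[OF e(1)] vo wc b z by (simp add: Hact_mult del: word_val.simps)
  also have "\<dots> = to_base u (act (tq e ?y) u g)"
    using Hact_te[OF e(1) z(1)] z(2) e Hact_vh[OF _ e(3) o2] rv(4)[OF e(1)] by simp
  finally have "Hact (word_val ((g, e) # (h, f) # xs)) ?b = to_base u (act (tq e ?y) u g)" .
  moreover obtain y where "act (tq e ?y) u g = NStep (rep e g) e y" using t e by simp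
  ultimately show ?case using act_ok[OF o2 e(3)] hf by metis
qed

text \<open>Applied to the trivial form, a nonempty reduced word gives a form with at least one
  step, whereas an element of a vertex group gives an \<open>NEnd\<close>. For a single loop this is
  Britton's lemma.\<close>

theorem reduced_word_nontrivial:
  assumes "word_path v xs v" "reduced xs" "xs \<noteq> []" "v \<in> Vert \<Gamma>" "h \<in> carrier (vg v)"
  shows "word_val xs \<noteq> vh v h"
proof
  assume eq: "word_val xs = vh v h"
  obtain g e ys where xs: "xs = (g, e) # ys" using assms(3) by (cases xs) auto
  interpret G: group "vg v" using vgroup_group assms by auto
  obtain y where y: "ok v (NStep (rep e g) e y)"
    "Hact (word_val xs) (to_base v (NEnd \<one>\<^bsub>vg v\<^esub>)) = to_base v (NStep (rep e g) e y)"
    using Hact_word_val assms xs by blast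
  have "Hact (vh v h) (to_base v (NEnd \<one>\<^bsub>vg v\<^esub>)) = to_base v (NEnd h)"
    using Hact_vh[of v h "NEnd \<one>\<^bsub>vg v\<^esub>"] assms by simp
  then have "from_base v (to_base v (NStep (rep e g) e y)) = from_base v (to_base v (NEnd h))"
    using y eq by simp
  then show False using from_to_base assms y by simp
qed

end

section \<open>The Bass-Serre tree\<close>

lemma (in group) lcos_eq_iff:
  assumes "subgroup K G" "x \<in> carrier G" "y \<in> carrier G"
  shows "x <# K = y <# K \<longleftrightarrow> inv x \<otimes> y \<in> K"
proof
  assume "x <# K = y <# K"
  moreover have "y \<in> y <# K"
    using subgroup.one_closed[OF assms(1)] assms(3) unfolding l_coset_def by force
  ultimately have "y \<in> x <# K" by simp
  then obtain k where "k \<in> K" "y = x \<otimes> k" by (auto simp: l_coset_def)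
  then show "inv x \<otimes> y \<in> K" using assms subgroup.mem_carrier[OF assms(1)] by (simp flip: m_assoc)
next
  assume k: "inv x \<otimes> y \<in> K"
  have "y = x \<otimes> (inv x \<otimes> y)" using assms by (simp flip: m_assoc)
  then have "y \<in> x <# K" using k unfolding l_coset_def by blast
  then show "x <# K = y <# K" using l_repr_independence assms by blast
qed

lemma (in group) lcos_mult_subgroup:
  assumes "subgroup K G" "subgroup L G" "K \<subseteq> L" "x \<in> carrier G"
  shows "(x <# K) <#> L = x <# L"
proof -
  have "K <#> L = L"
  proof
    show "K <#> L \<subseteq> L" using assms(3) subgroup.m_closed[OF assms(2)] by (auto simp: set_mult_def)
    show "L \<subseteq> K <#> L"
    proof
      fix l assume l: "l \<in> L"
      then have "l = \<one> \<otimes> l" using subgroup.mem_carrier[OF assms(2)] by simp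
      then show "l \<in> K <#> L" using l subgroup.one_closed[OF assms(1)] unfolding set_mult_def by blast
    qed
  qed
  then show ?thesis using setmult_lcos_assoc[of K L x] assms subgroup.subset by metis
qed

context splitting
begin

definition HV :: "'v \<Rightarrow> ('v, 'e, 'g) fgen word set set" where "HV v = vertex_subgroup \<GG> T P v"
definition HE :: "'e \<Rightarrow> ('v, 'e, 'g) fgen word set set" where "HE e = edge_subgroup \<GG> T P e"
definition bs where "bs = bass_serre_tree \<GG> T P"

lemma HV_eq: "HV v = vh v ` carrier (vg v)"
  by (simp add: HV_def vertex_subgroup_def vh_def)

lemma HE_eq: "HE e = vh (src \<Gamma> e) ` imE e"
  by (auto simp: HE_def edge_subgroup_def vh_def imE_def)

lemma HV_subgroup: "v \<in> Vert \<Gamma> \<Longrightarrow> subgroup (HV v) H"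
  unfolding HV_eq using group_hom.img_is_subgroup[OF vh_group_hom] .

lemma HE_subgroup: "e \<in> Edge \<Gamma> \<Longrightarrow> subgroup (HE e) H"
  unfolding HE_eq using group_hom.subgroup_img_is_subgroup[OF vh_group_hom imE_subgroup] rv by blast

lemma HE_HV: "e \<in> Edge \<Gamma> \<Longrightarrow> HE e \<subseteq> HV (src \<Gamma> e)"
  unfolding HE_eq HV_eq using imE_carrier by blast

lemmas HV_sub = subgroup.subset[OF HV_subgroup] and HE_sub = subgroup.subset[OF HE_subgroup]

lemma te_conj:
  assumes "e \<in> Edge \<Gamma>" "x \<in> HE (rv e)"
  shows "te e \<otimes>\<^bsub>H\<^esub> x \<otimes>\<^bsub>H\<^esub> inv\<^bsub>H\<^esub> (te e) \<in> HE e"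
proof -
  obtain a where a: "a \<in> carrier (egroup \<GG> e)" "x = vh (tgt \<Gamma> e) (emono \<GG> (rv e) a)"
    using assms egroup_group(2) rv by (auto simp: HE_eq imE_def)
  then show ?thesis using te_relation[OF assms(1) a(1)] by (auto simp: HE_eq imE_def)
qed

lemma te_conj_inv:
  assumes "e \<in> Edge \<Gamma>" "x \<in> HE e"
  shows "inv\<^bsub>H\<^esub> (te e) \<otimes>\<^bsub>H\<^esub> x \<otimes>\<^bsub>H\<^esub> te e \<in> HE (rv e)"
  using te_conj[of "rv e" x] assms rv[OF assms(1)] te_rv[OF assms(1)] te_closed[OF assms(1)] by simp

lemma edge_coset_te:
  assumes g: "g \<in> carrier H" and e: "e \<in> Edge \<Gamma>"
  shows "(g <#\<^bsub>H\<^esub> HE e) #>\<^bsub>H\<^esub> te e = (g \<otimes>\<^bsub>H\<^esub> te e) <#\<^bsub>H\<^esub> HE (rv e)"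
proof
  have t: "te e \<in> carrier H" using te_closed[OF e] .
  have c: "x \<in> carrier H" if "x \<in> HE e" for x using that HE_sub[OF e] by blast
  have c': "x \<in> carrier H" if "x \<in> HE (rv e)" for x using that HE_sub rv[OF e] by blast
  show "(g <#\<^bsub>H\<^esub> HE e) #>\<^bsub>H\<^esub> te e \<subseteq> (g \<otimes>\<^bsub>H\<^esub> te e) <#\<^bsub>H\<^esub> HE (rv e)"
  proof
    fix y assume "y \<in> (g <#\<^bsub>H\<^esub> HE e) #>\<^bsub>H\<^esub> te e"
    then obtain x where x: "x \<in> HE e" "y = g \<otimes>\<^bsub>H\<^esub> x \<otimes>\<^bsub>H\<^esub> te e" by (auto simp: l_coset_def r_coset_def)
    have "te e \<otimes>\<^bsub>H\<^esub> (inv\<^bsub>H\<^esub> (te e) \<otimes>\<^bsub>H\<^esub> x \<otimes>\<^bsub>H\<^esub> te e) = x \<otimes>\<^bsub>H\<^esub> te e"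
      using t c[OF x(1)] by (simp flip: H.m_assoc)
    then have "y = (g \<otimes>\<^bsub>H\<^esub> te e) \<otimes>\<^bsub>H\<^esub> (inv\<^bsub>H\<^esub> (te e) \<otimes>\<^bsub>H\<^esub> x \<otimes>\<^bsub>H\<^esub> te e)"
      using x(2) g t c[OF x(1)] by (simp add: H.m_assoc)
    then show "y \<in> (g \<otimes>\<^bsub>H\<^esub> te e) <#\<^bsub>H\<^esub> HE (rv e)"
      using te_conj_inv[OF e x(1)] unfolding l_coset_def by blast
  qed
  show "(g \<otimes>\<^bsub>H\<^esub> te e) <#\<^bsub>H\<^esub> HE (rv e) \<subseteq> (g <#\<^bsub>H\<^esub> HE e) #>\<^bsub>H\<^esub> te e"
  proof
    fix y assume "y \<in> (g \<otimes>\<^bsub>H\<^esub> te e) <#\<^bsub>H\<^esub> HE (rv e)"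
    then obtain x where x: "x \<in> HE (rv e)" "y = g \<otimes>\<^bsub>H\<^esub> te e \<otimes>\<^bsub>H\<^esub> x" by (auto simp: l_coset_def)
    have "y = g \<otimes>\<^bsub>H\<^esub> (te e \<otimes>\<^bsub>H\<^esub> x \<otimes>\<^bsub>H\<^esub> inv\<^bsub>H\<^esub> (te e)) \<otimes>\<^bsub>H\<^esub> te e"
      using x(2) g t c'[OF x(1)] by (simp add: H.m_assoc)
    then show "y \<in> (g <#\<^bsub>H\<^esub> HE e) #>\<^bsub>H\<^esub> te e"
      using te_conj[OF e x(1)] unfolding l_coset_def r_coset_def by blast
  qed
qed

lemma te_coset_vertex:
  assumes g: "g \<in> carrier H" and e: "e \<in> Edge \<Gamma>"
  shows "((g <#\<^bsub>H\<^esub> HE e) #>\<^bsub>H\<^esub> te e) <#>\<^bsub>H\<^esub> HV (tgt \<Gamma> e) = (g \<otimes>\<^bsub>H\<^esub> te e) <#\<^bsub>H\<^esub> HV (tgt \<Gamma> e)"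
  unfolding edge_coset_te[OF g e]
  using H.lcos_mult_subgroup[OF HE_subgroup HV_subgroup HE_HV, of "rv e"] rv[OF e] g te_closed[OF e] by simp

lemma bs_Vert: "Vert bs = {(v, g <#\<^bsub>H\<^esub> HV v) | v g. v \<in> Vert \<Gamma> \<and> g \<in> carrier H}"
  and bs_Edge: "Edge bs = {(e, g <#\<^bsub>H\<^esub> HE e) | e g. e \<in> Edge \<Gamma> \<and> g \<in> carrier H}"
  by (simp_all add: bs_def bass_serre_tree_def Let_def HV_def HE_def)

lemma bs_maps:
  assumes "e \<in> Edge \<Gamma>" "g \<in> carrier H"
  shows "src bs (e, g <#\<^bsub>H\<^esub> HE e) = (src \<Gamma> e, g <#\<^bsub>H\<^esub> HV (src \<Gamma> e))"
    "tgt bs (e, g <#\<^bsub>H\<^esub> HE e) = (tgt \<Gamma> e, (g \<otimes>\<^bsub>H\<^esub> te e) <#\<^bsub>H\<^esub> HV (tgt \<Gamma> e))"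
    "rev_edge bs (e, g <#\<^bsub>H\<^esub> HE e) = (rv e, (g \<otimes>\<^bsub>H\<^esub> te e) <#\<^bsub>H\<^esub> HE (rv e))"
proof -
  have "src bs (e, C) = (src \<Gamma> e, C <#>\<^bsub>H\<^esub> HV (src \<Gamma> e))"
    "tgt bs (e, C) = (tgt \<Gamma> e, (C #>\<^bsub>H\<^esub> te e) <#>\<^bsub>H\<^esub> HV (tgt \<Gamma> e))"
    "rev_edge bs (e, C) = (rv e, C #>\<^bsub>H\<^esub> te e)" for C
    by (simp_all add: bs_def bass_serre_tree_def Let_def HV_def HE_def te_def)
  then show "src bs (e, g <#\<^bsub>H\<^esub> HE e) = (src \<Gamma> e, g <#\<^bsub>H\<^esub> HV (src \<Gamma> e))"
    "tgt bs (e, g <#\<^bsub>H\<^esub> HE e) = (tgt \<Gamma> e, (g \<otimes>\<^bsub>H\<^esub> te e) <#\<^bsub>H\<^esub> HV (tgt \<Gamma> e))"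
    "rev_edge bs (e, g <#\<^bsub>H\<^esub> HE e) = (rv e, (g \<otimes>\<^bsub>H\<^esub> te e) <#\<^bsub>H\<^esub> HE (rv e))"
    using H.lcos_mult_subgroup[OF HE_subgroup HV_subgroup HE_HV] rv assms te_coset_vertex edge_coset_te
    by simp_all
qed

lemma bs_EdgeE:
  assumes "x \<in> Edge bs"
  obtains e g where "e \<in> Edge \<Gamma>" "g \<in> carrier H" "x = (e, g <#\<^bsub>H\<^esub> HE e)"
  using assms by (auto simp: bs_Edge)

lemma bs_VertE:
  assumes "x \<in> Vert bs"
  obtains v g where "v \<in> Vert \<Gamma>" "g \<in> carrier H" "x = (v, g <#\<^bsub>H\<^esub> HV v)"
  using assms by (auto simp: bs_Vert)

lemma bs_EdgeI: "e \<in> Edge \<Gamma> \<Longrightarrow> g \<in> carrier H \<Longrightarrow> (e, g <#\<^bsub>H\<^esub> HE e) \<in> Edge bs"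
  and bs_VertI: "v \<in> Vert \<Gamma> \<Longrightarrow> g \<in> carrier H \<Longrightarrow> (v, g <#\<^bsub>H\<^esub> HV v) \<in> Vert bs"
  by (auto simp: bs_Edge bs_Vert)

lemma bs_serre: "serre_graph bs"
  unfolding serre_graph_def
proof
  fix x assume "x \<in> Edge bs"
  then obtain e g where e: "e \<in> Edge \<Gamma>" and g: "g \<in> carrier H" and x: "x = (e, g <#\<^bsub>H\<^esub> HE e)"
    by (rule bs_EdgeE)
  have gt: "g \<otimes>\<^bsub>H\<^esub> te e \<in> carrier H" using g te_closed[OF e] by simp
  have "g \<otimes>\<^bsub>H\<^esub> te e \<otimes>\<^bsub>H\<^esub> te (rv e) = g" using g te_closed[OF e] te_rv[OF e] by (simp add: H.m_assoc)
  then show "rev_edge bs x \<in> Edge bs \<and> rev_edge bs x \<noteq> x \<and> rev_edge bs (rev_edge bs x) = x \<and>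
      src bs x \<in> Vert bs \<and> tgt bs x \<in> Vert bs \<and> tgt bs (rev_edge bs x) = src bs x"
    unfolding x bs_maps[OF e g] bs_maps[OF rv(1)[OF e] gt]
    using rv[OF e] g gt by (auto intro!: bs_EdgeI bs_VertI)
qed

text \<open>The label in the first component is left alone, and its type is arbitrary, so the same
  function translates vertices and edges.\<close>

definition lt :: "('v, 'e, 'g) fgen word set \<Rightarrow> 'x \<times> ('v, 'e, 'g) fgen word set set \<Rightarrow>
    'x \<times> ('v, 'e, 'g) fgen word set set" where
  "lt h x = (fst x, h <#\<^bsub>H\<^esub> snd x)"

lemma lt_vert: "v \<in> Vert \<Gamma> \<Longrightarrow> g \<in> carrier H \<Longrightarrow> h \<in> carrier H \<Longrightarrow>
    lt h (v, g <#\<^bsub>H\<^esub> HV v) = (v, (h \<otimes>\<^bsub>H\<^esub> g) <#\<^bsub>H\<^esub> HV v)"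
  by (simp add: lt_def H.lcos_m_assoc HV_sub)

lemma lt_edge: "e \<in> Edge \<Gamma> \<Longrightarrow> g \<in> carrier H \<Longrightarrow> h \<in> carrier H \<Longrightarrow>
    lt h (e, g <#\<^bsub>H\<^esub> HE e) = (e, (h \<otimes>\<^bsub>H\<^esub> g) <#\<^bsub>H\<^esub> HE e)"
  by (simp add: lt_def H.lcos_m_assoc HE_sub)

lemma lt_Vert: "x \<in> Vert bs \<Longrightarrow> h \<in> carrier H \<Longrightarrow> lt h x \<in> Vert bs"
  by (erule bs_VertE) (simp add: lt_vert bs_VertI)

lemma lt_Edge: "x \<in> Edge bs \<Longrightarrow> h \<in> carrier H \<Longrightarrow> lt h x \<in> Edge bs"
  by (erule bs_EdgeE) (simp add: lt_edge bs_EdgeI)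

lemma lt_src: "x \<in> Edge bs \<Longrightarrow> h \<in> carrier H \<Longrightarrow> src bs (lt h x) = lt h (src bs x)"
  by (erule bs_EdgeE) (simp add: lt_edge bs_maps lt_vert rv)

lemma lt_tgt: "x \<in> Edge bs \<Longrightarrow> h \<in> carrier H \<Longrightarrow> tgt bs (lt h x) = lt h (tgt bs x)"
  by (erule bs_EdgeE) (simp add: lt_edge bs_maps lt_vert rv te_closed H.m_assoc)

lemma lt_path:
  "edge_path bs u es w \<Longrightarrow> h \<in> carrier H \<Longrightarrow> edge_path bs (lt h u) (map (lt h) es) (lt h w)"
  by (induction es arbitrary: u) (auto simp: lt_Vert lt_Edge lt_src lt_tgt)

lemma lt_mult_vert: "x \<in> Vert bs \<Longrightarrow> h \<in> carrier H \<Longrightarrow> k \<in> carrier H \<Longrightarrow> lt (h \<otimes>\<^bsub>H\<^esub> k) x = lt h (lt k x)"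
  by (erule bs_VertE) (simp add: lt_vert H.m_assoc)

lemma lt_mult_edge: "x \<in> Edge bs \<Longrightarrow> h \<in> carrier H \<Longrightarrow> k \<in> carrier H \<Longrightarrow> lt (h \<otimes>\<^bsub>H\<^esub> k) x = lt h (lt k x)"
  by (erule bs_EdgeE) (simp add: lt_edge H.m_assoc)

lemma lt_one_vert: "x \<in> Vert bs \<Longrightarrow> lt \<one>\<^bsub>H\<^esub> x = x"
  by (erule bs_VertE) (simp add: lt_vert)

lemma lt_one_edge: "x \<in> Edge bs \<Longrightarrow> lt \<one>\<^bsub>H\<^esub> x = x"
  by (erule bs_EdgeE) (simp add: lt_edge)

lemma lt_fix_vert:
  assumes "v \<in> Vert \<Gamma>" "g \<in> carrier H" "h \<in> carrier H" "lt h (v, g <#\<^bsub>H\<^esub> HV v) = (v, g <#\<^bsub>H\<^esub> HV v)"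
  shows "inv\<^bsub>H\<^esub> g \<otimes>\<^bsub>H\<^esub> h \<otimes>\<^bsub>H\<^esub> g \<in> HV v"
  using assms H.lcos_eq_iff[OF HV_subgroup[OF assms(1)] assms(2), of "h \<otimes>\<^bsub>H\<^esub> g"]
  by (simp add: lt_vert H.m_assoc)

lemma lt_fix_edge:
  assumes "e \<in> Edge \<Gamma>" "g \<in> carrier H" "h \<in> carrier H" "lt h (e, g <#\<^bsub>H\<^esub> HE e) = (e, g <#\<^bsub>H\<^esub> HE e)"
  shows "inv\<^bsub>H\<^esub> g \<otimes>\<^bsub>H\<^esub> h \<otimes>\<^bsub>H\<^esub> g \<in> HV (src \<Gamma> e)"
  using assms H.lcos_eq_iff[OF HE_subgroup[OF assms(1)] assms(2), of "h \<otimes>\<^bsub>H\<^esub> g"] HE_HV[OF assms(1)]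
  by (auto simp add: lt_edge H.m_assoc)

section \<open>Connectedness\<close>

definition joined :: "'v \<times> ('v, 'e, 'g) fgen word set set \<Rightarrow> 'v \<times> ('v, 'e, 'g) fgen word set set \<Rightarrow> bool" where
  "joined x y \<longleftrightarrow> (\<exists>es. edge_path bs x es y)"

lemma joined_refl: "x \<in> Vert bs \<Longrightarrow> joined x x"
  unfolding joined_def by (rule exI[of _ "[]"]) simp

lemma joined_sym: "joined x y \<Longrightarrow> joined y x"
  unfolding joined_def using edge_path_rev[OF bs_serre] by blast

lemma joined_trans: "joined x y \<Longrightarrow> joined y z \<Longrightarrow> joined x z"
  unfolding joined_def using edge_path_append[OF bs_serre] by blast

lemma joined_edge: "x \<in> Edge bs \<Longrightarrow> joined (src bs x) (tgt bs x)"
  unfolding joined_def using serre_rev[OF bs_serre] by (intro exI[of _ "[x]"]) auto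

lemma joined_lt: "joined x y \<Longrightarrow> h \<in> carrier H \<Longrightarrow> joined (lt h x) (lt h y)"
  unfolding joined_def using lt_path by blast

text \<open>Since \<open>te\<close> is trivial on tree edges, these vertices span a lift of the
  maximal tree and are joined to each other.\<close>

definition bv :: "'v \<Rightarrow> 'v \<times> ('v, 'e, 'g) fgen word set set" where
  "bv v = (v, \<one>\<^bsub>H\<^esub> <#\<^bsub>H\<^esub> HV v)"

lemma bv_Vert: "v \<in> Vert \<Gamma> \<Longrightarrow> bv v \<in> Vert bs"
  unfolding bv_def by (rule bs_VertI) auto

lemma joined_bv_path: "edge_path T u es v \<Longrightarrow> joined (bv u) (bv v)"
proof (induction es arbitrary: u)
  case Nil then show ?case using bv_Vert by (auto intro!: joined_refl simp: T_vert)
next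
  case (Cons e es)
  then have e: "e \<in> Edge T" "e \<in> Edge \<Gamma>" "src \<Gamma> e = u" and p: "edge_path T (tgt \<Gamma> e) es v"
    using T_edges by (auto simp: T_maps)
  have "joined (src bs (e, \<one>\<^bsub>H\<^esub> <#\<^bsub>H\<^esub> HE e)) (tgt bs (e, \<one>\<^bsub>H\<^esub> <#\<^bsub>H\<^esub> HE e))"
    using e by (intro joined_edge bs_EdgeI) auto
  then have "joined (bv u) (bv (tgt \<Gamma> e))" using e te_tree[OF e(1)] by (simp add: bs_maps bv_def)
  then show ?case using Cons.IH[OF p] joined_trans by blast
qed

lemma joined_bv: "u \<in> Vert \<Gamma> \<Longrightarrow> v \<in> Vert \<Gamma> \<Longrightarrow> joined (bv u) (bv v)"
  using T_conn joined_bv_path unfolding connected_graph_def T_vert by blast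

lemma lt_bv: "v \<in> Vert \<Gamma> \<Longrightarrow> h \<in> carrier H \<Longrightarrow> lt h (bv v) = (v, h <#\<^bsub>H\<^esub> HV v)"
  unfolding bv_def by (simp add: lt_vert)

text \<open>Every generator moves the lifted tree to a translate that is joined to it: an element of
  the group of \<open>v\<close> fixes \<open>bv v\<close>, and \<open>te e\<close> takes
  \<open>bv (tgt \<Gamma> e)\<close> to a neighbour of \<open>bv (src \<Gamma> e)\<close>.
  Translation invariance of \<open>joined\<close> carries this over to products of
  generators.\<close>

lemma joined_lt_bv:
  assumes "x \<in> carrier H" "u \<in> Vert \<Gamma>"
  shows "joined (lt x (bv u)) (bv u)"
  using assms
proof (induction arbitrary: u rule: H_induct)
  case one then show ?case using lt_one_vert bv_Vert joined_refl by simp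
next
  case (vertex v g x)
  have c: "vh v g \<in> carrier H" using vertex vh_closed by blast
  have 1: "joined (lt (vh v g) (lt x (bv u))) (lt (vh v g) (bv u))"
    using joined_lt[OF vertex.IH[OF vertex.prems] c] .
  have 2: "joined (lt (vh v g) (bv u)) (lt (vh v g) (bv v))"
    using joined_lt[OF joined_bv[OF vertex.prems vertex(1)] c] .
  have "vh v g <#\<^bsub>H\<^esub> HV v = \<one>\<^bsub>H\<^esub> <#\<^bsub>H\<^esub> HV v"
    using H.lcos_eq_iff[OF HV_subgroup[OF vertex(1)] H.one_closed c] vertex(2) c by (auto simp: HV_eq)
  then have 3: "lt (vh v g) (bv v) = bv v" using lt_bv[OF vertex(1) c] by (simp add: bv_def)
  show ?case using 1 2 3 joined_bv[OF vertex(1) vertex.prems] joined_trans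
      lt_mult_vert[OF bv_Vert[OF vertex.prems] c vertex(3)] by metis
next
  case (edge e x)
  have c: "te e \<in> carrier H" using edge te_closed by blast
  have 1: "joined (lt (te e) (lt x (bv u))) (lt (te e) (bv u))"
    using joined_lt[OF edge.IH[OF edge.prems] c] .
  have 2: "joined (lt (te e) (bv u)) (lt (te e) (bv (tgt \<Gamma> e)))"
    using joined_lt[OF joined_bv[OF edge.prems rv(5)[OF edge(1)]] c] .
  have "joined (src bs (e, \<one>\<^bsub>H\<^esub> <#\<^bsub>H\<^esub> HE e)) (tgt bs (e, \<one>\<^bsub>H\<^esub> <#\<^bsub>H\<^esub> HE e))"
    by (intro joined_edge bs_EdgeI edge(1)) auto
  then have 3: "joined (lt (te e) (bv (tgt \<Gamma> e))) (bv (src \<Gamma> e))"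
    using edge c rv[OF edge(1)] by (intro joined_sym[of "bv (src \<Gamma> e)"]) (simp add: bs_maps lt_bv, simp add: bv_def)
  have 4: "joined (bv (src \<Gamma> e)) (bv u)" using joined_bv[OF rv(4)[OF edge(1)] edge.prems] .
  show ?case using 1 2 3 4 joined_trans
      lt_mult_vert[OF bv_Vert[OF edge.prems] c edge(2)] by metis
qed

lemma bs_connected: "connected_graph bs"
proof -
  have "joined x (bv v0)" if "x \<in> Vert bs" for x
    using that
  proof (rule bs_VertE)
    fix v g assume v: "v \<in> Vert \<Gamma>" "g \<in> carrier H" "x = (v, g <#\<^bsub>H\<^esub> HV v)"
    then have "x = lt g (bv v)" by (simp add: lt_bv)
    then show ?thesis using joined_lt_bv[OF v(2,1)] joined_bv[OF v(1) v0] joined_trans by metis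
  qed
  then have "joined x y" if "x \<in> Vert bs" "y \<in> Vert bs" for x y
    using that joined_sym joined_trans by metis
  then show ?thesis unfolding connected_graph_def joined_def by blast
qed

text \<open>Consecutive edge cosets along a path differ by an element of the vertex group at their
  common vertex and a stable letter, so a path can be read as a word. A place where the word is not
  reduced is one where an edge is followed by its inverse. The clause on \<open>hd es\<close> is
  there for the induction: it identifies the second edge as the inverse of the first in that
  case.\<close>

lemma bs_path_word:
  assumes "edge_path bs (v, g <#\<^bsub>H\<^esub> HV v) es (w, g' <#\<^bsub>H\<^esub> HV w)" "g \<in> carrier H" "v \<in> Vert \<Gamma>"
    "\<not> backtracks bs es"
  shows "\<exists>xs. word_path v xs w \<and> length xs = length es \<and> reduced xs \<and>
     (g \<otimes>\<^bsub>H\<^esub> word_val xs) <#\<^bsub>H\<^esub> HV w = g' <#\<^bsub>H\<^esub> HV w \<and>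
     (\<forall>x e ys. xs = (x, e) # ys \<longrightarrow> hd es = (e, (g \<otimes>\<^bsub>H\<^esub> vh v x) <#\<^bsub>H\<^esub> HE e))"
  using assms
proof (induction es arbitrary: v g)
  case Nil
  then show ?case by (intro exI[of _ "[]"]) auto
next
  case (Cons f es)
  then have f: "f \<in> Edge bs" "src bs f = (v, g <#\<^bsub>H\<^esub> HV v)"
    and p: "edge_path bs (tgt bs f) es (w, g' <#\<^bsub>H\<^esub> HV w)" by auto
  obtain e c where e: "e \<in> Edge \<Gamma>" and c: "c \<in> carrier H" and fe: "f = (e, c <#\<^bsub>H\<^esub> HE e)"
    using f(1) by (rule bs_EdgeE)
  have ev: "src \<Gamma> e = v" "c <#\<^bsub>H\<^esub> HV v = g <#\<^bsub>H\<^esub> HV v" using f(2) unfolding fe bs_maps[OF e c] by auto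
  have "inv\<^bsub>H\<^esub> g \<otimes>\<^bsub>H\<^esub> c \<in> HV v"
    using H.lcos_eq_iff[OF HV_subgroup[OF Cons.prems(3)] Cons.prems(2) c] ev by simp
  then obtain x where x: "x \<in> carrier (vg v)" "vh v x = inv\<^bsub>H\<^esub> g \<otimes>\<^bsub>H\<^esub> c" by (auto simp: HV_eq)
  have cx: "c = g \<otimes>\<^bsub>H\<^esub> vh v x" using x(2) c Cons.prems(2) by (simp flip: H.m_assoc)
  have hx: "vh v x \<in> carrier H" using vh_closed x Cons.prems(3) by blast
  have t: "te e \<in> carrier H" using te_closed[OF e] .
  define g1 where "g1 = c \<otimes>\<^bsub>H\<^esub> te e"
  have g1: "g1 \<in> carrier H" using c t by (simp add: g1_def)
  have tf: "tgt bs f = (tgt \<Gamma> e, g1 <#\<^bsub>H\<^esub> HV (tgt \<Gamma> e))" and rf: "rev_edge bs f = (rv e, g1 <#\<^bsub>H\<^esub> HE (rv e))"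
    unfolding fe g1_def using bs_maps[OF e c] by auto
  have nb: "\<not> backtracks bs es" using Cons.prems(4) backtracks_append[of bs es "[f]" "[]"] by auto
  obtain xs where xs: "word_path (tgt \<Gamma> e) xs w" "length xs = length es" "reduced xs"
    "(g1 \<otimes>\<^bsub>H\<^esub> word_val xs) <#\<^bsub>H\<^esub> HV w = g' <#\<^bsub>H\<^esub> HV w"
    "\<And>y e' ys. xs = (y, e') # ys \<Longrightarrow> hd es = (e', (g1 \<otimes>\<^bsub>H\<^esub> vh (tgt \<Gamma> e) y) <#\<^bsub>H\<^esub> HE e')"
    using Cons.IH[OF p[unfolded tf] g1 rv(5)[OF e] nb] by blast
  have wc: "word_val xs \<in> carrier H" using word_val_closed[OF xs(1)] .
  have red: "reduced ((x, e) # xs)"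
  proof (cases xs)
    case (Cons ye ys)
    obtain y e' where ye: "ye = (y, e')" by force
    have y: "e' \<in> Edge \<Gamma>" "src \<Gamma> e' = tgt \<Gamma> e" "y \<in> carrier (vg (tgt \<Gamma> e))" using xs(1) Cons ye by auto
    have "y \<notin> imE e'" if "e' = rv e"
    proof
      assume "y \<in> imE e'"
      then have "vh (tgt \<Gamma> e) y \<in> HE (rv e)" using that rv[OF e] by (auto simp: HE_eq)
      then have "(g1 \<otimes>\<^bsub>H\<^esub> vh (tgt \<Gamma> e) y) <#\<^bsub>H\<^esub> HE (rv e) = g1 <#\<^bsub>H\<^esub> HE (rv e)"
        using H.lcos_eq_iff[OF HE_subgroup[OF rv(1)[OF e]] g1, of "g1 \<otimes>\<^bsub>H\<^esub> vh (tgt \<Gamma> e) y"]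
          vh_closed[OF rv(5)[OF e] y(3)] g1 by (simp flip: H.m_assoc)
      then have "hd es = rev_edge bs f" using xs(5) Cons ye that rf by simp
      moreover have "es \<noteq> []" using xs(2) Cons by auto
      ultimately have "f # es = [] @ [f, rev_edge bs f] @ tl es" by (cases es) auto
      then show False using Cons.prems(4) unfolding backtracks_def by blast
    qed
    then show ?thesis using xs(3) Cons ye by simp
  qed simp
  have "g \<otimes>\<^bsub>H\<^esub> word_val ((x, e) # xs) = g1 \<otimes>\<^bsub>H\<^esub> word_val xs"
    using ev(1) Cons.prems(2) hx t wc by (simp add: g1_def cx H.m_assoc)
  then have "(g \<otimes>\<^bsub>H\<^esub> word_val ((x, e) # xs)) <#\<^bsub>H\<^esub> HV w = g' <#\<^bsub>H\<^esub> HV w" using xs(4) by simp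
  moreover have "word_path v ((x, e) # xs) w" "length ((x, e) # xs) = length (f # es)"
    using e ev(1) x(1) xs(1,2) by auto
  moreover have "hd (f # es) = (e, (g \<otimes>\<^bsub>H\<^esub> vh v x) <#\<^bsub>H\<^esub> HE e)" using fe cx by simp
  ultimately show ?case using red by blast
qed

text \<open>A circuit at the vertex \<open>g HV v\<close> would be read as a nonempty reduced word
  with value in \<open>HV v\<close>.\<close>

lemma bs_acyclic: "\<not> circuit bs es"
proof
  assume "circuit bs es"
  then obtain u where u: "edge_path bs u es u" and ne: "es \<noteq> []" and nb: "\<not> backtracks bs es"
    by (auto simp: circuit_iff)
  obtain v g where v: "v \<in> Vert \<Gamma>" and g: "g \<in> carrier H" and ug: "u = (v, g <#\<^bsub>H\<^esub> HV v)"
    using edge_path_end[OF u] by (rule bs_VertE)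
  obtain xs where xs: "word_path v xs v" "length xs = length es" "reduced xs"
    "(g \<otimes>\<^bsub>H\<^esub> word_val xs) <#\<^bsub>H\<^esub> HV v = g <#\<^bsub>H\<^esub> HV v"
    using bs_path_word[OF u[unfolded ug] g v nb] by blast
  have w: "word_val xs \<in> carrier H" using word_val_closed[OF xs(1)] .
  have "inv\<^bsub>H\<^esub> g \<otimes>\<^bsub>H\<^esub> (g \<otimes>\<^bsub>H\<^esub> word_val xs) \<in> HV v"
    using H.lcos_eq_iff[OF HV_subgroup[OF v] g, of "g \<otimes>\<^bsub>H\<^esub> word_val xs"] xs(4) g w by simp
  then have "word_val xs \<in> HV v" using g w by (simp flip: H.m_assoc)
  then obtain h where "h \<in> carrier (vg v)" "word_val xs = vh v h" by (auto simp: HV_eq)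
  moreover have "xs \<noteq> []" using ne xs(2) by auto
  ultimately show False using reduced_word_nontrivial xs v by blast
qed

theorem bass_serre_tree_is_tree: "tree_graph bs"
  unfolding tree_graph_def using bs_serre bs_connected bs_acyclic bv_Vert[OF v0] by blast

lemma bs_orientation: "orientation bs (bass_serre_pos \<GG> T P)"
proof -
  have pos: "bass_serre_pos \<GG> T P = {x \<in> Edge bs. fst x \<in> P}" by (simp add: bass_serre_pos_def bs_def)
  have r: "fst (rev_edge bs x) \<in> P \<longleftrightarrow> fst x \<notin> P" if "x \<in> Edge bs" for x
    using that by (rule bs_EdgeE) (simp add: bs_maps P_rv)
  have rr: "rev_edge bs x \<in> Edge bs" "rev_edge bs (rev_edge bs x) = x" if "x \<in> Edge bs" for x
    using serre_rev[OF bs_serre that] by auto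
  have "x \<in> rev_edge bs ` {x \<in> Edge bs. fst x \<in> P}" if "x \<in> Edge bs" "fst x \<notin> P" for x
    using that r rr by (intro image_eqI[of _ _ "rev_edge bs x"]) auto
  then show ?thesis unfolding orientation_def pos using r rr by auto
qed

end

section \<open>The metric of a tree\<close>

locale oriented_tree =
  fixes Y :: "('a, 'b) sgraph" and Q :: "'b set"
  assumes tree: "tree_graph Y" and orient: "orientation Y Q"
begin

lemma serre: "serre_graph Y" and conn: "connected_graph Y" and acyclic: "\<not> circuit Y es"
  using tree by (simp_all add: tree_graph_def)

lemmas rv = serre_rev[OF serre]

lemma Q_edge: "e \<in> Q \<Longrightarrow> e \<in> Edge Y"
  using orient by (auto simp: orientation_def)

lemma Q_rev: "e \<in> Q \<Longrightarrow> rev_edge Y e \<notin> Q"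
  using orient by (auto simp: orientation_def)

lemma Q_cases: "e \<in> Edge Y \<Longrightarrow> e \<in> Q \<or> rev_edge Y e \<in> Q"
  using orient rv(3)[OF Q_edge] by (auto simp: orientation_def)

text \<open>\<open>avoid e u v\<close>: the vertices \<open>u\<close> and \<open>v\<close> lie on the same side of the edge \<open>e\<close>.\<close>

definition avoid :: "'b \<Rightarrow> 'a \<Rightarrow> 'a \<Rightarrow> bool" where
  "avoid e u v \<longleftrightarrow> (\<exists>es. edge_path Y u es v \<and> e \<notin> set es \<and> rev_edge Y e \<notin> set es)"

lemma avoid_refl: "u \<in> Vert Y \<Longrightarrow> avoid e u u"
  unfolding avoid_def by (rule exI[of _ "[]"]) simp

lemma avoid_trans: "avoid e u v \<Longrightarrow> avoid e v w \<Longrightarrow> avoid e u w"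
proof -
  assume "avoid e u v" "avoid e v w"
  then obtain a b where "edge_path Y u a v" "edge_path Y v b w" "e \<notin> set (a @ b)" "rev_edge Y e \<notin> set (a @ b)"
    unfolding avoid_def by auto
  then show "avoid e u w" unfolding avoid_def using edge_path_append[OF serre] by blast
qed

lemma avoid_sym: "e \<in> Edge Y \<Longrightarrow> avoid e u v \<Longrightarrow> avoid e v u"
proof -
  assume e: "e \<in> Edge Y" and "avoid e u v"
  then obtain a where a: "edge_path Y u a v" "e \<notin> set a" "rev_edge Y e \<notin> set a" unfolding avoid_def by blast
  have "edge_path Y v (path_rev Y a) u" using edge_path_rev[OF serre a(1)] .
  moreover have "rev_edge Y f \<noteq> e \<and> rev_edge Y f \<noteq> rev_edge Y e" if "f \<in> set a" for f
  proof -
    have "f \<in> Edge Y" using edge_path_edges[OF a(1)] that by blast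
    then show ?thesis using a(2,3) that rv(3)[OF e] rv(3)[of f] by metis
  qed
  then have "e \<notin> rev_edge Y ` set a" "rev_edge Y e \<notin> rev_edge Y ` set a" by (metis imageE)+
  then have "e \<notin> set (path_rev Y a)" "rev_edge Y e \<notin> set (path_rev Y a)"
    by (simp_all add: path_rev_def)
  ultimately show "avoid e v u" unfolding avoid_def by blast
qed

lemma avoid_edge: "f \<in> Edge Y \<Longrightarrow> f \<noteq> e \<Longrightarrow> f \<noteq> rev_edge Y e \<Longrightarrow> avoid e (src Y f) (tgt Y f)"
  unfolding avoid_def using rv[of f] by (intro exI[of _ "[f]"]) auto

lemma avoid_vert: "avoid e u v \<Longrightarrow> u \<in> Vert Y \<and> v \<in> Vert Y"
  unfolding avoid_def by (elim exE conjE) (simp add: edge_path_start[OF serre] edge_path_end)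

lemma path_shorten:
  assumes "edge_path Y u es v" "backtracks Y es"
  obtains es' where "edge_path Y u es' v" "length es' < length es" "set es' \<subseteq> set es"
proof -
  obtain a e b where es: "es = a @ [e, rev_edge Y e] @ b" using assms(2) unfolding backtracks_def by blast
  then obtain x where x: "edge_path Y u a x" "edge_path Y x ([e, rev_edge Y e] @ b) v"
    using assms(1) edge_path_append[OF serre] by blast
  then have "edge_path Y x b v" using rv[of e] by auto
  then have "edge_path Y u (a @ b) v" using x edge_path_append[OF serre] by blast
  then show ?thesis using that[of "a @ b"] es by auto
qed

text \<open>Closed up by the inverse of \<open>e\<close>, the path backtracks. The turn cannot
  involve the added edge, for then \<open>e\<close> would lie on the path; so it lies within the
  path, which becomes shorter by removing it.\<close>

lemma avoid_separates:
  assumes e: "e \<in> Edge Y"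
  shows "\<not> avoid e (src Y e) (tgt Y e)"
proof
  assume "avoid e (src Y e) (tgt Y e)"
  then obtain a where a: "edge_path Y (src Y e) a (tgt Y e)" "e \<notin> set a" "rev_edge Y e \<notin> set a"
    unfolding avoid_def by blast
  then show False
  proof (induction "length a" arbitrary: a rule: less_induct)
    case less
    have "edge_path Y (src Y e) (a @ [rev_edge Y e]) (src Y e)"
      using less.prems(1) rv[OF e] e by (auto simp: edge_path_append[OF serre])
    then have "backtracks Y (a @ [rev_edge Y e])" using closed_path_backtracks[OF serre acyclic] by blast
    then obtain c f b where c: "a @ [rev_edge Y e] = c @ [f, rev_edge Y f] @ b" unfolding backtracks_def by blast
    show False
    proof (cases b rule: rev_cases)
      case Nil
      then have c': "a = c @ [f]" "rev_edge Y e = rev_edge Y f" using c by auto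
      then have "f \<in> Edge Y" using edge_path_edges[OF less.prems(1)] by auto
      then have "e = f" using c'(2) rv(3) e by metis
      then show False using c' less.prems(2) by auto
    next
      case (snoc b' z)
      then have "a = c @ [f, rev_edge Y f] @ b'" using c by auto
      then have "backtracks Y a" unfolding backtracks_def by blast
      then obtain a' where "edge_path Y (src Y e) a' (tgt Y e)" "length a' < length a" "set a' \<subseteq> set a"
        using path_shorten[OF less.prems(1)] by blast
      then show False using less.hyps less.prems(2,3) by blast
    qed
  qed
qed

lemma avoid_total:
  assumes e: "e \<in> Edge Y" and v: "v \<in> Vert Y"
  shows "avoid e (src Y e) v \<or> avoid e (tgt Y e) v"
proof -
  obtain es where "edge_path Y v es (src Y e)" using conn v rv(4)[OF e] unfolding connected_graph_def by blast
  then have "avoid e (src Y e) v \<or> avoid e (tgt Y e) v" using v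
  proof (induction es arbitrary: v)
    case Nil then show ?case using avoid_refl by auto
  next
    case (Cons f es)
    then have f: "f \<in> Edge Y" "src Y f = v" "edge_path Y (tgt Y f) es (src Y e)" by auto
    show ?case
    proof (cases "f = e \<or> f = rev_edge Y e")
      case True
      then show ?thesis using f rv[OF e] avoid_refl Cons.prems by auto
    next
      case False
      then have "avoid e (tgt Y f) v" using avoid_sym[OF e avoid_edge[OF f(1)]] f by blast
      then show ?thesis using Cons.IH[OF f(3)] rv[OF f(1)] avoid_trans by blast
    qed
  qed
  then show ?thesis .
qed

section \<open>Sides of edges as coordinates\<close>

definition side :: "'b \<Rightarrow> 'a \<Rightarrow> real" where
  "side e v = (if avoid e (tgt Y e) v then 1 else 0)"

lemma side_01: "side e v = 0 \<or> side e v = 1"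
  by (simp add: side_def)

lemma side_tgt: "e \<in> Edge Y \<Longrightarrow> side e (tgt Y e) = 1"
  using avoid_refl rv by (simp add: side_def)

lemma side_src: "e \<in> Edge Y \<Longrightarrow> side e (src Y e) = 0"
  using avoid_separates avoid_sym unfolding side_def by metis

lemma side_eq_iff:
  assumes "e \<in> Edge Y" "u \<in> Vert Y" "v \<in> Vert Y"
  shows "side e u = side e v \<longleftrightarrow> avoid e u v"
proof
  assume eq: "side e u = side e v"
  show "avoid e u v"
  proof (cases "avoid e (tgt Y e) u")
    case True
    then have "avoid e (tgt Y e) v" using eq by (simp add: side_def split: if_splits)
    then show ?thesis using True avoid_sym[OF assms(1)] avoid_trans by blast
  next
    case False
    then have "\<not> avoid e (tgt Y e) v" using eq by (simp add: side_def split: if_splits)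
    then have "avoid e (src Y e) u" "avoid e (src Y e) v" using False avoid_total assms by blast+
    then show ?thesis using avoid_sym[OF assms(1)] avoid_trans by blast
  qed
next
  assume "avoid e u v"
  then have "avoid e (tgt Y e) u \<longleftrightarrow> avoid e (tgt Y e) v" using avoid_sym[OF assms(1)] avoid_trans by blast
  then show "side e u = side e v" by (simp add: side_def)
qed

lemma side_edge:
  "e \<in> Q \<Longrightarrow> f \<in> Q \<Longrightarrow> f \<noteq> e \<Longrightarrow> side e (src Y f) = side e (tgt Y f)"
  using side_eq_iff[of e "src Y f" "tgt Y f"] avoid_edge[of f e] Q_edge rv Q_rev by blast

text \<open>Let \<open>x\<close> be the end of \<open>e\<close> on the side of \<open>v\<close>. If
  \<open>v\<close> and \<open>x\<close> are on different sides of \<open>f\<close>, a path between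
  them that avoids \<open>e\<close> has to cross \<open>f\<close>, so it reaches an end of
  \<open>f\<close> without crossing \<open>e\<close>. Thus the side of \<open>e\<close> containing
  \<open>f\<close> and the side of \<open>f\<close> containing \<open>e\<close> together cover the
  tree.\<close>

lemma nested_vertices:
  assumes e: "e \<in> Q" and f: "f \<in> Q" and ne: "e \<noteq> f" and v: "v \<in> Vert Y"
  shows "side e v = side e (src Y f) \<or> side f v = side f (src Y e)"
proof (rule disjCI)
  assume n: "side f v \<noteq> side f (src Y e)"
  have E: "e \<in> Edge Y" "f \<in> Edge Y" using e f Q_edge by auto
  define x where "x = (if side e v = 1 then tgt Y e else src Y e)"
  have x: "x \<in> Vert Y" "side e x = side e v" "side f x = side f (src Y e)"
    using side_01[of e v] rv E side_tgt[OF E(1)] side_src[OF E(1)] side_edge[OF f e ne] by (auto simp: x_def)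
  then have "avoid e v x" using side_eq_iff[OF E(1) v x(1)] by simp
  then obtain es where es: "edge_path Y v es x" "e \<notin> set es" "rev_edge Y e \<notin> set es" unfolding avoid_def by blast
  have "\<not> avoid f v x" using side_eq_iff[OF E(2) v x(1)] x n by simp
  then have "f \<in> set es \<or> rev_edge Y f \<in> set es" using es(1) unfolding avoid_def by blast
  then obtain f' where f': "f' \<in> set es" "f' = f \<or> f' = rev_edge Y f" by blast
  then obtain a b where "es = a @ [f'] @ b" by (metis append_Cons append_Nil split_list)
  then have "edge_path Y v a (src Y f')" using es(1) by (auto simp: edge_path_append[OF serre])
  then have "avoid e v (src Y f')" using es \<open>es = a @ [f'] @ b\<close> unfolding avoid_def by auto
  then have "side e v = side e (src Y f')" using side_eq_iff[OF E(1) v] avoid_vert by blast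
  then show "side e v = side e (src Y f)" using f'(2) rv[OF E(2)] side_edge[OF e f] ne by metis
qed

text \<open>The projection of the tree to the edge \<open>e\<close>, identified with the unit
  interval: everything on one side of \<open>e\<close> is collapsed to the end of \<open>e\<close>
  on that side.\<close>

fun coord :: "'b \<Rightarrow> ('a, 'b) graph_point \<Rightarrow> real" where
  "coord e (VPoint v) = side e v"
| "coord e (EPoint f t) = (if f = e then t else side e (src Y f))"

abbreviation "X \<equiv> points (graph_complex Y Q)"

lemma points_iff: "p \<in> X \<longleftrightarrow> (\<exists>v\<in>Vert Y. p = VPoint v) \<or> (\<exists>e t. p = EPoint e t \<and> e \<in> Q \<and> 0 < t \<and> t < 1)"
  by (auto simp: graph_complex_def)

lemma coord_range: "p \<in> X \<Longrightarrow> 0 \<le> coord e p \<and> coord e p \<le> 1"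
  using side_01 by (cases p) (auto simp: points_iff, (metis zero_le_one order_refl)+)

lemma nested:
  assumes e: "e \<in> Q" and f: "f \<in> Q" and ne: "e \<noteq> f" and p: "p \<in> X"
  shows "coord e p = side e (src Y f) \<or> coord f p = side f (src Y e)"
proof (cases p)
  case (VPoint v) then show ?thesis using nested_vertices[OF e f ne] p by (auto simp: points_iff)
next
  case (EPoint g t)
  then have g: "g \<in> Q" using p by (auto simp: points_iff)
  show ?thesis using EPoint nested_vertices[OF e f ne, of "src Y g"] rv(4)[OF Q_edge[OF g]] ne by auto
qed

section \<open>Distance as a sum over the separating edges\<close>

definition supp :: "('a, 'b) graph_point \<Rightarrow> ('a, 'b) graph_point \<Rightarrow> 'b set" where
  "supp p q = {e \<in> Q. coord e p \<noteq> coord e q}"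

definition tdist :: "('a, 'b) graph_point \<Rightarrow> ('a, 'b) graph_point \<Rightarrow> real" where
  "tdist p q = (\<Sum>e\<in>supp p q. \<bar>coord e p - coord e q\<bar>)"

text \<open>Only the edges of a path joining two vertices can separate them.\<close>

lemma supp_vertices: "u \<in> Vert Y \<Longrightarrow> v \<in> Vert Y \<Longrightarrow> finite (supp (VPoint u) (VPoint v))"
proof -
  assume u: "u \<in> Vert Y" and v: "v \<in> Vert Y"
  obtain es where es: "edge_path Y u es v" using conn u v unfolding connected_graph_def by blast
  have "supp (VPoint u) (VPoint v) \<subseteq> set es \<union> rev_edge Y ` set es"
  proof
    fix e assume "e \<in> supp (VPoint u) (VPoint v)"
    then have e: "e \<in> Q" "side e u \<noteq> side e v" by (auto simp: supp_def)
    then have "\<not> avoid e u v" using side_eq_iff[OF Q_edge u v] by blast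
    then have "e \<in> set es \<or> rev_edge Y e \<in> set es" using es unfolding avoid_def by blast
    then show "e \<in> set es \<union> rev_edge Y ` set es" using rv(3)[OF Q_edge[OF e(1)]] by (metis UnCI imageI)
  qed
  then show ?thesis using finite_subset by blast
qed

lemma supp_trans: "supp p r \<subseteq> supp p q \<union> supp q r"
  by (auto simp: supp_def)

lemma supp_sym: "supp p q = supp q p"
  by (auto simp: supp_def)

definition near :: "('a, 'b) graph_point \<Rightarrow> 'a" where
  "near p = (case p of VPoint v \<Rightarrow> v | EPoint e t \<Rightarrow> src Y e)"

lemma near: "p \<in> X \<Longrightarrow> near p \<in> Vert Y \<and> finite (supp p (VPoint (near p)))"
proof (cases p)
  case (EPoint e t)
  assume "p \<in> X"
  then have "e \<in> Q" using EPoint by (auto simp: points_iff)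
  moreover have "supp p (VPoint (src Y e)) \<subseteq> {e}" using EPoint by (auto simp: supp_def split: if_splits)
  ultimately show ?thesis using EPoint rv(4)[OF Q_edge] finite_subset by (auto simp: near_def)
qed (auto simp: near_def supp_def points_iff)

lemma finite_supp: "p \<in> X \<Longrightarrow> q \<in> X \<Longrightarrow> finite (supp p q)"
proof -
  assume p: "p \<in> X" and q: "q \<in> X"
  have "supp p q \<subseteq> supp p (VPoint (near p)) \<union> (supp (VPoint (near p)) (VPoint (near q)) \<union> supp q (VPoint (near q)))"
    using supp_trans supp_sym by blast
  then show ?thesis using near[OF p] near[OF q] supp_vertices by (meson finite_UnI finite_subset)
qed

text \<open>This lets the three distances of a triangle be summed over one common set of
  edges.\<close>

lemma tdist_superset:
  assumes "finite F" "supp p q \<subseteq> F" "F \<subseteq> Q"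
  shows "tdist p q = (\<Sum>e\<in>F. \<bar>coord e p - coord e q\<bar>)"
  unfolding tdist_def by (rule sum.mono_neutral_left) (use assms in \<open>auto simp: supp_def\<close>)

lemma tdist_sym: "tdist p q = tdist q p"
  by (simp add: tdist_def supp_sym abs_minus_commute)

lemma tdist_nonneg: "0 \<le> tdist p q"
  unfolding tdist_def by (rule sum_nonneg) auto

lemma tdist_self: "tdist p p = 0"
  by (simp add: tdist_def supp_def)

lemma common_support:
  assumes "p \<in> X" "q \<in> X" "r \<in> X"
  obtains F where "finite F" "F \<subseteq> Q" "supp p q \<subseteq> F" "supp q r \<subseteq> F" "supp p r \<subseteq> F"
  using that[of "supp p q \<union> supp q r"] assms finite_supp supp_trans[of p r q]
  by (auto simp: supp_def)

lemma tdist_triangle: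
  assumes "p \<in> X" "q \<in> X" "r \<in> X"
  shows "tdist p r \<le> tdist p q + tdist q r"
proof -
  obtain F where F: "finite F" "F \<subseteq> Q" "supp p q \<subseteq> F" "supp q r \<subseteq> F" "supp p r \<subseteq> F"
    using common_support assms by blast
  show ?thesis unfolding tdist_superset[OF F(1,3,2)] tdist_superset[OF F(1,4,2)] tdist_superset[OF F(1,5,2)]
      sum.distrib[symmetric] by (rule sum_mono) auto
qed

text \<open>The triangle inequality holds coordinate by coordinate, so equality of the sums forces
  equality of the terms. Together with \<open>betweenI\<close> this turns betweenness in the tree
  into betweenness on the line for each edge.\<close>

lemma between_coords:
  assumes "p \<in> X" "m \<in> X" "q \<in> X" "e \<in> Q" "tdist p m + tdist m q = tdist p q"
  shows "\<bar>coord e p - coord e m\<bar> + \<bar>coord e m - coord e q\<bar> = \<bar>coord e p - coord e q\<bar>"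
proof -
  obtain F where F: "finite F" "F \<subseteq> Q" "supp p m \<subseteq> F" "supp m q \<subseteq> F" "supp p q \<subseteq> F"
    using common_support assms by blast
  show ?thesis
  proof (cases "e \<in> F")
    case True
    have "(\<Sum>e\<in>F. \<bar>coord e p - coord e q\<bar>) = (\<Sum>e\<in>F. \<bar>coord e p - coord e m\<bar> + \<bar>coord e m - coord e q\<bar>)"
      using assms(5) unfolding tdist_superset[OF F(1,3,2)] tdist_superset[OF F(1,4,2)] tdist_superset[OF F(1,5,2)]
      by (simp add: sum.distrib)
    then have "\<bar>coord e p - coord e q\<bar> = \<bar>coord e p - coord e m\<bar> + \<bar>coord e m - coord e q\<bar>"
      by (rule sum_mono_inv[where I = F]) (use True F in auto)
    then show ?thesis by simp
  next
    case False
    then have "coord e p = coord e m" "coord e m = coord e q" using F assms(4) unfolding supp_def by blast+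
    then show ?thesis by simp
  qed
qed

lemma betweenI:
  assumes "p \<in> X" "m \<in> X" "q \<in> X"
    "\<And>e. e \<in> Q \<Longrightarrow> \<bar>coord e p - coord e m\<bar> + \<bar>coord e m - coord e q\<bar> = \<bar>coord e p - coord e q\<bar>"
  shows "tdist p m + tdist m q = tdist p q"
proof -
  obtain F where F: "finite F" "F \<subseteq> Q" "supp p m \<subseteq> F" "supp m q \<subseteq> F" "supp p q \<subseteq> F"
    using common_support assms by blast
  show ?thesis unfolding tdist_superset[OF F(1,3,2)] tdist_superset[OF F(1,4,2)] tdist_superset[OF F(1,5,2)]
      sum.distrib[symmetric] by (rule sum.cong) (use F assms(4) in auto)
qed

text \<open>Two distinct edges divide the tree into only three of the four possible quadrants.\<close>

lemma median:
  assumes X: "p \<in> X" "m \<in> X" "x \<in> X" "y \<in> X" and b: "tdist x m + tdist m y = tdist x y"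
  shows "tdist p m + tdist m x = tdist p x \<or> tdist p m + tdist m y = tdist p y"
proof (rule ccontr)
  assume "\<not> ?thesis"
  then obtain e f where e: "e \<in> Q" "\<bar>coord e p - coord e m\<bar> + \<bar>coord e m - coord e x\<bar> \<noteq> \<bar>coord e p - coord e x\<bar>"
    and f: "f \<in> Q" "\<bar>coord f p - coord f m\<bar> + \<bar>coord f m - coord f y\<bar> \<noteq> \<bar>coord f p - coord f y\<bar>"
    using betweenI[OF X(1,2,3)] betweenI[OF X(1,2,4)] by blast
  have be: "\<bar>coord e x - coord e m\<bar> + \<bar>coord e m - coord e y\<bar> = \<bar>coord e x - coord e y\<bar>"
    and bf: "\<bar>coord f x - coord f m\<bar> + \<bar>coord f m - coord f y\<bar> = \<bar>coord f x - coord f y\<bar>"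
    using between_coords[OF X(3,2,4) _ b] e f by blast+
  \<comment> \<open>Failure of betweenness in the coordinate \<open>e\<close> puts \<open>p\<close>
    and \<open>x\<close> strictly on one side of \<open>m\<close>, and then \<open>y\<close> is on
    the other side or level with \<open>m\<close>. For \<open>f\<close> the roles of
    \<open>x\<close> and \<open>y\<close> are exchanged.\<close>
  have E: "(coord e p < coord e m \<and> coord e x < coord e m \<and> coord e m \<le> coord e y) \<or>
      (coord e p > coord e m \<and> coord e x > coord e m \<and> coord e m \<ge> coord e y)" using e(2) be by linarith
  have F: "(coord f p < coord f m \<and> coord f y < coord f m \<and> coord f m \<le> coord f x) \<or>
      (coord f p > coord f m \<and> coord f y > coord f m \<and> coord f m \<ge> coord f x)" using f(2) bf by linarith
  show False
  proof (cases "e = f")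
    case True then show False using E F by auto
  next
    case False
    define a b where "a = side e (src Y f)" and "b = side f (src Y e)"
    have n: "coord e z = a \<or> coord f z = b" if "z \<in> X" for z
      using nested[OF e(1) f(1) False that] by (simp add: a_def b_def)
    have r: "0 \<le> coord g z \<and> coord g z \<le> 1" if "z \<in> X" for g z using coord_range that by blast
    have a: "a = 0 \<or> a = 1" unfolding a_def by (rule side_01)
    \<comment> \<open>Depending on which extreme \<open>a\<close> is, either both \<open>m\<close>
      and \<open>y\<close> or both \<open>p\<close> and \<open>x\<close> have an
      \<open>e\<close>-coordinate different from \<open>a\<close>. By nesting the two points of that
      pair share the \<open>f\<close>-coordinate \<open>b\<close>, but in the coordinate
      \<open>f\<close> they are different.\<close>
    show False using n[OF X(1)] n[OF X(2)] n[OF X(3)] n[OF X(4)] r[OF X(1), of e] r[OF X(2), of e] r[OF X(3), of e]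
        r[OF X(4), of e] a E F by linarith
  qed
qed

lemma coord_cell:
  assumes e: "e \<in> Q" and f: "f \<in> Q" and x: "0 \<le> x (0::nat)" "x 0 \<le> 1"
  shows "coord f (edge_chart Y e x) = (if f = e then x 0 else side f (src Y e))"
  using e f side_src[OF Q_edge[OF e]] side_tgt[OF Q_edge[OF e]] side_edge[OF f e] by (auto simp: edge_chart_def)

lemma edge_chart_X: "e \<in> Q \<Longrightarrow> 0 \<le> x 0 \<Longrightarrow> x 0 \<le> 1 \<Longrightarrow> edge_chart Y e x \<in> X"
  using rv(4,5)[OF Q_edge] by (auto simp: edge_chart_def points_iff)

lemma tdist_cell:
  assumes e: "e \<in> Q" and x: "0 \<le> x (0::nat)" "x 0 \<le> 1" and y: "0 \<le> y (0::nat)" "y 0 \<le> 1"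
  shows "tdist (edge_chart Y e x) (edge_chart Y e y) = \<bar>x 0 - y 0\<bar>"
proof -
  have "tdist (edge_chart Y e x) (edge_chart Y e y) = (\<Sum>f\<in>{e}. \<bar>coord f (edge_chart Y e x) - coord f (edge_chart Y e y)\<bar>)"
    using coord_cell[OF e] x y e by (intro tdist_superset) (auto simp: supp_def split: if_splits)
  then show ?thesis using coord_cell[OF e e] x y by simp
qed

lemma vpoint_cell: "e \<in> Q \<Longrightarrow> VPoint (src Y e) = edge_chart Y e (\<lambda>_. 0)" "e \<in> Q \<Longrightarrow> VPoint (tgt Y e) = edge_chart Y e (\<lambda>_. 1)"
  by (auto simp: edge_chart_def)

lemma epoint_cell: "0 < t \<Longrightarrow> t < 1 \<Longrightarrow> EPoint e t = edge_chart Y e (\<lambda>_. t)"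
  by (auto simp: edge_chart_def)

text \<open>Any two points are connected by moves inside single closed edges whose lengths add up to
  the distance. Stated as an induction principle, this serves three times: for the separation of
  points by coordinates, for geodesics in the tree, and for shortest strings in the product.\<close>

lemma geodesic_induct [consumes 2, case_names refl cell join]:
  assumes p: "p \<in> X" and q: "q \<in> X"
    and refl: "\<And>p. p \<in> X \<Longrightarrow> R p p"
    and cell: "\<And>e x y. e \<in> Q \<Longrightarrow> 0 \<le> x (0::nat) \<Longrightarrow> x 0 \<le> 1 \<Longrightarrow> 0 \<le> y (0::nat) \<Longrightarrow> y 0 \<le> 1 \<Longrightarrow>
      R (edge_chart Y e x) (edge_chart Y e y)"
    and join: "\<And>p m q. p \<in> X \<Longrightarrow> m \<in> X \<Longrightarrow> q \<in> X \<Longrightarrow> tdist p m + tdist m q = tdist p q \<Longrightarrow> R p m \<Longrightarrow> R m q \<Longrightarrow> R p q"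
  shows "R p q"
proof -
  have edge: "R (VPoint (src Y e)) (VPoint (tgt Y e))" if e: "e \<in> Edge Y" for e
  proof (cases "e \<in> Q")
    case True then show ?thesis unfolding vpoint_cell[OF True] by (intro cell) auto
  next
    case False
    then have r: "rev_edge Y e \<in> Q" using Q_cases[OF e] by blast
    have "R (VPoint (tgt Y (rev_edge Y e))) (VPoint (src Y (rev_edge Y e)))"
      unfolding vpoint_cell[OF r] by (intro cell r) auto
    then show ?thesis using rv[OF e] by simp
  qed
  \<comment> \<open>A path of minimal length crosses no edge twice, in whatever direction. Hence its
    first edge does not separate the second vertex from the end, while every other edge leaves the
    first two vertices on one side.\<close>
  have vv: "R (VPoint u) (VPoint v)" if "edge_path Y u es v" "\<And>es'. edge_path Y u es' v \<Longrightarrow> length es \<le> length es'" for u v es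
    using that
  proof (induction es arbitrary: u)
    case Nil then show ?case using refl[of "VPoint u"] by (auto simp: points_iff)
  next
    case (Cons e es)
    then have e: "e \<in> Edge Y" "src Y e = u" and es: "edge_path Y (tgt Y e) es v" by auto
    have V: "u \<in> Vert Y" "v \<in> Vert Y" "tgt Y e \<in> Vert Y" using e rv edge_path_end[OF es] by auto
    have min: "length es \<le> length es'" if "edge_path Y (tgt Y e) es' v" for es'
      using Cons.prems(2)[of "e # es'"] that e by simp
    have ne: "e \<notin> set es"
    proof
      assume "e \<in> set es"
      then obtain a b where ab: "es = a @ e # b" by (meson split_list)
      then have "edge_path Y u (e # b) v" using es e by (auto simp: edge_path_append[OF serre])
      then show False using Cons.prems(2) ab by fastforce
    qed
    have nr: "rev_edge Y e \<notin> set es"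
    proof
      assume "rev_edge Y e \<in> set es"
      then obtain a b where ab: "es = a @ rev_edge Y e # b" by (meson split_list)
      then have "edge_path Y u b v" using es e rv[OF e(1)] by (auto simp: edge_path_append[OF serre])
      then show False using Cons.prems(2) ab by fastforce
    qed
    have "tdist (VPoint u) (VPoint (tgt Y e)) + tdist (VPoint (tgt Y e)) (VPoint v) = tdist (VPoint u) (VPoint v)"
    proof (rule betweenI)
      fix f assume f: "f \<in> Q"
      show "\<bar>coord f (VPoint u) - coord f (VPoint (tgt Y e))\<bar> + \<bar>coord f (VPoint (tgt Y e)) - coord f (VPoint v)\<bar> =
         \<bar>coord f (VPoint u) - coord f (VPoint v)\<bar>"
      proof (cases "f = e \<or> f = rev_edge Y e")
        case True
        then have "avoid f (tgt Y e) v" unfolding avoid_def using es ne nr rv[OF e(1)] by auto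
        then have "side f (tgt Y e) = side f v" using side_eq_iff[OF Q_edge[OF f] V(3,2)] by simp
        then show ?thesis by simp
      next
        case False
        then have "e \<noteq> f" "e \<noteq> rev_edge Y f" using rv[OF Q_edge[OF f]] rv[OF e(1)] by auto
        then have "avoid f u (tgt Y e)" using avoid_edge[OF e(1)] e by blast
        then have "side f (tgt Y e) = side f u" using side_eq_iff[OF Q_edge[OF f] V(1,3)] by simp
        then show ?thesis by simp
      qed
    qed (use V in \<open>auto simp: points_iff\<close>)
    moreover have "R (VPoint (tgt Y e)) (VPoint v)" using Cons.IH[OF es min] .
    ultimately show ?case using join V edge[OF e(1)] e(2) by (metis points_iff)
  qed
  have VV: "R (VPoint u) (VPoint v)" if "u \<in> Vert Y" "v \<in> Vert Y" for u v
  proof -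
    have "\<exists>es. edge_path Y u es v" using conn that unfolding connected_graph_def by blast
    then obtain es where "edge_path Y u es v" "\<And>es'. edge_path Y u es' v \<Longrightarrow> length es \<le> length es'"
      using ex_has_least_nat[of "\<lambda>es. edge_path Y u es v" _ length] by metis
    then show ?thesis by (rule vv)
  qed
  \<comment> \<open>The vertex is the end of \<open>e\<close> facing \<open>q\<close>. It agrees
    with \<open>q\<close> in the coordinate \<open>e\<close> and with the interior point of
    \<open>e\<close> in all other coordinates, so it lies between the two.\<close>
  have corner: "\<exists>m\<in>Vert Y. tdist (EPoint e t) (VPoint m) + tdist (VPoint m) q = tdist (EPoint e t) q \<and>
       R (EPoint e t) (VPoint m) \<and> R (VPoint m) (EPoint e t)"
    if e: "e \<in> Q" and t: "0 < t" "t < 1" and q: "q \<in> X" and q01: "coord e q = 0 \<or> coord e q = 1" for e t q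
  proof -
    define m where "m = (if coord e q = 0 then src Y e else tgt Y e)"
    have m: "m \<in> Vert Y" "side e m = coord e q" using q01 rv[OF Q_edge[OF e]] side_src[OF Q_edge[OF e]] side_tgt[OF Q_edge[OF e]]
      by (auto simp: m_def)
    have mf: "side f m = side f (src Y e)" if "f \<in> Q" "f \<noteq> e" for f
      using side_edge[OF that(1) e] that by (auto simp: m_def)
    have mc: "VPoint m = edge_chart Y e (\<lambda>_. coord e q)" using q01 by (auto simp: m_def edge_chart_def)
    have tX: "EPoint e t \<in> X" using e t by (simp add: points_iff)
    have "tdist (EPoint e t) (VPoint m) + tdist (VPoint m) q = tdist (EPoint e t) q"
      using m mf tX q by (intro betweenI) (auto simp: points_iff)
    moreover have "R (EPoint e t) (VPoint m)" "R (VPoint m) (EPoint e t)"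
      unfolding mc epoint_cell[OF t] by (intro cell e; use t q01 in auto)+
    ultimately show ?thesis using m(1) by blast
  qed
  have VX: "R (VPoint u) q" if u: "u \<in> Vert Y" and q: "q \<in> X" for u q
  proof (cases q)
    case (VPoint v) then show ?thesis using VV u q by (auto simp: points_iff)
  next
    case (EPoint e t)
    then have e: "e \<in> Q" "0 < t" "t < 1" using q by (auto simp: points_iff)
    have uX: "VPoint u \<in> X" using u by (simp add: points_iff)
    obtain m where m: "m \<in> Vert Y" "tdist (EPoint e t) (VPoint m) + tdist (VPoint m) (VPoint u) = tdist (EPoint e t) (VPoint u)"
      "R (VPoint m) (EPoint e t)" using corner[OF e uX] side_01 by auto
    then have "VPoint m \<in> X" by (simp add: points_iff)
    moreover have "tdist (VPoint u) (VPoint m) + tdist (VPoint m) q = tdist (VPoint u) q"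
      unfolding EPoint using m(2) tdist_sym by (metis add.commute)
    ultimately show ?thesis using join[OF uX _ q] VV[OF u m(1)] m(3) unfolding EPoint by blast
  qed
  show ?thesis
  proof (cases p)
    case (VPoint v) then show ?thesis using VX p q by (auto simp: points_iff)
  next
    case (EPoint e t)
    then have e: "e \<in> Q" "0 < t" "t < 1" using p by (auto simp: points_iff)
    show ?thesis
    proof (cases "coord e q = 0 \<or> coord e q = 1")
      case True
      obtain m where m: "m \<in> Vert Y" "tdist (EPoint e t) (VPoint m) + tdist (VPoint m) q = tdist (EPoint e t) q"
        "R (EPoint e t) (VPoint m)" using corner[OF e q True] by blast
      then have "VPoint m \<in> X" by (simp add: points_iff)
      then show ?thesis using join[OF p _ q] m(2,3) VX[OF m(1) q] unfolding EPoint by blast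
    next
      case False
      then obtain s where s: "q = EPoint e s" "0 < s" "s < 1"
        using side_01 q by (cases q) (auto simp: points_iff split: if_splits)
      show ?thesis unfolding EPoint s(1) epoint_cell[OF e(2,3)] epoint_cell[OF s(2,3)]
        by (intro cell) (use e s in auto)
    qed
  qed
qed

lemma tdist_eq_0:
  assumes "p \<in> X" "q \<in> X" "tdist p q = 0"
  shows "p = q"
proof -
  have "supp p q = {}"
    using assms(3) finite_supp[OF assms(1,2)] unfolding tdist_def
    by (subst (asm) sum_nonneg_eq_0_iff) (auto simp: supp_def)
  then have c: "coord e p = coord e q" if "e \<in> Q" for e using that by (auto simp: supp_def)
  have "(\<forall>e\<in>Q. coord e p = coord e q) \<longrightarrow> p = q" using assms(1,2)
  proof (induction rule: geodesic_induct)
    case (cell e x y)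
    show ?case
    proof
      assume "\<forall>f\<in>Q. coord f (edge_chart Y e x) = coord f (edge_chart Y e y)"
      then have "coord e (edge_chart Y e x) = coord e (edge_chart Y e y)" using cell(1) by blast
      then have "x 0 = y 0"
        using coord_cell[OF cell(1) cell(1), of x] coord_cell[OF cell(1) cell(1), of y] cell by simp
      then show "edge_chart Y e x = edge_chart Y e y" by (simp add: edge_chart_def)
    qed
  next
    case (join p m q)
    show ?case
    proof
      assume a: "\<forall>e\<in>Q. coord e p = coord e q"
      have "coord e p = coord e m \<and> coord e m = coord e q" if "e \<in> Q" for e
        using between_coords[OF join(1,2,3) that join(4)] a that by force
      then show "p = q" using join by simp
    qed
  qed simp
  then show ?thesis using c by blast
qed

lemma tdist_metric: "Metric_space X tdist"
  by unfold_locales (auto simp: tdist_nonneg tdist_self tdist_triangle intro: tdist_sym tdist_eq_0)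

text \<open>By \<open>median\<close>, \<open>m\<close> lies between \<open>p\<close> and one of the
  ends. The distance from \<open>p\<close> to that end is then known exactly, and the distance to
  the other end is bounded below by the triangle inequality. With these values the claim reduces to
  Stewart's identity for four points on a line.\<close>

lemma tdist_stewart:
  assumes X: "p \<in> X" "x \<in> X" "y \<in> X" "m \<in> X" and t: "0 \<le> t" "t \<le> 1"
    and m: "tdist x m = t * tdist x y" "tdist m y = (1 - t) * tdist x y"
  shows "(tdist p m)\<^sup>2 \<le> (1 - t) * (tdist p x)\<^sup>2 + t * (tdist p y)\<^sup>2 - t * (1 - t) * (tdist x y)\<^sup>2"
proof -
  let ?a = "tdist p m" and ?l = "tdist x y"
  have b: "tdist x m + tdist m y = ?l" using m by (simp add: algebra_simps)
  consider "tdist p m + tdist m x = tdist p x" | "tdist p m + tdist m y = tdist p y"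
    using median[OF X(1,4,2,3) b] by blast
  then show ?thesis
  proof cases
    case 1
    then have px: "tdist p x = ?a + t * ?l" using m tdist_sym[of m x] by simp
    have "\<bar>?a - (1 - t) * ?l\<bar> \<le> tdist p y"
      using tdist_triangle[OF X(1,3,4)] tdist_triangle[OF X(4,1,3)] m(2) tdist_sym[of y m] tdist_sym[of m p] by linarith
    then have "(?a - (1 - t) * ?l)\<^sup>2 \<le> (tdist p y)\<^sup>2"
      by (rule abs_le_square_iff[THEN iffD1, OF order_trans]) simp
    then have "t * (?a - (1 - t) * ?l)\<^sup>2 \<le> t * (tdist p y)\<^sup>2" using t by (simp add: mult_left_mono)
    moreover have "?a\<^sup>2 = (1 - t) * (?a + t * ?l)\<^sup>2 + t * (?a - (1 - t) * ?l)\<^sup>2 - t * (1 - t) * ?l\<^sup>2"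
      by (simp add: power2_eq_square algebra_simps)
    ultimately show ?thesis unfolding px by linarith
  next
    case 2
    then have py: "tdist p y = ?a + (1 - t) * ?l" using m by simp
    have "\<bar>?a - t * ?l\<bar> \<le> tdist p x"
      using tdist_triangle[OF X(1,2,4)] tdist_triangle[OF X(4,1,2)] m(1) tdist_sym[of m x] tdist_sym[of m p] by linarith
    then have "(?a - t * ?l)\<^sup>2 \<le> (tdist p x)\<^sup>2"
      by (rule abs_le_square_iff[THEN iffD1, OF order_trans]) simp
    then have "(1 - t) * (?a - t * ?l)\<^sup>2 \<le> (1 - t) * (tdist p x)\<^sup>2" using t by (simp add: mult_left_mono)
    moreover have "?a\<^sup>2 = (1 - t) * (?a - t * ?l)\<^sup>2 + t * (?a + (1 - t) * ?l)\<^sup>2 - t * (1 - t) * ?l\<^sup>2"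
      by (simp add: power2_eq_square algebra_simps)
    ultimately show ?thesis unfolding py by linarith
  qed
qed

end

section \<open>Stewart's inequality and CAT(0) spaces\<close>

lemma euclidean_dist_sq: "(euclidean_dist n x y)\<^sup>2 = (\<Sum>i<n. (x i - y i)\<^sup>2)"
  by (simp add: euclidean_dist_def L2_set_def sum_nonneg)

lemma euclidean_dist_nonneg: "0 \<le> euclidean_dist n x y"
  by (simp add: euclidean_dist_def)

lemma euclidean_dist_sqrt: "euclidean_dist n x y = sqrt (\<Sum>i<n. (x i - y i)\<^sup>2)"
  by (simp add: euclidean_dist_def L2_set_def)

lemma euclidean_dist_cong:
  "(\<And>i. i < n \<Longrightarrow> x i - y i = x' i - y' i) \<Longrightarrow> euclidean_dist n x y = euclidean_dist n x' y'"
  by (simp add: euclidean_dist_sqrt)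

lemma euclidean_dist_commute: "euclidean_dist n x y = euclidean_dist n y x"
  by (simp add: euclidean_dist_sqrt power2_commute)

lemma euclidean_dist_scale:
  "(\<And>i. i < n \<Longrightarrow> x' i - y' i = c * (x i - y i)) \<Longrightarrow> euclidean_dist n x' y' = \<bar>c\<bar> * euclidean_dist n x y"
  by (simp add: euclidean_dist_sqrt power_mult_distrib flip: sum_distrib_left) (simp add: real_sqrt_mult)

lemma euclidean_metric: "Metric_space (euclidean_points n) (euclidean_dist n)"
proof
  show "0 \<le> euclidean_dist n x y" for x y by (rule euclidean_dist_nonneg)
  show "euclidean_dist n x y = euclidean_dist n y x" for x y by (rule euclidean_dist_commute)
  show "euclidean_dist n x y = 0 \<longleftrightarrow> x = y" if "x \<in> euclidean_points n" "y \<in> euclidean_points n" for x y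
  proof
    assume "euclidean_dist n x y = 0"
    then have "\<forall>i<n. x i = y i" by (simp add: euclidean_dist_def L2_set_eq_0_iff)
    moreover have "\<forall>i\<ge>n. x i = y i" using that by (simp add: euclidean_points_def)
    ultimately show "x = y" using not_less by (intro ext) blast
  qed (simp add: euclidean_dist_def L2_set_def)
  show "euclidean_dist n x z \<le> euclidean_dist n x y + euclidean_dist n y z" for x y z
    using L2_set_triangle_ineq[of "\<lambda>i. x i - y i" "\<lambda>i. y i - z i" "{..<n}"] by (simp add: euclidean_dist_def)
qed

text \<open>Stewart's identity turned into an inequality.  Unlike the comparison inequality, it passes to
  \<open>\<ell>\<^sup>2\<close>-products summand by summand.\<close>

definition stewart_space :: "'p set \<Rightarrow> ('p \<Rightarrow> 'p \<Rightarrow> real) \<Rightarrow> bool" where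
  "stewart_space M d \<longleftrightarrow> Metric_space M d \<and>
     (\<forall>p\<in>M. \<forall>x\<in>M. \<forall>y\<in>M. \<forall>m\<in>M. \<forall>t\<in>{0..1}. d x m = t * d x y \<longrightarrow> d m y = (1 - t) * d x y \<longrightarrow>
        (d p m)\<^sup>2 \<le> (1 - t) * (d p x)\<^sup>2 + t * (d p y)\<^sup>2 - t * (1 - t) * (d x y)\<^sup>2)"

lemma stewart_spaceD:
  assumes "stewart_space M d" "p \<in> M" "x \<in> M" "y \<in> M" "m \<in> M" "0 \<le> t" "t \<le> 1"
    "d x m = t * d x y" "d m y = (1 - t) * d x y"
  shows "(d p m)\<^sup>2 \<le> (1 - t) * (d p x)\<^sup>2 + t * (d p y)\<^sup>2 - t * (1 - t) * (d x y)\<^sup>2"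
  using assms unfolding stewart_space_def by simp

lemma euclidean_stewart_identity:
  "(1 - t) * (euclidean_dist n p x)\<^sup>2 + t * (euclidean_dist n p y)\<^sup>2 =
   (euclidean_dist n p (\<lambda>i. (1 - t) * x i + t * y i))\<^sup>2 + t * (1 - t) * (euclidean_dist n x y)\<^sup>2"
  unfolding euclidean_dist_sq sum_distrib_left sum.distrib[symmetric]
  by (rule sum.cong) (auto simp: power2_eq_square algebra_simps)

text \<open>Stewart's identity with \<open>m\<close> in the place of \<open>p\<close> shows that the
  two distances of \<open>m\<close> force it to be the affine combination \<open>?u\<close>. The
  identity for \<open>p\<close> then gives the claim, with equality.\<close>

lemma euclidean_stewart: "stewart_space (euclidean_points n) (euclidean_dist n)"
  unfolding stewart_space_def
proof (intro conjI ballI impI)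
  show "Metric_space (euclidean_points n) (euclidean_dist n)" by (rule euclidean_metric)
  fix p x y m t
  assume t: "t \<in> {0..1::real}" and m: "euclidean_dist n x m = t * euclidean_dist n x y"
    "euclidean_dist n m y = (1 - t) * euclidean_dist n x y"
  let ?l = "euclidean_dist n x y" and ?u = "\<lambda>i. (1 - t) * x i + t * y i"
  have "(1 - t) * (t * ?l)\<^sup>2 + t * ((1 - t) * ?l)\<^sup>2 = (euclidean_dist n m ?u)\<^sup>2 + t * (1 - t) * ?l\<^sup>2"
    using euclidean_stewart_identity[of t n m x y] m by (simp add: euclidean_dist_commute[of n m x])
  moreover have "(1 - t) * (t * ?l)\<^sup>2 + t * ((1 - t) * ?l)\<^sup>2 = t * (1 - t) * ?l\<^sup>2"
    by (simp add: power2_eq_square algebra_simps)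
  ultimately have "euclidean_dist n m ?u = 0" by simp
  then have "\<forall>i<n. m i = ?u i" by (simp add: euclidean_dist_def L2_set_eq_0_iff)
  then have "euclidean_dist n p m = euclidean_dist n p ?u" by (intro euclidean_dist_cong) simp
  then show "(euclidean_dist n p m)\<^sup>2 \<le> (1 - t) * (euclidean_dist n p x)\<^sup>2 + t * (euclidean_dist n p y)\<^sup>2 -
      t * (1 - t) * ?l\<^sup>2"
    using euclidean_stewart_identity[of t n p x y] by simp
qed

text \<open>Strict convexity of the \<open>\<ell>\<^sup>2\<close>-combination: a point that divides
  a segment of the product in the ratio given by \<open>t\<close> does so in each factor. For
  \<open>t\<close> strictly between \<open>0\<close> and \<open>1\<close>, convexity of the square
  summed over both factors becomes an equation, so the four nonnegative defects vanish.\<close>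

lemma product_between:
  fixes a1 a2 b1 b2 w1 w2 t :: real
  assumes nn: "0 \<le> a1" "0 \<le> a2" "0 \<le> b1" "0 \<le> b2" "0 \<le> w1" "0 \<le> w2" and t: "0 \<le> t" "t \<le> 1"
    and tri: "w1 \<le> a1 + b1" "w2 \<le> a2 + b2"
    and a: "a1\<^sup>2 + a2\<^sup>2 = t\<^sup>2 * (w1\<^sup>2 + w2\<^sup>2)" and b: "b1\<^sup>2 + b2\<^sup>2 = (1 - t)\<^sup>2 * (w1\<^sup>2 + w2\<^sup>2)"
  shows "a1 = t * w1 \<and> a2 = t * w2 \<and> b1 = (1 - t) * w1 \<and> b2 = (1 - t) * w2"
proof -
  have w: "a1 + b1 = w1 \<and> a2 + b2 = w2 \<and> (1 - t) * a1 = t * b1 \<and> (1 - t) * a2 = t * b2"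
  proof -
    consider "t = 0" | "t = 1" | "0 < t" "t < 1" using t by linarith
    then show ?thesis
    proof cases
      case 1
      then have a0: "a1 = 0" "a2 = 0" using a by (simp_all add: sum_power2_eq_zero_iff)
      then have le: "w1\<^sup>2 \<le> b1\<^sup>2" "w2\<^sup>2 \<le> b2\<^sup>2" using tri nn by (simp_all add: power_mono)
      then have "b1\<^sup>2 = w1\<^sup>2" "b2\<^sup>2 = w2\<^sup>2" using b 1 by simp_all
      then show ?thesis using a0 1 nn by (simp add: power2_eq_iff_nonneg)
    next
      case 2
      then have b0: "b1 = 0" "b2 = 0" using b by (simp_all add: sum_power2_eq_zero_iff)
      then have le: "w1\<^sup>2 \<le> a1\<^sup>2" "w2\<^sup>2 \<le> a2\<^sup>2" using tri nn by (simp_all add: power_mono)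
      then have "a1\<^sup>2 = w1\<^sup>2" "a2\<^sup>2 = w2\<^sup>2" using a 2 by simp_all
      then show ?thesis using b0 2 nn by (simp add: power2_eq_iff_nonneg)
    next
      case 3
      define c where "c = t * (1 - t)"
      have c: "c > 0" using 3 by (simp add: c_def)
      have le: "w1\<^sup>2 \<le> (a1 + b1)\<^sup>2" "w2\<^sup>2 \<le> (a2 + b2)\<^sup>2" using tri nn by (simp_all add: power_mono)
      have id: "((1 - t) * u - t * v)\<^sup>2 = (1 - t) * u\<^sup>2 + t * v\<^sup>2 - c * (u + v)\<^sup>2" for u v :: real
        by (simp add: c_def power2_eq_square algebra_simps)
      have "(1 - t) * (a1\<^sup>2 + a2\<^sup>2) + t * (b1\<^sup>2 + b2\<^sup>2) = c * (w1\<^sup>2 + w2\<^sup>2)"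
        unfolding a b c_def by (simp add: power2_eq_square algebra_simps)
      then have sum: "((1 - t) * a1 - t * b1)\<^sup>2 + ((1 - t) * a2 - t * b2)\<^sup>2 +
          c * ((a1 + b1)\<^sup>2 - w1\<^sup>2) + c * ((a2 + b2)\<^sup>2 - w2\<^sup>2) = 0"
        unfolding id by (simp add: algebra_simps)
      have nn': "0 \<le> ((1 - t) * a1 - t * b1)\<^sup>2" "0 \<le> ((1 - t) * a2 - t * b2)\<^sup>2"
        "0 \<le> c * ((a1 + b1)\<^sup>2 - w1\<^sup>2)" "0 \<le> c * ((a2 + b2)\<^sup>2 - w2\<^sup>2)" using le c by simp_all
      have z: "((1 - t) * a1 - t * b1)\<^sup>2 = 0" "((1 - t) * a2 - t * b2)\<^sup>2 = 0"
        "c * ((a1 + b1)\<^sup>2 - w1\<^sup>2) = 0" "c * ((a2 + b2)\<^sup>2 - w2\<^sup>2) = 0" using sum nn' by linarith+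
      have "(a1 + b1)\<^sup>2 = w1\<^sup>2" "(a2 + b2)\<^sup>2 = w2\<^sup>2" using z(3,4) c by simp_all
      then have "a1 + b1 = w1" "a2 + b2 = w2" using nn by (simp_all add: power2_eq_iff_nonneg)
      then show ?thesis using z(1,2) by simp
    qed
  qed
  then have "a1 = t * w1" "a2 = t * w2" by (auto simp: algebra_simps)
  then show ?thesis using w by (auto simp: algebra_simps)
qed

lemma prod_dist_sq: "(prod_dist d1 d2 (x, y) (x', y'))\<^sup>2 = (d1 x x')\<^sup>2 + (d2 y y')\<^sup>2"
  by (simp add: prod_dist_def)

lemma stewart_product:
  assumes 1: "stewart_space M d1" and 2: "stewart_space N d2"
  shows "stewart_space (M \<times> N) (prod_dist d1 d2)"
proof -
  interpret A: Metric_space M d1 using 1 by (simp add: stewart_space_def)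
  interpret B: Metric_space N d2 using 2 by (simp add: stewart_space_def)
  interpret Metric_space12 M d1 N d2 by unfold_locales
  show ?thesis
    unfolding stewart_space_def
  proof (intro conjI ballI impI)
    show "Metric_space (M \<times> N) (prod_dist d1 d2)" by (rule prod_metric)
    fix p x y m t
    assume X: "p \<in> M \<times> N" "x \<in> M \<times> N" "y \<in> M \<times> N" "m \<in> M \<times> N" and t: "t \<in> {0..1::real}"
      and m: "prod_dist d1 d2 x m = t * prod_dist d1 d2 x y" "prod_dist d1 d2 m y = (1 - t) * prod_dist d1 d2 x y"
    obtain p1 p2 x1 x2 y1 y2 m1 m2 where e: "p = (p1, p2)" "x = (x1, x2)" "y = (y1, y2)" "m = (m1, m2)"
      by (metis surj_pair)
    have in1: "p1 \<in> M" "x1 \<in> M" "y1 \<in> M" "m1 \<in> M" and in2: "p2 \<in> N" "x2 \<in> N" "y2 \<in> N" "m2 \<in> N"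
      using X e by auto
    have s: "(d1 x1 m1)\<^sup>2 + (d2 x2 m2)\<^sup>2 = t\<^sup>2 * ((d1 x1 y1)\<^sup>2 + (d2 x2 y2)\<^sup>2)"
      "(d1 m1 y1)\<^sup>2 + (d2 m2 y2)\<^sup>2 = (1 - t)\<^sup>2 * ((d1 x1 y1)\<^sup>2 + (d2 x2 y2)\<^sup>2)"
      using m unfolding e by (metis prod_dist_sq power_mult_distrib)+
    have b: "d1 x1 m1 = t * d1 x1 y1 \<and> d2 x2 m2 = t * d2 x2 y2 \<and> d1 m1 y1 = (1 - t) * d1 x1 y1 \<and>
        d2 m2 y2 = (1 - t) * d2 x2 y2"
      using t s A.triangle[OF in1(2,4,3)] B.triangle[OF in2(2,4,3)]
      by (intro product_between) auto
    have t': "0 \<le> t" "t \<le> 1" using t by auto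
    show "(prod_dist d1 d2 p m)\<^sup>2 \<le> (1 - t) * (prod_dist d1 d2 p x)\<^sup>2 + t * (prod_dist d1 d2 p y)\<^sup>2 -
        t * (1 - t) * (prod_dist d1 d2 x y)\<^sup>2"
      using stewart_spaceD[OF 1 in1 t'] stewart_spaceD[OF 2 in2 t'] b
      unfolding e prod_dist_sq by (simp add: algebra_simps)
  qed
qed

section \<open>Comparison with Euclidean triangles, and geodesics\<close>

lemma norm_stewart_identity:
  fixes x y z :: "'a::real_inner"
  shows "(dist z ((1 - t) *\<^sub>R x + t *\<^sub>R y))\<^sup>2 =
    (1 - t) * (dist z x)\<^sup>2 + t * (dist z y)\<^sup>2 - t * (1 - t) * (dist x y)\<^sup>2"
  unfolding dist_norm power2_norm_eq_inner
  by (simp add: inner_diff inner_add algebra_simps inner_commute)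

lemma segment_param:
  fixes x y p :: "'a::real_normed_vector"
  assumes p: "p \<in> closed_segment x y" and d: "dist x p = s * dist x y"
  shows "p = (1 - s) *\<^sub>R x + s *\<^sub>R y"
proof -
  obtain u where u: "p = (1 - u) *\<^sub>R x + u *\<^sub>R y" "0 \<le> u" "u \<le> 1" using p by (auto simp: closed_segment_def)
  have "x - p = u *\<^sub>R (x - y)" unfolding u(1) by (simp add: algebra_simps)
  then have "dist x p = u * dist x y" using u(2) by (simp add: dist_norm)
  then have "u = s \<or> x = y" using d by auto
  then show ?thesis using u(1) by (auto simp: algebra_simps)
qed

text \<open>The inequality is used twice: with apex \<open>z\<close> over the side from
  \<open>x\<close> to \<open>y\<close>, which bounds the distance from \<open>c s\<close> to
  \<open>z\<close>, and with apex \<open>c s\<close> over the side from \<open>x\<close> to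
  \<open>z\<close>. In the comparison triangle both are identities, so the bounds carry
  over.\<close>

lemma CAT0_from_stewart:
  assumes st: "stewart_space M d" and geo: "\<And>x y. x \<in> M \<Longrightarrow> y \<in> M \<Longrightarrow> \<exists>c. geodesic_path M d x y c"
  shows "CAT0_space M d"
  unfolding CAT0_space_def
proof (intro conjI ballI impI allI)
  show met: "Metric_space M d" using st by (simp add: stewart_space_def)
  interpret Metric_space M d by fact
  show "\<exists>c. geodesic_path M d x y c" if "x \<in> M" "y \<in> M" for x y using geo that .
  fix x y z c c' s t and x' y' z' p' q' :: "real^2"
  assume X: "x \<in> M" "y \<in> M" "z \<in> M" and c: "geodesic_path M d x y c" and c': "geodesic_path M d x z c'"
    and tri: "dist x' y' = d x y" "dist y' z' = d y z" "dist x' z' = d x z"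
    and s: "s \<in> {0..d x y}" and t: "t \<in> {0..d x z}"
    and p': "p' \<in> closed_segment x' y'" "dist x' p' = s" and q': "q' \<in> closed_segment x' z'" "dist x' q' = t"
  define \<sigma> where "\<sigma> = (if d x y = 0 then 0 else s / d x y)"
  define \<tau> where "\<tau> = (if d x z = 0 then 0 else t / d x z)"
  have \<sigma>: "0 \<le> \<sigma>" "\<sigma> \<le> 1" "s = \<sigma> * d x y" using s by (auto simp: \<sigma>_def divide_le_eq_1)
  have \<tau>: "0 \<le> \<tau>" "\<tau> \<le> 1" "t = \<tau> * d x z" using t by (auto simp: \<tau>_def divide_le_eq_1)
  have cs: "c s \<in> M" "d x (c s) = \<sigma> * d x y" "d (c s) y = (1 - \<sigma>) * d x y"
  proof -
    have 0: "c 0 = x" "c (d x y) = y" and i: "\<And>a b. a \<in> {0..d x y} \<Longrightarrow> b \<in> {0..d x y} \<Longrightarrow> d (c a) (c b) = \<bar>a - b\<bar>"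
      and m: "c ` {0..d x y} \<subseteq> M" using c unfolding geodesic_path_def by auto
    show "c s \<in> M" using m s by blast
    show "d x (c s) = \<sigma> * d x y" using i[of 0 s] s 0 \<sigma> by simp
    show "d (c s) y = (1 - \<sigma>) * d x y" using i[of s "d x y"] s 0 \<sigma>(3) by (simp add: algebra_simps)
  qed
  have ct: "c' t \<in> M" "d x (c' t) = \<tau> * d x z" "d (c' t) z = (1 - \<tau>) * d x z"
  proof -
    have 0: "c' 0 = x" "c' (d x z) = z" and i: "\<And>a b. a \<in> {0..d x z} \<Longrightarrow> b \<in> {0..d x z} \<Longrightarrow> d (c' a) (c' b) = \<bar>a - b\<bar>"
      and m: "c' ` {0..d x z} \<subseteq> M" using c' unfolding geodesic_path_def by auto
    show "c' t \<in> M" using m t by blast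
    show "d x (c' t) = \<tau> * d x z" using i[of 0 t] t 0 \<tau> by simp
    show "d (c' t) z = (1 - \<tau>) * d x z" using i[of t "d x z"] t 0 \<tau>(3) by (simp add: algebra_simps)
  qed
  have p'eq: "p' = (1 - \<sigma>) *\<^sub>R x' + \<sigma> *\<^sub>R y'" using segment_param[OF p'(1)] p'(2) \<sigma>(3) tri by simp
  have q'eq: "q' = (1 - \<tau>) *\<^sub>R x' + \<tau> *\<^sub>R z'" using segment_param[OF q'(1)] q'(2) \<tau>(3) tri by simp
  have 1: "(d z (c s))\<^sup>2 \<le> (dist z' p')\<^sup>2"
    using stewart_spaceD[OF st X(3,1,2) cs(1) \<sigma>(1,2) cs(2,3)] norm_stewart_identity[of z' \<sigma> x' y'] tri
    unfolding p'eq by (simp add: commute[of z] dist_commute[of z'])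
  have 2: "(d (c s) (c' t))\<^sup>2 \<le> (1 - \<tau>) * (d (c s) x)\<^sup>2 + \<tau> * (d (c s) z)\<^sup>2 - \<tau> * (1 - \<tau>) * (d x z)\<^sup>2"
    using stewart_spaceD[OF st cs(1) X(1,3) ct(1) \<tau>(1,2) ct(2,3)] .
  have 3: "(dist p' q')\<^sup>2 = (1 - \<tau>) * (dist p' x')\<^sup>2 + \<tau> * (dist p' z')\<^sup>2 - \<tau> * (1 - \<tau>) * (dist x' z')\<^sup>2"
    unfolding q'eq by (rule norm_stewart_identity)
  have 4: "d (c s) x = dist p' x'"
    using cs(2) p'(2) \<sigma>(3) commute[of "c s" x] dist_commute[of p' x'] by linarith
  have "(d (c s) z)\<^sup>2 \<le> (dist p' z')\<^sup>2" using 1 by (simp add: commute[of z] dist_commute[of z'])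
  then have "(d (c s) (c' t))\<^sup>2 \<le> (dist p' q')\<^sup>2"
    using 2 \<tau>(1) mult_left_mono[of "(d (c s) z)\<^sup>2" "(dist p' z')\<^sup>2" \<tau>] unfolding 3 4 tri(3) by linarith
  then show "d (c s) (c' t) \<le> dist p' q'" using power2_le_imp_le zero_le_dist by blast
qed

lemma geodesic_path_join:
  assumes M: "Metric_space M d" and X: "x \<in> M" "y \<in> M" "z \<in> M"
    and c: "geodesic_path M d x y c" and c': "geodesic_path M d y z c'" and add: "d x y + d y z = d x z"
  shows "\<exists>c. geodesic_path M d x z c"
proof -
  interpret Metric_space M d by fact
  define h where "h r = (if r \<le> d x y then c r else c' (r - d x y))" for r
  have c0: "c 0 = x" "c (d x y) = y" and ci: "\<And>a b. a \<in> {0..d x y} \<Longrightarrow> b \<in> {0..d x y} \<Longrightarrow> d (c a) (c b) = \<bar>a - b\<bar>"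
    and cm: "\<And>a. a \<in> {0..d x y} \<Longrightarrow> c a \<in> M" using c unfolding geodesic_path_def by auto
  have d0: "c' 0 = y" "c' (d y z) = z" and di: "\<And>a b. a \<in> {0..d y z} \<Longrightarrow> b \<in> {0..d y z} \<Longrightarrow> d (c' a) (c' b) = \<bar>a - b\<bar>"
    and dm: "\<And>a. a \<in> {0..d y z} \<Longrightarrow> c' a \<in> M" using c' unfolding geodesic_path_def by auto
  have hm: "h r \<in> M" if "r \<in> {0..d x z}" for r
    using that add cm[of r] dm[of "r - d x y"] by (auto simp: h_def)
  have mixed: "d (h a) (h b) = b - a" if "0 \<le> a" "a \<le> b" "b \<le> d x z" for a b
  proof -
    consider "b \<le> d x y" | "d x y < a" | "a \<le> d x y" "d x y < b" by linarith
    then show ?thesis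
    proof cases
      case 1 then show ?thesis using that ci[of a b] by (simp add: h_def)
    next
      case 2 then show ?thesis using that di[of "a - d x y" "b - d x y"] add by (simp add: h_def)
    next
      \<comment> \<open>The upper bound comes from passing through \<open>y\<close>. The lower bound
        holds because a shortcut between the two points would make a connection from
        \<open>x\<close> to \<open>z\<close> shorter than \<open>d x z\<close>.\<close>
      case 3
      have ha: "h a = c a" "h b = c' (b - d x y)" using 3 by (auto simp: h_def)
      have m: "h a \<in> M" "h b \<in> M" using hm that by auto
      have "d (h a) y = d x y - a" using ci[of a "d x y"] that 3 c0 ha by simp
      moreover have "d y (h b) = b - d x y" using di[of 0 "b - d x y"] that 3 d0 ha add by simp
      ultimately have "d (h a) (h b) \<le> b - a" using triangle[OF m(1) X(2) m(2)] by simp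
      moreover have "d x (h a) = a" using ci[of 0 a] that 3 c0 ha by simp
      moreover have "d (h b) z = d x z - b" using di[of "b - d x y" "d y z"] that 3 d0 ha add by simp
      ultimately show ?thesis using triangle[OF X(1) m(1) X(3)] triangle[OF m(1) m(2) X(3)] by linarith
    qed
  qed
  have "d (h a) (h b) = \<bar>a - b\<bar>" if "a \<in> {0..d x z}" "b \<in> {0..d x z}" for a b
    using mixed[of a b] mixed[of b a] that commute by (cases "a \<le> b") auto
  moreover have "h 0 = x" using c0 by (simp add: h_def)
  moreover have "h (d x z) = z"
  proof (cases "d y z = 0")
    case True then show ?thesis using add c0 X by (simp add: h_def)
  next
    case False
    then have "d y z > 0" using nonneg[of y z] by linarith
    then show ?thesis using add d0 by (simp add: h_def flip: add)
  qed
  ultimately have "geodesic_path M d x z h" unfolding geodesic_path_def using hm by blast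
  then show ?thesis by blast
qed

lemma geodesic_path_refl: "Metric_space M d \<Longrightarrow> x \<in> M \<Longrightarrow> geodesic_path M d x x (\<lambda>_. x)"
  using Metric_space.mdist_zero[of M d x] by (simp add: geodesic_path_def)

lemma geodesic_path_product:
  assumes c: "geodesic_path M d1 x1 y1 c" and e: "geodesic_path N d2 x2 y2 e"
    and nn: "0 \<le> d1 x1 y1" "0 \<le> d2 x2 y2"
  shows "\<exists>h. geodesic_path (M \<times> N) (prod_dist d1 d2) (x1, x2) (y1, y2) h"
proof -
  define D where "D = prod_dist d1 d2 (x1, x2) (y1, y2)"
  let ?l1 = "d1 x1 y1" and ?l2 = "d2 x2 y2"
  have D2: "D\<^sup>2 = ?l1\<^sup>2 + ?l2\<^sup>2" and D0: "0 \<le> D" by (auto simp: D_def prod_dist_def)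
  \<comment> \<open>Each factor is traversed at a constant speed proportional to its own length. If
    \<open>D = 0\<close>, both lengths vanish, and division by zero yields the constant
    path.\<close>
  define h where "h r = (c (r * ?l1 / D), e (r * ?l2 / D))" for r
  have D00: "?l1 = 0 \<and> ?l2 = 0" if "D = 0" using D2 that by (simp add: sum_power2_eq_zero_iff)
  have ran: "r * ?l1 / D \<in> {0..?l1}" "r * ?l2 / D \<in> {0..?l2}" if "r \<in> {0..D}" for r
  proof (atomize (full), cases "D = 0")
    case True
    then show "r * ?l1 / D \<in> {0..?l1} \<and> r * ?l2 / D \<in> {0..?l2}" using nn by simp
  next
    case False
    then have "D > 0" using D0 by simp
    then show "r * ?l1 / D \<in> {0..?l1} \<and> r * ?l2 / D \<in> {0..?l2}"
      using that nn mult_right_mono[of r D ?l1] mult_right_mono[of r D ?l2]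
      by (simp add: divide_le_eq mult.commute)
  qed
  have "h 0 = (x1, x2)" using c e by (simp add: h_def geodesic_path_def)
  moreover have "h D = (y1, y2)"
    using c e D00 by (cases "D = 0") (auto simp: h_def geodesic_path_def)
  moreover have "h ` {0..D} \<subseteq> M \<times> N" using c e ran unfolding geodesic_path_def h_def by blast
  moreover have "prod_dist d1 d2 (h a) (h b) = \<bar>a - b\<bar>" if ab: "a \<in> {0..D}" "b \<in> {0..D}" for a b
  proof -
    have 1: "d1 (c (a * ?l1 / D)) (c (b * ?l1 / D)) = \<bar>a * ?l1 / D - b * ?l1 / D\<bar>"
      "d2 (e (a * ?l2 / D)) (e (b * ?l2 / D)) = \<bar>a * ?l2 / D - b * ?l2 / D\<bar>"
      using c e ran ab unfolding geodesic_path_def by blast+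
    have "(prod_dist d1 d2 (h a) (h b))\<^sup>2 = ((a - b) / D)\<^sup>2 * (?l1\<^sup>2 + ?l2\<^sup>2)"
      unfolding h_def prod_dist_sq 1 by (simp add: power2_eq_square algebra_simps diff_divide_distrib)
    also have "\<dots> = (a - b)\<^sup>2" using D2 ab by (cases "D = 0") (simp_all add: power_divide flip: D2)
    finally have "\<bar>prod_dist d1 d2 (h a) (h b)\<bar> = \<bar>a - b\<bar>" by (simp add: power2_eq_iff abs_eq_iff)
    then show ?thesis by (simp add: prod_dist_def split: prod.splits)
  qed
  ultimately show ?thesis unfolding geodesic_path_def D_def[symmetric] by blast
qed

lemma euclidean_geodesic:
  assumes "x \<in> euclidean_points n" "y \<in> euclidean_points n"
  shows "\<exists>c. geodesic_path (euclidean_points n) (euclidean_dist n) x y c"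
proof -
  let ?l = "euclidean_dist n x y"
  define c where "c r = (\<lambda>i. x i + (r / ?l) * (y i - x i))" for r
  have "c ?l = y"
  proof (cases "?l = 0")
    case True
    then have "x = y" using Metric_space.zero[OF euclidean_metric assms] by simp
    then show ?thesis by (simp add: c_def)
  qed (auto simp: c_def)
  moreover have "c 0 = x" by (simp add: c_def)
  moreover have "c r \<in> euclidean_points n" for r using assms by (simp add: c_def euclidean_points_def)
  moreover have "euclidean_dist n (c a) (c b) = \<bar>a - b\<bar>" if "a \<in> {0..?l}" "b \<in> {0..?l}" for a b
  proof -
    have "euclidean_dist n (c a) (c b) = \<bar>(b - a) / ?l\<bar> * ?l"
      by (rule euclidean_dist_scale) (simp add: c_def diff_divide_distrib algebra_simps)
    then show ?thesis using that euclidean_dist_nonneg[of n x y] by (cases "?l = 0") auto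
  qed
  ultimately have "geodesic_path (euclidean_points n) (euclidean_dist n) x y c" unfolding geodesic_path_def by blast
  then show ?thesis by blast
qed

text \<open>\<open>Metric_space\<close> demands nonnegativity and symmetry for all arguments, also
  outside \<open>M\<close> where \<open>d'\<close> may differ from \<open>d\<close>; therefore the
  metric axioms of \<open>d'\<close> are assumed separately.\<close>

lemma CAT0_space_cong:
  assumes "CAT0_space M d" and eq: "\<And>x y. x \<in> M \<Longrightarrow> y \<in> M \<Longrightarrow> d' x y = d x y" and "Metric_space M d'"
  shows "CAT0_space M d'"
proof -
  have g: "geodesic_path M d' x y c \<longleftrightarrow> geodesic_path M d x y c" if "x \<in> M" "y \<in> M" for x y c
  proof (cases "c ` {0..d x y} \<subseteq> M")
    case True
    then show ?thesis using that eq unfolding geodesic_path_def by (simp add: image_subset_iff)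
  qed (use that eq in \<open>simp add: geodesic_path_def\<close>)
  have m: "c s \<in> M" if "geodesic_path M d x y c" "s \<in> {0..d x y}" for x y c s
    using that by (auto simp: geodesic_path_def)
  have C: "d (c s) (c' t) \<le> dist p' q'"
    if "x \<in> M" "y \<in> M" "z \<in> M" "geodesic_path M d x y c" "geodesic_path M d x z c'"
      "dist x' y' = d x y" "dist y' z' = d y z" "dist x' z' = d x z" "s \<in> {0..d x y}" "t \<in> {0..d x z}"
      "p' \<in> closed_segment x' y'" "q' \<in> closed_segment x' z'" "dist x' p' = s" "dist x' q' = t"
    for x y z c c' s t and x' y' z' p' q' :: "real^2"
    using assms(1) that unfolding CAT0_space_def by blast
  show ?thesis
    unfolding CAT0_space_def
  proof (intro conjI ballI impI allI)
    show "\<exists>c. geodesic_path M d' x y c" if "x \<in> M" "y \<in> M" for x y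
      using assms(1) that g unfolding CAT0_space_def by blast
    fix x y z c c' s t and x' y' z' p' q' :: "real^2"
    assume X: "x \<in> M" "y \<in> M" "z \<in> M" and h: "geodesic_path M d' x y c" "geodesic_path M d' x z c'"
      "dist x' y' = d' x y" "dist y' z' = d' y z" "dist x' z' = d' x z" "s \<in> {0..d' x y}" "t \<in> {0..d' x z}"
      "p' \<in> closed_segment x' y'" "q' \<in> closed_segment x' z'" "dist x' p' = s" "dist x' q' = t"
    have "d (c s) (c' t) \<le> dist p' q'"
      using h g X eq by (intro C[OF X]) auto
    moreover have "c s \<in> M" "c' t \<in> M" using h(1,2,6,7) g X eq m by metis+
    ultimately show "d' (c s) (c' t) \<le> dist p' q'" using eq by simp
  qed (fact assms(3))
qed

section \<open>Products of cubical complexes\<close>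

definition fst_coords :: "nat \<Rightarrow> (nat \<Rightarrow> real) \<Rightarrow> nat \<Rightarrow> real" where
  "fst_coords m x = (\<lambda>i. if i < m then x i else 0)"

definition snd_coords :: "nat \<Rightarrow> (nat \<Rightarrow> real) \<Rightarrow> nat \<Rightarrow> real" where
  "snd_coords m x = (\<lambda>i. x (m + i))"

definition join_coords :: "nat \<Rightarrow> (nat \<Rightarrow> real) \<Rightarrow> (nat \<Rightarrow> real) \<Rightarrow> nat \<Rightarrow> real" where
  "join_coords m a b = (\<lambda>i. if i < m then a i else b (i - m))"

lemma join_split: "join_coords m (fst_coords m x) (snd_coords m x) = x"
  by (auto simp: join_coords_def fst_coords_def snd_coords_def)

lemma fst_join: "a \<in> euclidean_points m \<Longrightarrow> fst_coords m (join_coords m a b) = a"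
  by (auto simp: join_coords_def fst_coords_def euclidean_points_def)

lemma snd_join: "snd_coords m (join_coords m a b) = b"
  by (auto simp: join_coords_def snd_coords_def)

lemma unit_cube_split:
  "x \<in> unit_cube (m + n) \<longleftrightarrow> fst_coords m x \<in> unit_cube m \<and> snd_coords m x \<in> unit_cube n"
proof
  assume x: "x \<in> unit_cube (m + n)"
  then show "fst_coords m x \<in> unit_cube m \<and> snd_coords m x \<in> unit_cube n"
    by (auto simp: unit_cube_def euclidean_points_def fst_coords_def snd_coords_def)
next
  assume a: "fst_coords m x \<in> unit_cube m \<and> snd_coords m x \<in> unit_cube n"
  have 1: "0 \<le> x i \<and> x i \<le> 1" if "i < m" for i using a that by (auto simp: unit_cube_def fst_coords_def)
  have 2: "0 \<le> x i \<and> x i \<le> 1" if "m \<le> i" "i < m + n" for i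
  proof -
    have "0 \<le> snd_coords m x (i - m) \<and> snd_coords m x (i - m) \<le> 1" using a that by (simp add: unit_cube_def)
    then show ?thesis using that by (simp add: snd_coords_def)
  qed
  have 3: "x i = 0" if "m + n \<le> i" for i
  proof -
    have "snd_coords m x (i - m) = 0" using a that by (simp add: unit_cube_def euclidean_points_def)
    then show ?thesis using that by (simp add: snd_coords_def)
  qed
  have "0 \<le> x i \<and> x i \<le> 1" if "i < m + n" for i using 1[of i] 2[of i] that by (cases "i < m") auto
  then show "x \<in> unit_cube (m + n)" by (simp add: unit_cube_def euclidean_points_def 3)
qed

lemma unit_cube_euclidean: "x \<in> unit_cube n \<Longrightarrow> x \<in> euclidean_points n"
  by (simp add: unit_cube_def)

lemma euclidean_dist_split:
  "(euclidean_dist (m + n) x y)\<^sup>2 =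
   (euclidean_dist m (fst_coords m x) (fst_coords m y))\<^sup>2 + (euclidean_dist n (snd_coords m x) (snd_coords m y))\<^sup>2"
proof -
  have "(\<Sum>i<m + n. (x i - y i)\<^sup>2) = (\<Sum>i<m. (x i - y i)\<^sup>2) + (\<Sum>i<n. (x (m + i) - y (m + i))\<^sup>2)"
    using sum.atLeastLessThan_concat[of 0 m "m + n" "\<lambda>i. (x i - y i)\<^sup>2"]
      sum.shift_bounds_nat_ivl[of "\<lambda>i. (x i - y i)\<^sup>2" 0 m n]
    by (simp add: lessThan_atLeast0 add.commute)
  then show ?thesis by (simp add: euclidean_dist_sq fst_coords_def snd_coords_def)
qed

lemma cube_face_subset: "cube_face n F \<Longrightarrow> F \<subseteq> unit_cube n"
  by (auto simp: cube_face_def)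

lemma cube_face_self: "cube_face n (unit_cube n)"
  unfolding cube_face_def by (intro exI[of _ "{}"] exI[of _ "\<lambda>_. 0"]) auto

lemma cube_face_product:
  assumes "cube_face m F" "cube_face n G"
  shows "cube_face (m + n) {x. fst_coords m x \<in> F \<and> snd_coords m x \<in> G}"
proof -
  obtain I \<epsilon> where I: "I \<subseteq> {..<m}" "\<forall>i\<in>I. \<epsilon> i \<in> {0, 1}" "F = {x \<in> unit_cube m. \<forall>i\<in>I. x i = \<epsilon> i}"
    using assms(1) unfolding cube_face_def by blast
  obtain J \<eta> where J: "J \<subseteq> {..<n}" "\<forall>i\<in>J. \<eta> i \<in> {0, 1}" "G = {x \<in> unit_cube n. \<forall>i\<in>J. x i = \<eta> i}"
    using assms(2) unfolding cube_face_def by blast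
  let ?K = "I \<union> (+) m ` J" and ?e = "\<lambda>i. if i < m then \<epsilon> i else \<eta> (i - m)"
  have "fst_coords m x \<in> F \<and> snd_coords m x \<in> G \<longleftrightarrow> x \<in> unit_cube (m + n) \<and> (\<forall>i\<in>?K. x i = ?e i)" for x
  proof -
    have 1: "(\<forall>i\<in>I. fst_coords m x i = \<epsilon> i) \<longleftrightarrow> (\<forall>i\<in>I. x i = ?e i)"
      using I(1) by (intro ball_cong refl) (auto simp: fst_coords_def)
    have 2: "(\<forall>i\<in>J. snd_coords m x i = \<eta> i) \<longleftrightarrow> (\<forall>i\<in>(+) m ` J. x i = ?e i)"
      by (simp add: snd_coords_def)
    show ?thesis by (simp only: I(3) J(3) unit_cube_split mem_Collect_eq ball_Un 1 2) (simp only: conj_ac)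
  qed
  then have "{x. fst_coords m x \<in> F \<and> snd_coords m x \<in> G} = {x \<in> unit_cube (m + n). \<forall>i\<in>?K. x i = ?e i}" by blast
  moreover have "?K \<subseteq> {..<m + n}" using I J by auto
  moreover have "\<forall>i\<in>?K. ?e i \<in> {0, 1}" using I J by auto
  ultimately show ?thesis unfolding cube_face_def by (intro exI[of _ ?K] exI[of _ ?e] conjI)
qed

lemma product_complex_cubes:
  "cubes (product_complex K L) =
     {(m + n, \<lambda>x. (\<phi> (fst_coords m x), \<psi> (snd_coords m x))) | m \<phi> n \<psi>. (m, \<phi>) \<in> cubes K \<and> (n, \<psi>) \<in> cubes L}"
  by (simp add: product_complex_def fst_coords_def snd_coords_def)

lemma product_complex_points: "points (product_complex K L) = points K \<times> points L"
  by (simp add: product_complex_def)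

lemma cubical_complex_chart:
  assumes "cubical_complex K" "(m, \<phi>) \<in> cubes K"
  shows "\<phi> ` unit_cube m \<subseteq> points K" "inj_on \<phi> (unit_cube m)"
  using assms unfolding cubical_complex_def by blast+

lemma cubical_complex_meet:
  assumes "cubical_complex K" "(m, \<phi>) \<in> cubes K" "(n, \<psi>) \<in> cubes K" "\<phi> ` unit_cube m \<inter> \<psi> ` unit_cube n \<noteq> {}"
  obtains F F' h where "cube_face m F" "cube_face n F'" "cube_isometry m F n F' h"
    "\<And>x y. x \<in> unit_cube m \<Longrightarrow> y \<in> unit_cube n \<Longrightarrow> \<phi> x = \<psi> y \<longleftrightarrow> x \<in> F \<and> y = h x"
proof -
  have "\<forall>(m, \<phi>)\<in>cubes K. \<forall>(n, \<psi>)\<in>cubes K.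
        \<phi> ` unit_cube m \<inter> \<psi> ` unit_cube n \<noteq> {} \<longrightarrow>
        (\<exists>F F' h. cube_face m F \<and> cube_face n F' \<and> cube_isometry m F n F' h \<and>
           (\<forall>x\<in>unit_cube m. \<forall>y\<in>unit_cube n. \<phi> x = \<psi> y \<longleftrightarrow> x \<in> F \<and> y = h x))"
    using assms(1) unfolding cubical_complex_def by blast
  from this[rule_format, OF assms(2), unfolded split_conv, rule_format, OF assms(3), unfolded split_conv,
      rule_format, OF assms(4)]
  show thesis using that by blast
qed

lemma cube_isometry_product:
  assumes h: "cube_isometry m F m' F' h" and k: "cube_isometry n G n' G' k"
    and F: "F \<subseteq> unit_cube m" "F' \<subseteq> unit_cube m'"
  shows "cube_isometry (m + n) {x. fst_coords m x \<in> F \<and> snd_coords m x \<in> G}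
     (m' + n') {x. fst_coords m' x \<in> F' \<and> snd_coords m' x \<in> G'}
     (\<lambda>x. join_coords m' (h (fst_coords m x)) (k (snd_coords m x)))" (is "cube_isometry _ ?A _ ?B ?H")
proof -
  have hb: "bij_betw h F F'" and kb: "bij_betw k G G'" using h k by (auto simp: cube_isometry_def)
  have hF: "h a \<in> F'" "h a \<in> euclidean_points m'" if "a \<in> F" for a
    using hb that F unit_cube_euclidean by (auto simp: bij_betw_def)
  have kG: "k b \<in> G'" if "b \<in> G" for b using kb that by (auto simp: bij_betw_def)
  have fH: "fst_coords m' (?H x) = h (fst_coords m x)" "snd_coords m' (?H x) = k (snd_coords m x)"
    if "x \<in> ?A" for x using that hF by (simp_all add: fst_join snd_join)
  have "inj_on ?H ?A"
  proof (rule inj_onI)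
    fix x y assume xy: "x \<in> ?A" "y \<in> ?A" "?H x = ?H y"
    have "h (fst_coords m x) = h (fst_coords m y)"
      using arg_cong[OF xy(3), of "fst_coords m'"] unfolding fH(1)[OF xy(1)] fH(1)[OF xy(2)] .
    moreover have "k (snd_coords m x) = k (snd_coords m y)"
      using arg_cong[OF xy(3), of "snd_coords m'"] unfolding fH(2)[OF xy(1)] fH(2)[OF xy(2)] .
    ultimately have "fst_coords m x = fst_coords m y" "snd_coords m x = snd_coords m y"
      using xy hb kb unfolding bij_betw_def inj_on_def by blast+
    then show "x = y" using join_split by metis
  qed
  moreover have "?H ` ?A = ?B"
  proof
    show "?H ` ?A \<subseteq> ?B" using fH hF kG by fastforce
    show "?B \<subseteq> ?H ` ?A"
    proof
      fix y assume y: "y \<in> ?B"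
      obtain a where a: "a \<in> F" "h a = fst_coords m' y" using hb y by (force simp: bij_betw_def)
      obtain b where b: "b \<in> G" "k b = snd_coords m' y" using kb y by (force simp: bij_betw_def)
      have "fst_coords m (join_coords m a b) = a" "snd_coords m (join_coords m a b) = b"
        using a(1) F unit_cube_euclidean fst_join snd_join by blast+
      then have 1: "join_coords m a b \<in> ?A" "?H (join_coords m a b) = y" using a b join_split by simp_all
      show "y \<in> ?H ` ?A" using 1(2)[symmetric] 1(1) by (rule image_eqI)
    qed
  qed
  moreover have "euclidean_dist (m' + n') (?H x) (?H y) = euclidean_dist (m + n) x y"
    if xy: "x \<in> ?A" "y \<in> ?A" for x y
  proof -
    have "(euclidean_dist (m' + n') (?H x) (?H y))\<^sup>2 = (euclidean_dist (m + n) x y)\<^sup>2"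
      using xy h k unfolding euclidean_dist_split fH[OF xy(1)] fH[OF xy(2)] cube_isometry_def by simp
    then show ?thesis by (simp add: power2_eq_iff_nonneg euclidean_dist_nonneg)
  qed
  ultimately show ?thesis by (auto simp: cube_isometry_def bij_betw_def)
qed

lemma cubical_complexI:
  assumes "points K = (\<Union>(n, \<phi>)\<in>cubes K. \<phi> ` unit_cube n)"
    and "\<And>n \<phi>. (n, \<phi>) \<in> cubes K \<Longrightarrow> inj_on \<phi> (unit_cube n)"
    and "\<And>m \<phi> n \<psi>. (m, \<phi>) \<in> cubes K \<Longrightarrow> (n, \<psi>) \<in> cubes K \<Longrightarrow> \<phi> ` unit_cube m \<inter> \<psi> ` unit_cube n \<noteq> {} \<Longrightarrow>
        \<exists>F F' h. cube_face m F \<and> cube_face n F' \<and> cube_isometry m F n F' h \<and>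
           (\<forall>x\<in>unit_cube m. \<forall>y\<in>unit_cube n. \<phi> x = \<psi> y \<longleftrightarrow> x \<in> F \<and> y = h x)"
  shows "cubical_complex K"
  unfolding cubical_complex_def split_beta
proof (intro conjI ballI impI)
  show "points K = (\<Union>p\<in>cubes K. snd p ` unit_cube (fst p))" using assms(1) unfolding split_beta .
  show "inj_on (snd c) (unit_cube (fst c))" if "c \<in> cubes K" for c
    using assms(2)[of "fst c" "snd c"] that by simp
  show "\<exists>F F' h. cube_face (fst c) F \<and> cube_face (fst d) F' \<and> cube_isometry (fst c) F (fst d) F' h \<and>
           (\<forall>x\<in>unit_cube (fst c). \<forall>y\<in>unit_cube (fst d). snd c x = snd d y \<longleftrightarrow> x \<in> F \<and> y = h x)"
    if "c \<in> cubes K" "d \<in> cubes K" "snd c ` unit_cube (fst c) \<inter> snd d ` unit_cube (fst d) \<noteq> {}" for c d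
    using assms(3)[of "fst c" "snd c" "fst d" "snd d"] that by simp
qed

lemma chart_imageI:
  "(n, \<phi>) \<in> cubes K \<Longrightarrow> x \<in> unit_cube n \<Longrightarrow> \<phi> x \<in> (\<Union>(n, \<phi>)\<in>cubes K. \<phi> ` unit_cube n)"
  by force

lemma cubical_complex_points: "cubical_complex K \<Longrightarrow> points K = (\<Union>(n, \<phi>)\<in>cubes K. \<phi> ` unit_cube n)"
  by (simp add: cubical_complex_def)

text \<open>Two product cubes meet only if both pairs of factors meet, and then the common face and
  the gluing isometry are the products of those of the factors.\<close>

lemma cubical_complex_product:
  assumes K: "cubical_complex K" and L: "cubical_complex L"
  shows "cubical_complex (product_complex K L)"
proof (rule cubical_complexI)
  have pK: "points K = (\<Union>(n, \<phi>)\<in>cubes K. \<phi> ` unit_cube n)" and pL: "points L = (\<Union>(n, \<phi>)\<in>cubes L. \<phi> ` unit_cube n)"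
    using K L by (simp_all only: cubical_complex_points)
  show "points (product_complex K L) = (\<Union>(n, \<phi>)\<in>cubes (product_complex K L). \<phi> ` unit_cube n)"
  proof (intro equalityI subsetI)
    fix z assume "z \<in> points (product_complex K L)"
    then obtain p q where z: "z = (p, q)" "p \<in> points K" "q \<in> points L" by (auto simp: product_complex_points)
    obtain m \<phi> a where 1: "(m, \<phi>) \<in> cubes K" "a \<in> unit_cube m" "p = \<phi> a" using z pK by auto
    obtain n \<psi> b where 2: "(n, \<psi>) \<in> cubes L" "b \<in> unit_cube n" "q = \<psi> b" using z pL by auto
    let ?x = "join_coords m a b"
    have s: "fst_coords m ?x = a" "snd_coords m ?x = b" using 1 unit_cube_euclidean fst_join snd_join by blast+
    have "?x \<in> unit_cube (m + n)" using 1 2 s by (simp add: unit_cube_split)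
    moreover have "(m + n, \<lambda>x. (\<phi> (fst_coords m x), \<psi> (snd_coords m x))) \<in> cubes (product_complex K L)"
      unfolding product_complex_cubes using 1 2 by blast
    ultimately have "(\<lambda>x. (\<phi> (fst_coords m x), \<psi> (snd_coords m x))) ?x \<in> (\<Union>(n, \<phi>)\<in>cubes (product_complex K L). \<phi> ` unit_cube n)"
      by (intro chart_imageI)
    then show "z \<in> (\<Union>(n, \<phi>)\<in>cubes (product_complex K L). \<phi> ` unit_cube n)" using 1 2 s z by simp
  next
    fix z assume "z \<in> (\<Union>(n, \<phi>)\<in>cubes (product_complex K L). \<phi> ` unit_cube n)"
    then obtain m \<phi> n \<psi> x where "(m, \<phi>) \<in> cubes K" "(n, \<psi>) \<in> cubes L" "x \<in> unit_cube (m + n)"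
      "z = (\<phi> (fst_coords m x), \<psi> (snd_coords m x))" unfolding product_complex_cubes by blast
    then show "z \<in> points (product_complex K L)"
      using cubical_complex_chart(1)[OF K] cubical_complex_chart(1)[OF L] unfolding product_complex_points unit_cube_split
      by blast
  qed
next
  fix N \<Theta> assume "(N, \<Theta>) \<in> cubes (product_complex K L)"
  then obtain m \<phi> n \<psi> where c: "N = m + n" "\<Theta> = (\<lambda>x. (\<phi> (fst_coords m x), \<psi> (snd_coords m x)))"
    and 1: "(m, \<phi>) \<in> cubes K" "(n, \<psi>) \<in> cubes L" unfolding product_complex_cubes by blast
  have i: "inj_on \<phi> (unit_cube m)" "inj_on \<psi> (unit_cube n)"
    using cubical_complex_chart(2) K L 1 by blast+
  have "inj_on (\<lambda>x. (\<phi> (fst_coords m x), \<psi> (snd_coords m x))) (unit_cube (m + n))"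
  proof (rule inj_onI)
    fix x y assume "x \<in> unit_cube (m + n)" "y \<in> unit_cube (m + n)"
      "(\<phi> (fst_coords m x), \<psi> (snd_coords m x)) = (\<phi> (fst_coords m y), \<psi> (snd_coords m y))"
    then have "fst_coords m x = fst_coords m y" "snd_coords m x = snd_coords m y"
      using i unfolding unit_cube_split inj_on_def by blast+
    then show "x = y" using join_split by metis
  qed
  then show "inj_on \<Theta> (unit_cube N)" by (simp add: c)
next
  fix N \<Theta> N' \<Theta>' assume "(N, \<Theta>) \<in> cubes (product_complex K L)" "(N', \<Theta>') \<in> cubes (product_complex K L)"
    and ne0: "\<Theta> ` unit_cube N \<inter> \<Theta>' ` unit_cube N' \<noteq> {}"
  then obtain m \<phi> n \<psi> m' \<phi>' n' \<psi>' where c: "N = m + n" "\<Theta> = (\<lambda>x. (\<phi> (fst_coords m x), \<psi> (snd_coords m x)))"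
    "N' = m' + n'" "\<Theta>' = (\<lambda>x. (\<phi>' (fst_coords m' x), \<psi>' (snd_coords m' x)))"
    and 1: "(m, \<phi>) \<in> cubes K" "(n, \<psi>) \<in> cubes L" "(m', \<phi>') \<in> cubes K" "(n', \<psi>') \<in> cubes L"
    unfolding product_complex_cubes by blast
  let ?\<Phi> = "\<lambda>x. (\<phi> (fst_coords m x), \<psi> (snd_coords m x))" and ?\<Psi> = "\<lambda>x. (\<phi>' (fst_coords m' x), \<psi>' (snd_coords m' x))"
  have "\<exists>F F' h. cube_face (m + n) F \<and> cube_face (m' + n') F' \<and> cube_isometry (m + n) F (m' + n') F' h \<and>
           (\<forall>x\<in>unit_cube (m + n). \<forall>y\<in>unit_cube (m' + n'). ?\<Phi> x = ?\<Psi> y \<longleftrightarrow> x \<in> F \<and> y = h x)"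
    if ne: "?\<Phi> ` unit_cube (m + n) \<inter> ?\<Psi> ` unit_cube (m' + n') \<noteq> {}"
  proof -
    obtain x y where xy: "x \<in> unit_cube (m + n)" "y \<in> unit_cube (m' + n')" "?\<Phi> x = ?\<Psi> y" using ne by auto
    have n1: "\<phi> ` unit_cube m \<inter> \<phi>' ` unit_cube m' \<noteq> {}" "\<psi> ` unit_cube n \<inter> \<psi>' ` unit_cube n' \<noteq> {}"
      using xy unfolding unit_cube_split by blast+
    obtain F F' h where F: "cube_face m F" "cube_face m' F'" "cube_isometry m F m' F' h"
      and Fe: "\<And>x y. x \<in> unit_cube m \<Longrightarrow> y \<in> unit_cube m' \<Longrightarrow> \<phi> x = \<phi>' y \<longleftrightarrow> x \<in> F \<and> y = h x"
      using cubical_complex_meet[OF K 1(1,3) n1(1)] by blast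
    obtain G G' k where G: "cube_face n G" "cube_face n' G'" "cube_isometry n G n' G' k"
      and Ge: "\<And>x y. x \<in> unit_cube n \<Longrightarrow> y \<in> unit_cube n' \<Longrightarrow> \<psi> x = \<psi>' y \<longleftrightarrow> x \<in> G \<and> y = k x"
      using cubical_complex_meet[OF L 1(2,4) n1(2)] by blast
    let ?A = "{x. fst_coords m x \<in> F \<and> snd_coords m x \<in> G}" and ?B = "{x. fst_coords m' x \<in> F' \<and> snd_coords m' x \<in> G'}"
    let ?H = "\<lambda>x. join_coords m' (h (fst_coords m x)) (k (snd_coords m x))"
    have iso: "cube_isometry (m + n) ?A (m' + n') ?B ?H"
      using cube_isometry_product[OF F(3) G(3)] cube_face_subset F G by blast
    have hF: "h a \<in> euclidean_points m'" if "a \<in> F" for a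
      using F(3) that cube_face_subset[OF F(2)] unit_cube_euclidean unfolding cube_isometry_def bij_betw_def by blast
    have "?\<Phi> x = ?\<Psi> y \<longleftrightarrow> x \<in> ?A \<and> y = ?H x" if xy: "x \<in> unit_cube (m + n)" "y \<in> unit_cube (m' + n')" for x y
    proof -
      have "?\<Phi> x = ?\<Psi> y \<longleftrightarrow> x \<in> ?A \<and> fst_coords m' y = h (fst_coords m x) \<and> snd_coords m' y = k (snd_coords m x)"
        using xy Fe[of "fst_coords m x" "fst_coords m' y"] Ge[of "snd_coords m x" "snd_coords m' y"]
        unfolding unit_cube_split by auto
      also have "\<dots> \<longleftrightarrow> x \<in> ?A \<and> y = ?H x"
        using hF by (metis (mono_tags, lifting) fst_join join_split mem_Collect_eq snd_join)
      finally show ?thesis .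
    qed
    then show ?thesis using iso cube_face_product[OF F(1) G(1)] cube_face_product[OF F(2) G(2)] by blast
  qed
  then show "\<exists>F F' h. cube_face N F \<and> cube_face N' F' \<and> cube_isometry N F N' F' h \<and>
           (\<forall>x\<in>unit_cube N. \<forall>y\<in>unit_cube N'. \<Theta> x = \<Theta>' y \<longleftrightarrow> x \<in> F \<and> y = h x)"
    using ne0 unfolding c by blast
qed

section \<open>The cubulation of Euclidean space\<close>

lemma euclidean_cubes:
  "(m, \<phi>) \<in> cubes (euclidean_complex n) \<longleftrightarrow>
     m = n \<and> (\<exists>z :: nat \<Rightarrow> int. (\<forall>i\<ge>n. z i = 0) \<and> \<phi> = (\<lambda>x i. x i + of_int (z i)))"
  by (auto simp: euclidean_complex_def)

text \<open>If two translates of the unit cube meet, their positions differ by at most one in each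
  coordinate. The common face fixes just the coordinates in \<open>I\<close> where they differ, and
  the gluing map is the translation by the difference of the positions.\<close>

lemma cubical_complex_euclidean: "cubical_complex (euclidean_complex n)"
proof (rule cubical_complexI)
  show "points (euclidean_complex n) = (\<Union>(m, \<phi>)\<in>cubes (euclidean_complex n). \<phi> ` unit_cube m)"
  proof (intro equalityI subsetI)
    fix x assume "x \<in> points (euclidean_complex n)"
    then have x: "\<And>i. i \<ge> n \<Longrightarrow> x i = 0" by (simp add: euclidean_complex_def euclidean_points_def)
    let ?z = "\<lambda>i. \<lfloor>x i\<rfloor>" and ?y = "\<lambda>i. x i - of_int \<lfloor>x i\<rfloor>"
    have "(n, \<lambda>y i. y i + of_int (?z i)) \<in> cubes (euclidean_complex n)"
      unfolding euclidean_cubes using x by (intro conjI exI[of _ ?z]) auto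
    moreover have "0 \<le> x i - of_int \<lfloor>x i\<rfloor> \<and> x i - of_int \<lfloor>x i\<rfloor> \<le> 1" for i by linarith
    then have "?y \<in> unit_cube n" using x by (simp add: unit_cube_def euclidean_points_def)
    ultimately have "(\<lambda>y i. y i + of_int (?z i)) ?y \<in> (\<Union>(m, \<phi>)\<in>cubes (euclidean_complex n). \<phi> ` unit_cube m)"
      by (rule chart_imageI)
    then show "x \<in> (\<Union>(m, \<phi>)\<in>cubes (euclidean_complex n). \<phi> ` unit_cube m)" by simp
  next
    fix x assume "x \<in> (\<Union>(m, \<phi>)\<in>cubes (euclidean_complex n). \<phi> ` unit_cube m)"
    then show "x \<in> points (euclidean_complex n)"
      by (auto simp: euclidean_complex_def unit_cube_def euclidean_points_def)
  qed
  fix m \<phi> assume "(m, \<phi>) \<in> cubes (euclidean_complex n)"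
  then obtain z :: "nat \<Rightarrow> int" where z: "m = n" "\<forall>i\<ge>n. z i = 0" "\<phi> = (\<lambda>x i. x i + of_int (z i))" by (auto simp: euclidean_cubes)
  show "inj_on \<phi> (unit_cube m)"
  proof (rule inj_onI)
    fix x y assume "\<phi> x = \<phi> y"
    then have "x i = y i" for i using z(3) by (auto dest: fun_cong[of _ _ i])
    then show "x = y" by blast
  qed
  fix m' \<psi> assume "(m', \<psi>) \<in> cubes (euclidean_complex n)" and ne: "\<phi> ` unit_cube m \<inter> \<psi> ` unit_cube m' \<noteq> {}"
  then obtain w :: "nat \<Rightarrow> int" where w: "m' = n" "\<forall>i\<ge>n. w i = 0" "\<psi> = (\<lambda>x i. x i + of_int (w i))" by (auto simp: euclidean_cubes)
  define h where "h x = (\<lambda>i. x i + of_int (z i) - of_int (w i) :: real)" for x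
  define h' where "h' x = (\<lambda>i. x i + of_int (w i) - of_int (z i) :: real)" for x
  have eq: "\<phi> x = \<psi> y \<longleftrightarrow> y = h x" "\<phi> x = \<psi> y \<longleftrightarrow> x = h' y" for x y
    unfolding z(3) w(3) h_def h'_def fun_eq_iff by (auto simp: algebra_simps)
  obtain x0 where x0: "x0 \<in> unit_cube n" "h x0 \<in> unit_cube n" using ne eq(1) z w by auto
  define I where "I = {i. z i \<noteq> w i}"
  have I: "I \<subseteq> {..<n}"
  proof
    fix i assume "i \<in> I"
    then show "i \<in> {..<n}" using z(2) w(2) by (cases "i < n") (auto simp: I_def)
  qed
  have diff: "z i - w i = 1 \<or> z i - w i = - 1" if "i \<in> I" for i
  proof -
    have "i < n" using I that by auto
    then have b: "0 \<le> x0 i" "x0 i \<le> 1" "0 \<le> h x0 i" "h x0 i \<le> 1" using x0 by (auto simp: unit_cube_def)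
    then have "of_int (z i - w i) \<le> (1::real)" "- 1 \<le> (of_int (z i - w i) :: real)" by (auto simp: h_def)
    then have "z i - w i \<le> 1" "- 1 \<le> z i - w i" by linarith+
    moreover have "z i - w i \<noteq> 0" using that by (simp add: I_def)
    ultimately show ?thesis by linarith
  qed
  \<comment> \<open>If the first cube lies above the second in direction \<open>i\<close>, they
    share the bottom of the first, where the coordinate is \<open>0\<close>; otherwise they share
    its top.\<close>
  define \<epsilon> where "\<epsilon> i = (if z i - w i = 1 then 0 else 1 :: real)" for i
  have e: "0 \<le> a \<and> a \<le> 1 \<and> 0 \<le> a + of_int (z i) - of_int (w i) \<and> a + of_int (z i) - of_int (w i) \<le> 1 \<longleftrightarrow> a = \<epsilon> i"
    if "i \<in> I" for i and a :: real
    using diff[OF that]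
  proof
    assume d: "z i - w i = 1"
    then have "of_int (z i) - of_int (w i) = (1::real)" by linarith
    then show ?thesis using d by (auto simp: \<epsilon>_def)
  next
    assume d: "z i - w i = - 1"
    then have "of_int (z i) - of_int (w i) = (- 1::real)" by linarith
    then show ?thesis using d by (auto simp: \<epsilon>_def)
  qed
  define F where "F = {x \<in> unit_cube n. \<forall>i\<in>I. x i = \<epsilon> i}"
  define F' where "F' = {x \<in> unit_cube n. \<forall>i\<in>I. x i = 1 - \<epsilon> i}"
  have hF: "h x \<in> unit_cube n \<longleftrightarrow> x \<in> F" if x: "x \<in> unit_cube n" for x
  proof
    assume hx: "h x \<in> unit_cube n"
    have "x i = \<epsilon> i" if "i \<in> I" for i
    proof -
      have "i < n" using I that by auto
      then show ?thesis using e[OF that, of "x i"] x hx by (simp add: unit_cube_def h_def)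
    qed
    then show "x \<in> F" using x by (simp add: F_def)
  next
    assume xF: "x \<in> F"
    have "0 \<le> h x i \<and> h x i \<le> 1" if "i < n" for i
    proof (cases "i \<in> I")
      case True
      then show ?thesis using xF e[OF True, of "x i"] by (simp add: F_def h_def)
    next
      case False then show ?thesis using x that by (simp add: I_def h_def unit_cube_def)
    qed
    then show "h x \<in> unit_cube n" using x z(2) w(2) by (simp add: unit_cube_def euclidean_points_def h_def)
  qed
  have eps: "\<epsilon> i + of_int (z i) - of_int (w i) = 1 - \<epsilon> i" if "i \<in> I" for i
  proof -
    have "of_int (z i) - of_int (w i) = (1::real) \<and> z i - w i = 1 \<or> of_int (z i) - of_int (w i) = (- 1::real) \<and> z i - w i \<noteq> 1"
      using diff[OF that] by linarith
    then show ?thesis by (auto simp: \<epsilon>_def)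
  qed
  have hh: "h' (h x) = x" "h (h' x) = x" for x by (auto simp: h_def h'_def)
  have bij: "bij_betw h F F'"
  proof (rule bij_betw_byWitness[where f' = h'])
    show "h ` F \<subseteq> F'"
    proof
      fix y assume "y \<in> h ` F"
      then obtain x where x: "x \<in> F" "y = h x" by blast
      have "h x i = 1 - \<epsilon> i" if "i \<in> I" for i using x eps[OF that] that by (simp add: F_def h_def)
      then show "y \<in> F'" using x hF by (auto simp: F_def F'_def)
    qed
    show "h' ` F' \<subseteq> F"
    proof
      fix x assume "x \<in> h' ` F'"
      then obtain y where y: "y \<in> F'" "x = h' y" by blast
      have xi: "x i = \<epsilon> i" if "i \<in> I" for i using y eps[OF that] that by (simp add: F'_def h'_def)
      have "0 \<le> x i \<and> x i \<le> 1" if "i < n" for i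
      proof (cases "i \<in> I")
        case True then show ?thesis using xi by (simp add: \<epsilon>_def)
      next
        case False then show ?thesis using y that by (simp add: I_def h'_def F'_def unit_cube_def)
      qed
      then have "x \<in> unit_cube n" using y z(2) w(2) by (simp add: F'_def unit_cube_def euclidean_points_def h'_def)
      then show "x \<in> F" using xi by (simp add: F_def)
    qed
  qed (auto simp: hh)
  have "cube_isometry n F n F' h"
    unfolding cube_isometry_def using bij by (auto simp: h_def intro: euclidean_dist_cong)
  moreover have "cube_face n F"
    unfolding cube_face_def F_def using I
    by (intro exI[of _ I] exI[of _ \<epsilon>] conjI) (simp_all add: \<epsilon>_def)
  moreover have "cube_face n F'"
    unfolding cube_face_def F'_def using I
    by (intro exI[of _ I] exI[of _ "\<lambda>i. 1 - \<epsilon> i"] conjI) (simp_all add: \<epsilon>_def)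
  moreover have "\<forall>x\<in>unit_cube n. \<forall>y\<in>unit_cube n. \<phi> x = \<psi> y \<longleftrightarrow> x \<in> F \<and> y = h x"
  proof (intro ballI)
    fix x y assume "x \<in> unit_cube n" "y \<in> unit_cube n"
    then show "\<phi> x = \<psi> y \<longleftrightarrow> x \<in> F \<and> y = h x" unfolding eq(1) using hF[of x] by auto
  qed
  ultimately show "\<exists>F F' h. cube_face m F \<and> cube_face m' F' \<and> cube_isometry m F m' F' h \<and>
           (\<forall>x\<in>unit_cube m. \<forall>y\<in>unit_cube m'. \<phi> x = \<psi> y \<longleftrightarrow> x \<in> F \<and> y = h x)"
    unfolding z(1) w(1) by (intro exI[of _ F] exI[of _ F'] exI[of _ h] conjI)
qed

section \<open>Strings and the intrinsic distance\<close>

lemma cube_string_trans: "cube_string K p q l \<Longrightarrow> cube_string K q r l' \<Longrightarrow> cube_string K p r (l + l')"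
proof (induction rule: cube_string.induct)
  case (step m \<phi> x y q l)
  then show ?case using cube_string.step[OF step(1,2,3)] by (simp add: add.assoc)
qed simp

lemma cube_string_single:
  assumes "cubical_complex K" "(n, \<phi>) \<in> cubes K" "x \<in> unit_cube n" "y \<in> unit_cube n"
  shows "cube_string K (\<phi> x) (\<phi> y) (euclidean_dist n x y)"
proof -
  have "\<phi> y \<in> points K" using cubical_complex_chart(1)[OF assms(1,2)] assms(4) by blast
  then show ?thesis using cube_string.step[OF assms(2-4) cube_string.nil] by simp
qed

lemma cube_string_points:
  "cubical_complex K \<Longrightarrow> cube_string K p q l \<Longrightarrow> p \<in> points K \<and> q \<in> points K"
  by (rotate_tac, induction rule: cube_string.induct) (use cubical_complex_chart(1) in blast)+

lemma cube_string_lower_bound: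
  assumes K: "cubical_complex K" and M: "Metric_space (points K) d"
    and chart: "\<And>n \<phi> x y. (n, \<phi>) \<in> cubes K \<Longrightarrow> x \<in> unit_cube n \<Longrightarrow> y \<in> unit_cube n \<Longrightarrow> d (\<phi> x) (\<phi> y) \<le> euclidean_dist n x y"
    and s: "cube_string K p q l"
  shows "d p q \<le> l"
  using s
proof (induction rule: cube_string.induct)
  case (nil p) then show ?case using Metric_space.mdist_zero[OF M] by simp
next
  case (step n \<phi> x y q l)
  have pts: "\<phi> x \<in> points K" "\<phi> y \<in> points K" "q \<in> points K"
    using cubical_complex_chart(1)[OF K step(1)] step(2,3) cube_string_points[OF K step(4)] by blast+
  show ?case using Metric_space.triangle[OF M pts] chart[OF step(1-3)] step.IH by simp
qed

text \<open>A distance that the charts do not increase is a lower bound for the length of every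
  string, by the triangle inequality. If a string of exactly that length exists, the infimum is
  attained, so the intrinsic distance is \<open>d\<close> on the points of the complex.\<close>

lemma CAT0_cube_complexI:
  assumes K: "cubical_complex K" and st: "stewart_space (points K) d"
    and chart: "\<And>n \<phi> x y. (n, \<phi>) \<in> cubes K \<Longrightarrow> x \<in> unit_cube n \<Longrightarrow> y \<in> unit_cube n \<Longrightarrow> d (\<phi> x) (\<phi> y) \<le> euclidean_dist n x y"
    and string: "\<And>p q. p \<in> points K \<Longrightarrow> q \<in> points K \<Longrightarrow> cube_string K p q (d p q)"
    and geo: "\<And>x y. x \<in> points K \<Longrightarrow> y \<in> points K \<Longrightarrow> \<exists>c. geodesic_path (points K) d x y c"
  shows "CAT0_cube_complex K"
proof -
  have M: "Metric_space (points K) d" using st by (simp add: stewart_space_def)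
  interpret Metric_space "points K" d by (rule M)
  have eq: "intrinsic_dist K p q = d p q" if "p \<in> points K" "q \<in> points K" for p q
  proof -
    have "Inf {l. cube_string K p q l} = d p q"
    proof (rule cInf_eq_minimum)
      show "d p q \<in> {l. cube_string K p q l}" using string[OF that] by simp
      show "d p q \<le> l" if "l \<in> {l. cube_string K p q l}" for l
        by (rule cube_string_lower_bound[OF K M chart]) (use that in simp_all)
    qed
    then show ?thesis using string[OF that] by (auto simp: intrinsic_dist_def)
  qed
  have out: "intrinsic_dist K p q = 0" if "\<not> (p \<in> points K \<and> q \<in> points K)" for p q
    using that cube_string_points[OF K] by (auto simp: intrinsic_dist_def)
  have "Metric_space (points K) (intrinsic_dist K)"
  proof
    fix x y z
    show "0 \<le> intrinsic_dist K x y" using eq[of x y] out[of x y] by fastforce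
    show "intrinsic_dist K x y = intrinsic_dist K y x"
      using eq[of x y] eq[of y x] out[of x y] out[of y x] commute by metis
    show "intrinsic_dist K x y = 0 \<longleftrightarrow> x = y" if "x \<in> points K" "y \<in> points K" using eq[OF that] that by simp
    show "intrinsic_dist K x z \<le> intrinsic_dist K x y + intrinsic_dist K y z"
      if "x \<in> points K" "y \<in> points K" "z \<in> points K" using that eq triangle by simp
  qed
  then have "CAT0_space (points K) (intrinsic_dist K)"
    using CAT0_space_cong[OF CAT0_from_stewart[OF st geo] eq] by blast
  then show ?thesis using K string unfolding CAT0_cube_complex_def by blast
qed

section \<open>The product of a tree with Euclidean space\<close>

lemma unit_cube_0: "unit_cube 0 = {\<lambda>_. 0}"
  by (auto simp: unit_cube_def euclidean_points_def)

lemma unit_cube_1_eq: "x \<in> unit_cube 1 \<Longrightarrow> y \<in> unit_cube 1 \<Longrightarrow> x 0 = y 0 \<Longrightarrow> x = y"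
proof
  fix i assume "x \<in> unit_cube 1" "y \<in> unit_cube 1" "x 0 = y 0"
  then show "x i = y i" by (cases i) (auto simp: unit_cube_def euclidean_points_def)
qed

lemma unit_cube_1_range: "x \<in> unit_cube 1 \<Longrightarrow> 0 \<le> x 0 \<and> x 0 \<le> 1"
  by (auto simp: unit_cube_def)

lemma unit_cube_1I: "0 \<le> t \<Longrightarrow> t \<le> 1 \<Longrightarrow> (\<lambda>i. if i = 0 then t else 0) \<in> unit_cube 1"
  by (auto simp: unit_cube_def euclidean_points_def)

lemma euclidean_dist_0: "euclidean_dist 0 x y = 0"
  by (simp add: euclidean_dist_def)

lemma euclidean_dist_1: "euclidean_dist 1 x y = \<bar>x 0 - y 0\<bar>"
  by (simp add: euclidean_dist_def L2_set_def)

lemma cube_face_vertex: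
  assumes "x \<in> unit_cube n" "\<And>i. i < n \<Longrightarrow> x i = 0 \<or> x i = 1"
  shows "cube_face n {x}"
proof -
  have "{y \<in> unit_cube n. \<forall>i\<in>{..<n}. y i = x i} = {x}"
  proof -
    have "y = x" if "y \<in> unit_cube n" "\<forall>i\<in>{..<n}. y i = x i" for y
      using that assms(1) unfolding unit_cube_def euclidean_points_def
      by (intro ext) (metis (mono_tags, lifting) lessThan_iff mem_Collect_eq not_le)
    then show ?thesis using assms(1) by blast
  qed
  then show ?thesis unfolding cube_face_def using assms(2) by (intro exI[of _ "{..<n}"] exI[of _ x]) auto
qed

lemma meet_in_vertex:
  assumes "x0 \<in> unit_cube m" "\<And>i. i < m \<Longrightarrow> x0 i = 0 \<or> x0 i = 1"
    and "y0 \<in> unit_cube n" "\<And>i. i < n \<Longrightarrow> y0 i = 0 \<or> y0 i = 1"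
    and "\<And>x y. x \<in> unit_cube m \<Longrightarrow> y \<in> unit_cube n \<Longrightarrow> \<phi> x = \<psi> y \<longleftrightarrow> x = x0 \<and> y = y0"
  shows "\<exists>F F' h. cube_face m F \<and> cube_face n F' \<and> cube_isometry m F n F' h \<and>
           (\<forall>x\<in>unit_cube m. \<forall>y\<in>unit_cube n. \<phi> x = \<psi> y \<longleftrightarrow> x \<in> F \<and> y = h x)"
proof (rule exI[of _ "{x0}"], rule exI[of _ "{y0}"], rule exI[of _ "\<lambda>_. y0"], intro conjI)
  show "cube_face m {x0}" "cube_face n {y0}" using assms cube_face_vertex by blast+
  show "cube_isometry m {x0} n {y0} (\<lambda>_. y0)"
    by (simp add: cube_isometry_def bij_betw_def euclidean_dist_def L2_set_def)
qed (use assms(5) in simp)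

text \<open>For some time after \<open>s\<close> an affine function stays in one closed unit
  interval: the one above the floor of its value if it does not decrease, the one below the ceiling
  if it does. Enlarging the absolute slope by one keeps the divisor positive for a constant
  function.\<close>

lemma line_cell:
  fixes \<alpha> \<beta> s :: real
  shows "\<exists>z::int. \<exists>\<delta>>0. \<forall>t. s \<le> t \<and> t < s + \<delta> \<longrightarrow> z \<le> \<alpha> + t * \<beta> \<and> \<alpha> + t * \<beta> \<le> z + 1"
proof (cases "0 \<le> \<beta>")
  case True
  define z where "z = \<lfloor>\<alpha> + s * \<beta>\<rfloor>"
  define g where "g = of_int z + 1 - (\<alpha> + s * \<beta>)"
  have g: "g > 0" unfolding g_def z_def by linarith
  have "z \<le> \<alpha> + t * \<beta> \<and> \<alpha> + t * \<beta> \<le> z + 1" if t: "s \<le> t" "t < s + g / (\<beta> + 1)" for t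
  proof -
    have "(t - s) * \<beta> \<le> (t - s) * (\<beta> + 1)" using t True by (simp add: mult_left_mono)
    also have "\<dots> \<le> g" using t True by (simp add: field_simps)
    finally have "\<alpha> + t * \<beta> \<le> z + 1" by (simp add: g_def algebra_simps)
    moreover have "s * \<beta> \<le> t * \<beta>" using t True by (simp add: mult_right_mono)
    then have "z \<le> \<alpha> + t * \<beta>" unfolding z_def by linarith
    ultimately show ?thesis by simp
  qed
  then show ?thesis using g True by (intro exI[of _ z] exI[of _ "g / (\<beta> + 1)"]) simp
next
  case False
  define z where "z = \<lceil>\<alpha> + s * \<beta>\<rceil> - 1"
  define g where "g = (\<alpha> + s * \<beta>) - of_int z"
  have g: "g > 0" unfolding g_def z_def by linarith
  have "z \<le> \<alpha> + t * \<beta> \<and> \<alpha> + t * \<beta> \<le> z + 1" if t: "s \<le> t" "t < s + g / (1 - \<beta>)" for t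
  proof -
    have "(t - s) * (- \<beta>) \<le> (t - s) * (1 - \<beta>)" using t by (intro mult_left_mono) auto
    also have "\<dots> \<le> g" using t False by (simp add: field_simps)
    finally have "z \<le> \<alpha> + t * \<beta>" by (simp add: g_def algebra_simps)
    moreover have "t * \<beta> \<le> s * \<beta>" using t False by (simp add: mult_right_mono_neg)
    then have "\<alpha> + t * \<beta> \<le> z + 1" unfolding z_def by linarith
    ultimately show ?thesis by simp
  qed
  then show ?thesis using g False by (intro exI[of _ z] exI[of _ "g / (1 - \<beta>)"]) simp
qed

section \<open>Straight lines crossing the cubulation\<close>

definition line :: "(nat \<Rightarrow> real) \<Rightarrow> (nat \<Rightarrow> real) \<Rightarrow> real \<Rightarrow> nat \<Rightarrow> real" where
  "line u w t = (\<lambda>i. u i + t * (w i - u i))"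

lemma line_reverse: "line u w t = line w u (1 - t)"
  by (simp add: line_def algebra_simps)

lemma line_ends: "line u w 0 = u" "line u w 1 = w"
  by (simp_all add: line_def)

lemma line_dist: "euclidean_dist n (line u w s) (line u w t) = \<bar>s - t\<bar> * euclidean_dist n u w"
proof -
  have "euclidean_dist n (line u w s) (line u w t) = \<bar>t - s\<bar> * euclidean_dist n u w"
    by (rule euclidean_dist_scale) (simp add: line_def algebra_simps)
  then show ?thesis by (simp add: abs_minus_commute)
qed

lemma line_unit_cube: "a \<in> unit_cube m \<Longrightarrow> b \<in> unit_cube m \<Longrightarrow> 0 \<le> t \<Longrightarrow> t \<le> 1 \<Longrightarrow> line a b t \<in> unit_cube m"
proof -
  assume ab: "a \<in> unit_cube m" "b \<in> unit_cube m" and t: "0 \<le> t" "t \<le> 1"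
  have "0 \<le> a i + t * (b i - a i) \<and> a i + t * (b i - a i) \<le> 1" if "i < m" for i
  proof -
    have c: "0 \<le> a i" "a i \<le> 1" "0 \<le> b i" "b i \<le> 1" using ab that by (auto simp: unit_cube_def)
    have "a i + t * (b i - a i) = (1 - t) * a i + t * b i" by (simp add: algebra_simps)
    moreover have "(1 - t) * a i + t * b i \<le> 1" using c t by (intro convex_bound_le) auto
    moreover have "0 \<le> (1 - t) * a i + t * b i" using c t by simp
    ultimately show ?thesis by simp
  qed
  then show ?thesis using ab by (auto simp: unit_cube_def euclidean_points_def line_def)
qed

definition in_cell :: "nat \<Rightarrow> (nat \<Rightarrow> int) \<Rightarrow> (nat \<Rightarrow> real) \<Rightarrow> bool" where
  "in_cell n z x \<longleftrightarrow> (\<forall>i\<ge>n. z i = 0) \<and> (\<lambda>i. x i - of_int (z i)) \<in> unit_cube n"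

lemma line_in_cell:
  assumes "u \<in> euclidean_points n" "w \<in> euclidean_points n"
  shows "\<exists>z. \<exists>\<delta>>0. \<forall>t. s \<le> t \<and> t < s + \<delta> \<longrightarrow> in_cell n z (line u w t)"
proof -
  have "\<forall>i. \<exists>z::int. \<exists>\<delta>>0. \<forall>t. s \<le> t \<and> t < s + \<delta> \<longrightarrow> z \<le> line u w t i \<and> line u w t i \<le> z + 1"
    unfolding line_def using line_cell by blast
  then obtain z \<delta> where z: "\<And>i. \<delta> i > 0"
    "\<And>i t. s \<le> t \<Longrightarrow> t < s + \<delta> i \<Longrightarrow> of_int (z i) \<le> line u w t i \<and> line u w t i \<le> of_int (z i :: int) + (1::real)"
    by metis
  \<comment> \<open>The element \<open>1\<close> keeps the minimum meaningful for
    \<open>n = 0\<close>.\<close>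
  define d where "d = Min (insert 1 (\<delta> ` {..<n}))"
  have d: "d > 0" "\<And>i. i < n \<Longrightarrow> d \<le> \<delta> i" unfolding d_def using z(1) by auto
  define z' where "z' i = (if i < n then z i else 0)" for i
  have "in_cell n z' (line u w t)" if t: "s \<le> t" "t < s + d" for t
  proof -
    have "0 \<le> line u w t i - of_int (z' i) \<and> line u w t i - of_int (z' i) \<le> 1" if "i < n" for i
      using z(2)[OF t(1), of i] t(2) d(2)[OF that] that by (simp add: z'_def)
    then show ?thesis using assms by (simp add: in_cell_def unit_cube_def euclidean_points_def z'_def line_def)
  qed
  then show ?thesis using d(1) by blast
qed

context oriented_tree
begin

section \<open>The tree as a cubical complex\<close>

lemma graph_cubes:
  "(m, \<phi>) \<in> cubes (graph_complex Y Q) \<longleftrightarrow>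
     (m = 0 \<and> (\<exists>v\<in>Vert Y. \<phi> = (\<lambda>x. VPoint v))) \<or> (m = 1 \<and> (\<exists>e\<in>Q. \<phi> = edge_chart Y e))"
  by (auto simp: graph_complex_def)

lemma edge_chart_coord: "e \<in> Q \<Longrightarrow> x \<in> unit_cube 1 \<Longrightarrow> coord e (edge_chart Y e x) = x 0"
  using coord_cell[of e e x] unit_cube_1_range by simp

lemma edge_chart_coord_other: "e \<in> Q \<Longrightarrow> f \<in> Q \<Longrightarrow> e \<noteq> f \<Longrightarrow> x \<in> unit_cube 1 \<Longrightarrow> coord f (edge_chart Y e x) = side f (src Y e)"
  using coord_cell[of e f x] unit_cube_1_range by simp

lemma edge_chart_inj: "e \<in> Q \<Longrightarrow> inj_on (edge_chart Y e) (unit_cube 1)"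
  using edge_chart_coord unit_cube_1_eq by (metis inj_onI)

text \<open>This uses the tree: a loop would spoil injectivity of a chart, and parallel edges would
  meet in two vertices. At a common point of two different edges the coordinate of each is the side,
  \<open>0\<close> or \<open>1\<close>, on which the other lies, so they meet in a single
  vertex.\<close>

lemma cubical_complex_graph: "cubical_complex (graph_complex Y Q)"
proof (rule cubical_complexI)
  show "X = (\<Union>(n, \<phi>)\<in>cubes (graph_complex Y Q). \<phi> ` unit_cube n)"
  proof (intro equalityI subsetI)
    fix p assume "p \<in> X"
    then consider v where "v \<in> Vert Y" "p = VPoint v" | e t where "p = EPoint e t" "e \<in> Q" "0 < t" "t < 1"
      by (auto simp: points_iff)
    then show "p \<in> (\<Union>(n, \<phi>)\<in>cubes (graph_complex Y Q). \<phi> ` unit_cube n)"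
    proof cases
      case 1
      then have "(0, \<lambda>x. VPoint v) \<in> cubes (graph_complex Y Q)" by (auto simp: graph_cubes)
      moreover have "p \<in> (\<lambda>x. VPoint v) ` unit_cube 0" using 1 by (simp add: unit_cube_0)
      ultimately show ?thesis by blast
    next
      case 2
      let ?x = "\<lambda>i::nat. if i = 0 then t else 0"
      have "(1, edge_chart Y e) \<in> cubes (graph_complex Y Q)" using 2 graph_cubes by blast
      moreover have "p = edge_chart Y e ?x" using 2 by (simp add: edge_chart_def)
      moreover have "?x \<in> unit_cube 1" using 2 by (intro unit_cube_1I) auto
      ultimately show ?thesis by blast
    qed
  next
    fix p assume "p \<in> (\<Union>(n, \<phi>)\<in>cubes (graph_complex Y Q). \<phi> ` unit_cube n)"
    then obtain n \<phi> x where c: "(n, \<phi>) \<in> cubes (graph_complex Y Q)" "x \<in> unit_cube n" "p = \<phi> x" by blast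
    then show "p \<in> X" unfolding graph_cubes using edge_chart_X unit_cube_1_range by (auto simp: points_iff)
  qed
  fix m \<phi> assume c: "(m, \<phi>) \<in> cubes (graph_complex Y Q)"
  then show "inj_on \<phi> (unit_cube m)" unfolding graph_cubes using edge_chart_inj by (auto simp: unit_cube_0)
  fix n \<psi> assume d: "(n, \<psi>) \<in> cubes (graph_complex Y Q)" and ne: "\<phi> ` unit_cube m \<inter> \<psi> ` unit_cube n \<noteq> {}"
  obtain x0 y0 where xy: "x0 \<in> unit_cube m" "y0 \<in> unit_cube n" "\<phi> x0 = \<psi> y0" using ne by auto
  show "\<exists>F F' h. cube_face m F \<and> cube_face n F' \<and> cube_isometry m F n F' h \<and>
           (\<forall>x\<in>unit_cube m. \<forall>y\<in>unit_cube n. \<phi> x = \<psi> y \<longleftrightarrow> x \<in> F \<and> y = h x)"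
  proof (cases "\<exists>e\<in>Q. m = 1 \<and> n = 1 \<and> \<phi> = edge_chart Y e \<and> \<psi> = edge_chart Y e")
    case True
    then obtain e where e: "e \<in> Q" "m = 1" "n = 1" "\<phi> = edge_chart Y e" "\<psi> = edge_chart Y e" by blast
    have "\<forall>x\<in>unit_cube m. \<forall>y\<in>unit_cube n. \<phi> x = \<psi> y \<longleftrightarrow> x \<in> unit_cube m \<and> y = id x"
      using edge_chart_inj[OF e(1)] e unfolding inj_on_def by auto
    moreover have "cube_isometry m (unit_cube m) n (unit_cube n) id" using e by (simp add: cube_isometry_def)
    ultimately show ?thesis using cube_face_self by blast
  next
    case False
    show ?thesis
    proof (rule meet_in_vertex[OF xy(1) _ xy(2)])
      consider (vv) "m = 0" "n = 0" | (ve) v f where "m = 0" "n = 1" "f \<in> Q" "\<phi> = (\<lambda>_. VPoint v)" "\<psi> = edge_chart Y f"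
        | (ev) e w where "m = 1" "n = 0" "e \<in> Q" "\<phi> = edge_chart Y e" "\<psi> = (\<lambda>_. VPoint w)"
        | (ee) e f where "m = 1" "n = 1" "e \<in> Q" "f \<in> Q" "e \<noteq> f" "\<phi> = edge_chart Y e" "\<psi> = edge_chart Y f"
        using c d False unfolding graph_cubes by blast
      note cs = this
      have 1: "x 0 = side e w" if "e \<in> Q" "x \<in> unit_cube 1" "edge_chart Y e x = VPoint w" for e x w
        using edge_chart_coord[OF that(1,2)] that(3) by simp
      have 2: "x 0 = side e (src Y f)" if "e \<in> Q" "f \<in> Q" "e \<noteq> f" "x \<in> unit_cube 1" "y \<in> unit_cube 1"
        "edge_chart Y e x = edge_chart Y f y" for e f x y
        using edge_chart_coord[OF that(1,4)] edge_chart_coord_other[OF that(2,1) _ that(5)] that(3,6) by simp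
      show "x0 i = 0 \<or> x0 i = 1" if "i < m" for i
        using cs
      proof cases
        case (ev e w) then show ?thesis using 1[of e x0 w] xy side_01[of e w] that by simp
      next
        case (ee e f) then show ?thesis using 2[of e f x0 y0] xy side_01[of e "src Y f"] that by simp
      qed (use that in auto)
      show "y0 i = 0 \<or> y0 i = 1" if "i < n" for i
        using cs
      proof cases
        case (ve v f) then show ?thesis using 1[of f y0 v] xy side_01[of f v] that by simp
      next
        case (ee e f) then show ?thesis using 2[of f e y0 x0] xy side_01[of f "src Y e"] that by simp
      qed (use that in auto)
      show "\<phi> x = \<psi> y \<longleftrightarrow> x = x0 \<and> y = y0" if x: "x \<in> unit_cube m" and y: "y \<in> unit_cube n" for x y
      proof
        assume eq: "\<phi> x = \<psi> y"
        show "x = x0 \<and> y = y0"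
          using cs
        proof cases
          case vv then show ?thesis using x y xy by (simp add: unit_cube_0)
        next
          case (ve v f)
          have "y 0 = y0 0" using 1[of f y v] 1[of f y0 v] ve x y xy eq by simp
          then show ?thesis using ve x y xy unit_cube_1_eq by (simp add: unit_cube_0)
        next
          case (ev e w)
          have "x 0 = x0 0" using 1[of e x w] 1[of e x0 w] ev x y xy eq by simp
          then show ?thesis using ev x y xy unit_cube_1_eq by (simp add: unit_cube_0)
        next
          case (ee e f)
          have "x 0 = x0 0" using 2[of e f x y] 2[of e f x0 y0] ee x y xy eq by simp
          moreover have "y 0 = y0 0" using 2[of f e y x] 2[of f e y0 x0] ee x y xy eq by simp
          ultimately show ?thesis using ee x y xy unit_cube_1_eq by simp
        qed
      qed (use xy in simp)
    qed
  qed
qed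

lemma graph_chart_dist:
  assumes "(m, \<phi>) \<in> cubes (graph_complex Y Q)" "x \<in> unit_cube m" "y \<in> unit_cube m"
  shows "tdist (\<phi> x) (\<phi> y) = euclidean_dist m x y"
  using assms tdist_cell unit_cube_1_range[of x] unit_cube_1_range[of y] unfolding graph_cubes
  by (auto simp: tdist_self euclidean_dist_0 euclidean_dist_1 simp del: One_nat_def)

lemma tdist_geodesic:
  assumes "p \<in> X" "q \<in> X"
  shows "\<exists>c. geodesic_path X tdist p q c"
  using assms
proof (induction rule: geodesic_induct)
  case (refl p)
  then show ?case using geodesic_path_refl[OF tdist_metric] by blast
next
  case (cell e x y)
  let ?c = "\<lambda>r. edge_chart Y e (\<lambda>_. x 0 + r * sgn (y 0 - x 0))"
  have l: "tdist (edge_chart Y e x) (edge_chart Y e y) = \<bar>x 0 - y 0\<bar>" using tdist_cell cell(2-5) cell(1) by blast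
  have r: "0 \<le> x 0 + r * sgn (y 0 - x 0)" "x 0 + r * sgn (y 0 - x 0) \<le> 1" if "r \<in> {0..\<bar>x 0 - y 0\<bar>}" for r
    using that cell(2-5) by (auto simp: sgn_if)
  have "?c 0 = edge_chart Y e x" by (simp add: edge_chart_def)
  moreover have "x 0 + \<bar>x 0 - y 0\<bar> * sgn (y 0 - x 0) = y 0" by (auto simp: sgn_if)
  then have "?c \<bar>x 0 - y 0\<bar> = edge_chart Y e y" by (simp add: edge_chart_def)
  moreover have "?c r \<in> X" if "r \<in> {0..\<bar>x 0 - y 0\<bar>}" for r
    by (rule edge_chart_X[OF cell(1)]) (use r[OF that] in simp_all)
  moreover have "tdist (?c r) (?c s) = \<bar>r - s\<bar>" if "r \<in> {0..\<bar>x 0 - y 0\<bar>}" "s \<in> {0..\<bar>x 0 - y 0\<bar>}" for r s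
  proof -
    have "tdist (?c r) (?c s) = \<bar>(r - s) * sgn (y 0 - x 0)\<bar>"
      using tdist_cell[OF cell(1), of "\<lambda>_. x 0 + r * sgn (y 0 - x 0)" "\<lambda>_. x 0 + s * sgn (y 0 - x 0)"] r[OF that(1)] r[OF that(2)]
      by (simp add: algebra_simps)
    then show ?thesis using that by (cases "x 0 = y 0") (auto simp: abs_mult sgn_if)
  qed
  ultimately have "geodesic_path X tdist (edge_chart Y e x) (edge_chart Y e y) ?c"
    unfolding geodesic_path_def l by blast
  then show ?case by blast
next
  case (join p m q)
  show ?case using geodesic_path_join[OF tdist_metric join(1-3)] join(4-6) by blast
qed

lemma tdist_stewart_space: "stewart_space X tdist"
  unfolding stewart_space_def using tdist_metric tdist_stewart by auto

abbreviation "K n \<equiv> product_complex (graph_complex Y Q) (euclidean_complex n)"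
abbreviation "D n \<equiv> prod_dist tdist (euclidean_dist n)"

section \<open>Distance and strings in the product complex\<close>

lemma K_points: "points (K n) = X \<times> euclidean_points n"
  by (simp add: product_complex_points euclidean_complex_def)

lemma K_cubical: "cubical_complex (K n)"
  using cubical_complex_product cubical_complex_graph cubical_complex_euclidean by blast

lemma K_cubeE:
  assumes "(N, \<Phi>) \<in> cubes (K n)"
  obtains m \<phi> z where "(m, \<phi>) \<in> cubes (graph_complex Y Q)" "\<forall>i\<ge>n. z i = (0::int)" "N = m + n"
    "\<Phi> = (\<lambda>x. (\<phi> (fst_coords m x), \<lambda>i. snd_coords m x i + of_int (z i)))"
  using assms by (auto simp: product_complex_cubes euclidean_cubes)

lemma K_cubeI:
  assumes "(m, \<phi>) \<in> cubes (graph_complex Y Q)" "\<forall>i\<ge>n. z i = (0::int)"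
  shows "(m + n, \<lambda>x. (\<phi> (fst_coords m x), \<lambda>i. snd_coords m x i + of_int (z i))) \<in> cubes (K n)"
  unfolding product_complex_cubes using assms
  by (intro CollectI exI[of _ m] exI[of _ \<phi>] exI[of _ n] exI[of _ "\<lambda>x i. x i + of_int (z i)"]) (auto simp: euclidean_cubes)

lemma D_nonneg: "0 \<le> D n p q"
  by (simp add: prod_dist_def split: prod.split)

lemma K_chart_dist:
  assumes "(N, \<Phi>) \<in> cubes (K n)" "x \<in> unit_cube N" "y \<in> unit_cube N"
  shows "D n (\<Phi> x) (\<Phi> y) = euclidean_dist N x y"
proof -
  obtain m \<phi> z where c: "(m, \<phi>) \<in> cubes (graph_complex Y Q)" "N = m + n"
    "\<Phi> = (\<lambda>x. (\<phi> (fst_coords m x), \<lambda>i. snd_coords m x i + of_int (z i)))" using assms(1) by (rule K_cubeE)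
  have 1: "tdist (\<phi> (fst_coords m x)) (\<phi> (fst_coords m y)) = euclidean_dist m (fst_coords m x) (fst_coords m y)"
    using assms(2,3) c graph_chart_dist unit_cube_split by blast
  have 2: "euclidean_dist n (\<lambda>i. snd_coords m x i + of_int (z i)) (\<lambda>i. snd_coords m y i + of_int (z i)) =
      euclidean_dist n (snd_coords m x) (snd_coords m y)" by (rule euclidean_dist_cong) simp
  have "(D n (\<Phi> x) (\<Phi> y))\<^sup>2 = (euclidean_dist N x y)\<^sup>2"
    unfolding c(2,3) prod_dist_sq 1 2 euclidean_dist_split ..
  then show ?thesis using D_nonneg euclidean_dist_nonneg by (simp add: power2_eq_iff_nonneg)
qed

lemma string_in_cell:
  assumes c: "(m, \<phi>) \<in> cubes (graph_complex Y Q)" and ab: "a \<in> unit_cube m" "b \<in> unit_cube m"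
    and z: "in_cell n z (line u w s)" "in_cell n z (line u w t)" and st: "0 \<le> s" "s \<le> 1" "0 \<le> t" "t \<le> 1"
  shows "cube_string (K n) (\<phi> (line a b s), line u w s) (\<phi> (line a b t), line u w t)
     (\<bar>s - t\<bar> * sqrt ((euclidean_dist m a b)\<^sup>2 + (euclidean_dist n u w)\<^sup>2))"
proof -
  have z0: "\<forall>i\<ge>n. z i = 0" using z by (simp add: in_cell_def)
  let ?\<Phi> = "\<lambda>x. (\<phi> (fst_coords m x), \<lambda>i. snd_coords m x i + of_int (z i))"
  let ?j = "\<lambda>r. join_coords m (line a b r) (\<lambda>i. line u w r i - of_int (z i))"
  have l: "line a b s \<in> unit_cube m" "line a b t \<in> unit_cube m" using line_unit_cube ab st by blast+
  have f: "fst_coords m (?j s) = line a b s" "fst_coords m (?j t) = line a b t"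
    using l fst_join unit_cube_euclidean by blast+
  have cb: "(m + n, ?\<Phi>) \<in> cubes (K n)" using K_cubeI[OF c z0] .
  have x: "?j s \<in> unit_cube (m + n)" "?j t \<in> unit_cube (m + n)"
    unfolding unit_cube_split f snd_join using l z by (auto simp: in_cell_def)
  have "cube_string (K n) (?\<Phi> (?j s)) (?\<Phi> (?j t)) (euclidean_dist (m + n) (?j s) (?j t))"
    using cube_string_single[OF K_cubical cb x] .
  moreover have "euclidean_dist (m + n) (?j s) (?j t) = \<bar>s - t\<bar> * sqrt ((euclidean_dist m a b)\<^sup>2 + (euclidean_dist n u w)\<^sup>2)"
  proof -
    have e: "euclidean_dist n (\<lambda>i. line u w s i - of_int (z i)) (\<lambda>i. line u w t i - of_int (z i)) = \<bar>s - t\<bar> * euclidean_dist n u w"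
      unfolding line_dist[symmetric] by (rule euclidean_dist_cong) simp
    have "(euclidean_dist (m + n) (?j s) (?j t))\<^sup>2 = (\<bar>s - t\<bar> * sqrt ((euclidean_dist m a b)\<^sup>2 + (euclidean_dist n u w)\<^sup>2))\<^sup>2"
      unfolding euclidean_dist_split f snd_join e line_dist by (simp add: power_mult_distrib algebra_simps)
    then show ?thesis using euclidean_dist_nonneg by (simp add: power2_eq_iff_nonneg)
  qed
  ultimately show ?thesis unfolding f snd_join by simp
qed

text \<open>Above a single cell of the tree the straight segment must be cut into finitely many
  pieces, each inside a cube. Bisection does this without naming the cutting points: string lengths
  add up, and near every time \<open>x\<close> one cube contains the piece before \<open>x\<close>
  and one the piece after it.\<close>

lemma string_over_cell:
  assumes c: "(m, \<phi>) \<in> cubes (graph_complex Y Q)" and ab: "a \<in> unit_cube m" "b \<in> unit_cube m"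
    and uw: "u \<in> euclidean_points n" "w \<in> euclidean_points n"
  shows "cube_string (K n) (\<phi> a, u) (\<phi> b, w) (sqrt ((euclidean_dist m a b)\<^sup>2 + (euclidean_dist n u w)\<^sup>2))"
proof -
  let ?L = "sqrt ((euclidean_dist m a b)\<^sup>2 + (euclidean_dist n u w)\<^sup>2)"
  let ?g = "\<lambda>s. (\<phi> (line a b s), line u w s)"
  define R where "R s t \<longleftrightarrow> 0 \<le> s \<longrightarrow> t \<le> 1 \<longrightarrow> s \<le> t \<longrightarrow> cube_string (K n) (?g s) (?g t) ((t - s) * ?L)" for s t
  have "R 0 1"
  proof (rule Bolzano)
    fix r s t assume trans: "R r s" "R s t" "r \<le> s" "s \<le> t"
    show "R r t"
      unfolding R_def
    proof (intro impI)
      assume a: "0 \<le> r" "t \<le> 1" "r \<le> t"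
      have "cube_string (K n) (?g r) (?g s) ((s - r) * ?L)" "cube_string (K n) (?g s) (?g t) ((t - s) * ?L)"
        using trans a by (auto simp: R_def)
      then have "cube_string (K n) (?g r) (?g t) ((s - r) * ?L + (t - s) * ?L)" by (rule cube_string_trans)
      then show "cube_string (K n) (?g r) (?g t) ((t - r) * ?L)" by (simp add: algebra_simps)
    qed
  next
    fix x :: real assume loc: "0 \<le> x" "x \<le> 1"
    obtain z1 d1 where 1: "d1 > 0" "\<And>t. x \<le> t \<Longrightarrow> t < x + d1 \<Longrightarrow> in_cell n z1 (line u w t)"
      using line_in_cell[OF uw, of x] by blast
    \<comment> \<open>The cube just before time \<open>x\<close> is found by running the line
      backwards, since \<open>line_in_cell\<close> looks forward only.\<close>
    obtain z2 d2 where 2: "d2 > 0" "\<And>t. 1 - x \<le> t \<Longrightarrow> t < 1 - x + d2 \<Longrightarrow> in_cell n z2 (line w u t)"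
      using line_in_cell[OF uw(2,1), of "1 - x"] by blast
    have left: "in_cell n z2 (line u w t)" if "t \<le> x" "x - d2 < t" for t
      using 2(2)[of "1 - t"] that line_reverse[of u w t] by simp
    have "R s t" if "s \<le> x" "x \<le> t" "t - s < min d1 d2" for s t
      unfolding R_def
    proof (intro impI)
      assume a: "0 \<le> s" "t \<le> 1" "s \<le> t"
      have "cube_string (K n) (?g s) (?g x) (\<bar>s - x\<bar> * ?L)"
        using a that 2 loc by (intro string_in_cell[OF c ab, of n z2] left) auto
      moreover have "cube_string (K n) (?g x) (?g t) (\<bar>x - t\<bar> * ?L)"
        using a that 1(1) loc by (intro string_in_cell[OF c ab, of n z1] 1(2)) auto
      ultimately have "cube_string (K n) (?g s) (?g t) (\<bar>s - x\<bar> * ?L + \<bar>x - t\<bar> * ?L)" by (rule cube_string_trans)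
      moreover have "\<bar>s - x\<bar> * ?L + \<bar>x - t\<bar> * ?L = (t - s) * ?L" using that by (simp add: algebra_simps)
      ultimately show "cube_string (K n) (?g s) (?g t) ((t - s) * ?L)" by simp
    qed
    then show "\<exists>d>0. \<forall>a b. a \<le> x \<and> x \<le> b \<and> b - a < d \<longrightarrow> R a b"
      using 1(1) 2(1) by (intro exI[of _ "min d1 d2"]) auto
  qed simp
  then show ?thesis by (simp add: R_def line_ends)
qed

text \<open>Induction along a geodesic of the tree, for all Euclidean end points at once. Where the
  tree geodesic is divided, the Euclidean segment is divided in the same ratio, and for proportional
  parts the lengths in the \<open>\<ell>\<^sup>2\<close>-product add up.\<close>

lemma K_string:
  assumes "p \<in> X" "q \<in> X" "u \<in> euclidean_points n" "w \<in> euclidean_points n"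
  shows "cube_string (K n) (p, u) (q, w) (D n (p, u) (q, w))"
proof -
  have "\<forall>u\<in>euclidean_points n. \<forall>w\<in>euclidean_points n. cube_string (K n) (p, u) (q, w) (D n (p, u) (q, w))"
    using assms(1,2)
  proof (induction rule: geodesic_induct)
    case (refl p)
    have "X = (\<Union>(n, \<phi>)\<in>cubes (graph_complex Y Q). \<phi> ` unit_cube n)"
      using cubical_complex_graph unfolding cubical_complex_def by blast
    then obtain m \<phi> a where c: "(m, \<phi>) \<in> cubes (graph_complex Y Q)" "a \<in> unit_cube m" "p = \<phi> a" using refl by blast
    then show ?case using string_over_cell[OF c(1,2,2)] graph_chart_dist[OF c(1,2,2)] by (simp add: prod_dist_def)
  next
    case (cell e x y)
    let ?x = "\<lambda>i::nat. if i = 0 then x 0 else 0" and ?y = "\<lambda>i::nat. if i = 0 then y 0 else 0"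
    have c: "(1, edge_chart Y e) \<in> cubes (graph_complex Y Q)" using cell(1) graph_cubes by blast
    have i: "?x \<in> unit_cube 1" "?y \<in> unit_cube 1" using cell(2-5) by (auto intro!: unit_cube_1I simp del: One_nat_def)
    have "edge_chart Y e x = edge_chart Y e ?x" "edge_chart Y e y = edge_chart Y e ?y" by (simp_all add: edge_chart_def)
    then show ?case using string_over_cell[OF c i] graph_chart_dist[OF c i] by (simp add: prod_dist_def)
  next
    case (join p m q)
    let ?l1 = "tdist p m" and ?l2 = "tdist m q" and ?l = "tdist p q"
    show ?case
    proof (intro ballI)
      fix u w assume uw: "u \<in> euclidean_points n" "w \<in> euclidean_points n"
      \<comment> \<open>The ratio in which \<open>m\<close> divides the tree geodesic. If this
        geodesic has length zero, both of its parts do too, and the ratio \<open>0\<close>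
        fits.\<close>
      define s where "s = (if ?l = 0 then 0 else ?l1 / ?l)"
      have l: "?l1 + ?l2 = ?l" "0 \<le> ?l1" "0 \<le> ?l2" using join(4) tdist_nonneg by auto
      have s: "0 \<le> s" "s \<le> 1" "?l1 = s * ?l" "?l2 = (1 - s) * ?l"
        using l by (auto simp: s_def divide_le_eq_1 left_diff_distrib)
      have v: "line u w s \<in> euclidean_points n" using uw by (simp add: line_def euclidean_points_def)
      have d1: "euclidean_dist n u (line u w s) = s * euclidean_dist n u w"
        using line_dist[of n u w 0 s] s by (simp add: line_ends)
      have d2: "euclidean_dist n (line u w s) w = (1 - s) * euclidean_dist n u w"
        using line_dist[of n u w s 1] s by (simp add: line_ends)
      have sq: "sqrt ((c * A)\<^sup>2 + (c * B)\<^sup>2) = c * sqrt (A\<^sup>2 + B\<^sup>2)" if "0 \<le> c" for c A B :: real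
        using that by (simp add: power_mult_distrib real_sqrt_mult flip: distrib_left)
      have "cube_string (K n) (p, u) (q, w) (D n (p, u) (m, line u w s) + D n (m, line u w s) (q, w))"
        using join(5,6) uw v by (blast intro: cube_string_trans)
      moreover have "D n (p, u) (m, line u w s) + D n (m, line u w s) (q, w) = D n (p, u) (q, w)"
      proof -
        let ?Z = "sqrt (?l\<^sup>2 + (euclidean_dist n u w)\<^sup>2)"
        have "D n (p, u) (m, line u w s) = s * ?Z"
          unfolding prod_dist_def split_conv d1 s(3) using sq[OF s(1)] .
        moreover have "D n (m, line u w s) (q, w) = (1 - s) * ?Z"
          unfolding prod_dist_def split_conv d2 s(4) using s(2) by (intro sq) simp
        moreover have "D n (p, u) (q, w) = ?Z" by (simp add: prod_dist_def)
        ultimately show ?thesis by (simp add: left_diff_distrib)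
      qed
      ultimately show "cube_string (K n) (p, u) (q, w) (D n (p, u) (q, w))" by simp
    qed
  qed
  then show ?thesis using assms by blast
qed

theorem K_CAT0: "CAT0_cube_complex (K n)"
proof (rule CAT0_cube_complexI[where d = "D n"])
  show "cubical_complex (K n)" by (rule K_cubical)
  show "stewart_space (points (K n)) (D n)"
    unfolding K_points by (rule stewart_product[OF tdist_stewart_space euclidean_stewart])
  show "D n (\<phi> x) (\<phi> y) \<le> euclidean_dist N x y"
    if "(N, \<phi>) \<in> cubes (K n)" "x \<in> unit_cube N" "y \<in> unit_cube N" for N \<phi> x y
    using K_chart_dist that by simp
  show "cube_string (K n) p q (D n p q)" if "p \<in> points (K n)" "q \<in> points (K n)" for p q
    using that K_string unfolding K_points by (metis SigmaE)
  show "\<exists>c. geodesic_path (points (K n)) (D n) x y c" if "x \<in> points (K n)" "y \<in> points (K n)" for x y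
  proof -
    obtain p u q w where e: "x = (p, u)" "y = (q, w)" by (metis surj_pair)
    then have X: "p \<in> X" "q \<in> X" "u \<in> euclidean_points n" "w \<in> euclidean_points n" using that K_points by auto
    obtain c where c: "geodesic_path X tdist p q c" using tdist_geodesic X by blast
    obtain c' where c': "geodesic_path (euclidean_points n) (euclidean_dist n) u w c'" using euclidean_geodesic X by blast
    show ?thesis unfolding e K_points
      using geodesic_path_product[OF c c' tdist_nonneg euclidean_dist_nonneg] .
  qed
qed

lemma K_finite_dimensional: "finite_dimensional (K n)"
  unfolding finite_dimensional_def
proof (intro exI[of _ "1 + n"] ballI)
  fix c assume "c \<in> cubes (K n)"
  then obtain N \<Phi> where c: "c = (N, \<Phi>)" "(N, \<Phi>) \<in> cubes (K n)" by (cases c) auto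
  obtain m \<phi> where "(m, \<phi>) \<in> cubes (graph_complex Y Q)" "N = m + n" using c(2) by (rule K_cubeE)
  then show "case c of (N, \<phi>) \<Rightarrow> N \<le> 1 + n" unfolding c graph_cubes by auto
qed

end

section \<open>The action\<close>

text \<open>The elements of \<open>Bij E\<close> are extensional functions, hence the restriction to
  \<open>E\<close>.\<close>

lemma group_action_restrictI:
  assumes G: "group G"
    and closed: "\<And>g x. g \<in> carrier G \<Longrightarrow> x \<in> E \<Longrightarrow> f g x \<in> E"
    and mult: "\<And>g h x. g \<in> carrier G \<Longrightarrow> h \<in> carrier G \<Longrightarrow> x \<in> E \<Longrightarrow> f (g \<otimes>\<^bsub>G\<^esub> h) x = f g (f h x)"
    and one: "\<And>x. x \<in> E \<Longrightarrow> f \<one>\<^bsub>G\<^esub> x = x"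
  shows "group_action G E (\<lambda>g. restrict (f g) E)"
proof -
  interpret group G by fact
  have bij: "bij_betw (f g) E E" if g: "g \<in> carrier G" for g
  proof (rule bij_betw_byWitness[where f' = "f (inv\<^bsub>G\<^esub> g)"])
    show "\<forall>x\<in>E. f (inv\<^bsub>G\<^esub> g) (f g x) = x" "\<forall>x\<in>E. f g (f (inv\<^bsub>G\<^esub> g) x) = x"
      using g one by (simp_all flip: mult)
  qed (use g closed in auto)
  have Bij: "restrict (f g) E \<in> Bij E" if "g \<in> carrier G" for g
    using bij[OF that] by (simp add: Bij_def bij_betw_restrict_eq)
  have "(\<lambda>g. restrict (f g) E) \<in> hom G (BijGroup E)"
  proof (rule homI)
    show "restrict (f g) E \<in> carrier (BijGroup E)" if "g \<in> carrier G" for g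
      using Bij[OF that] by (simp add: BijGroup_def)
    show "restrict (f (g \<otimes>\<^bsub>G\<^esub> h)) E = restrict (f g) E \<otimes>\<^bsub>BijGroup E\<^esub> restrict (f h) E"
      if "g \<in> carrier G" "h \<in> carrier G" for g h
      using that Bij closed by (simp add: BijGroup_def compose_def mult cong: restrict_cong)
  qed
  then show ?thesis
    using G group_BijGroup by (simp add: group_action_def group_hom_def group_hom_axioms_def)
qed

lemma cubical_map_cong:
  assumes "cubical_complex K" "\<And>p. p \<in> points K \<Longrightarrow> f p = g p" "cubical_map K g"
  shows "cubical_map K f"
  unfolding cubical_map_def
proof (intro ballI)
  fix c assume c: "c \<in> cubes K"
  obtain m \<phi> where m: "c = (m, \<phi>)" by (cases c) auto
  have "\<exists>(n, \<psi>)\<in>cubes K. \<exists>F h. cube_face n F \<and> cube_isometry m (unit_cube m) n F h \<and>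
      (\<forall>x\<in>unit_cube m. g (\<phi> x) = \<psi> (h x))"
    using assms(3) c unfolding cubical_map_def m by blast
  moreover have "f (\<phi> x) = g (\<phi> x)" if "x \<in> unit_cube m" for x
    using assms(2) cubical_complex_chart(1)[OF assms(1)] c that unfolding m by blast
  ultimately show "case c of (m, \<phi>) \<Rightarrow> \<exists>(n, \<psi>)\<in>cubes K. \<exists>F h. cube_face n F \<and> cube_isometry m (unit_cube m) n F h \<and>
      (\<forall>x\<in>unit_cube m. f (\<phi> x) = \<psi> (h x))"
    unfolding m by simp
qed

text \<open>The case in which whole cubes go to whole cubes and the isometry is the identity. It
  suffices here, since tree translations preserve the orientation and Euclidean translations the
  parametrization.\<close>

lemma cubical_mapI:
  assumes "\<And>m \<phi>. (m, \<phi>) \<in> cubes K \<Longrightarrow> \<exists>\<psi>. (m, \<psi>) \<in> cubes K \<and> (\<forall>x\<in>unit_cube m. f (\<phi> x) = \<psi> x)"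
  shows "cubical_map K f"
  unfolding cubical_map_def
proof (intro ballI)
  fix c assume "c \<in> cubes K"
  then obtain m \<phi> \<psi> where m: "c = (m, \<phi>)" "(m, \<psi>) \<in> cubes K" "\<forall>x\<in>unit_cube m. f (\<phi> x) = \<psi> x"
    using assms by (metis surj_pair)
  have "cube_isometry m (unit_cube m) m (unit_cube m) id" by (simp add: cube_isometry_def)
  then have "cube_face m (unit_cube m) \<and> cube_isometry m (unit_cube m) m (unit_cube m) id \<and>
      (\<forall>x\<in>unit_cube m. f (\<phi> x) = \<psi> (id x))" using m(3) cube_face_self by simp
  then show "case c of (m, \<phi>) \<Rightarrow> \<exists>(n, \<psi>)\<in>cubes K. \<exists>F h. cube_face n F \<and> cube_isometry m (unit_cube m) n F h \<and>
      (\<forall>x\<in>unit_cube m. f (\<phi> x) = \<psi> (h x))"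
    unfolding m(1) using m(2) by blast
qed

context splitting
begin

text \<open>Both finiteness properties pass from the vertex group to its image in \<open>H\<close>.
  The cosets of the abelian subgroup are counted through chosen preimages \<open>r y\<close>, whose
  coset plays the part of the function \<open>f\<close> above.\<close>

lemma HV_detects:
  assumes VRC: "VRC H" and v: "v \<in> Vert \<Gamma>"
    and fg: "finitely_generated_group (vg v)" and va: "virtually_abelian (vg v)"
  shows "\<exists>K F. detects H (HV v) K F"
proof -
  interpret G: group "vg v" using v by (rule vgroup_group)
  interpret h: group_hom "vg v" H "vh v" using v by (rule vh_group_hom)
  obtain S where S: "finite S" "S \<subseteq> carrier (vg v)" "generate (vg v) S = carrier (vg v)"
    using fg unfolding finitely_generated_group_def by blast
  obtain A where A: "finite_index_subgroup A (vg v)" "comm_group ((vg v)\<lparr>carrier := A\<rparr>)"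
    using va unfolding virtually_abelian_def by blast
  have sA: "subgroup A (vg v)" using A(1) by (simp add: finite_index_subgroup_def)
  have gen: "generate H (vh v ` S) = HV v" using h.generate_img[OF S(2)] S(3) by (simp add: HV_eq)
  define r where "r y = inv_into (carrier (vg v)) (vh v) y" for y
  have r: "r y \<in> carrier (vg v)" "vh v (r y) = y" if "y \<in> HV v" for y
    using that unfolding r_def HV_eq by (simp_all add: inv_into_into f_inv_into_f)
  have "\<exists>K F. detects H (generate H (vh v ` S)) K F"
  proof (rule H.detects_fg_virtually_abelian[OF VRC, where A = "vh v ` A" and f = "\<lambda>y. A #>\<^bsub>vg v\<^esub> r y"])
    show "finite (vh v ` S)" "vh v ` S \<subseteq> carrier H" using S(1,2) by auto
    show "subgroup (vh v ` A) H" using h.subgroup_img_is_subgroup[OF sA] .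
    show "vh v ` A \<subseteq> generate H (vh v ` S)" unfolding gen HV_eq using subgroup.subset[OF sA] by blast
    have "(\<lambda>y. A #>\<^bsub>vg v\<^esub> r y) ` HV v \<subseteq> (\<lambda>x. A #>\<^bsub>vg v\<^esub> x) ` carrier (vg v)" using r by blast
    then show "finite ((\<lambda>y. A #>\<^bsub>vg v\<^esub> r y) ` generate H (vh v ` S))"
      unfolding gen using G.finite_index_cosets_finite[OF A(1)] finite_subset by blast
    show "x \<otimes>\<^bsub>H\<^esub> inv\<^bsub>H\<^esub> y \<in> vh v ` A"
      if "x \<in> generate H (vh v ` S)" "y \<in> generate H (vh v ` S)" "A #>\<^bsub>vg v\<^esub> r x = A #>\<^bsub>vg v\<^esub> r y" for x y
    proof -
      have xy: "x \<in> HV v" "y \<in> HV v" using that gen by auto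
      have "r x \<otimes>\<^bsub>vg v\<^esub> inv\<^bsub>vg v\<^esub> (r y) \<in> A" using G.rcos_eqD[OF sA r(1)[OF xy(1)] r(1)[OF xy(2)] that(3)] .
      moreover have "vh v (r x \<otimes>\<^bsub>vg v\<^esub> inv\<^bsub>vg v\<^esub> (r y)) = x \<otimes>\<^bsub>H\<^esub> inv\<^bsub>H\<^esub> y" using r xy by simp
      ultimately show ?thesis by (metis imageI)
    qed
    show "x \<otimes>\<^bsub>H\<^esub> y = y \<otimes>\<^bsub>H\<^esub> x" if xy: "x \<in> vh v ` A" "y \<in> vh v ` A" for x y
    proof -
      obtain a b where ab: "a \<in> A" "x = vh v a" "b \<in> A" "y = vh v b" using xy by blast
      interpret C: comm_group "(vg v)\<lparr>carrier := A\<rparr>" by (rule A(2))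
      have "a \<otimes>\<^bsub>vg v\<^esub> b = b \<otimes>\<^bsub>vg v\<^esub> a" using C.m_comm[of a b] ab by simp
      then show ?thesis using ab subgroup.mem_carrier[OF sA] by (metis h.hom_mult)
    qed
  qed
  then show ?thesis by (simp add: gen)
qed

sublocale BS: oriented_tree bs "bass_serre_pos \<GG> T P"
  by unfold_locales (rule bass_serre_tree_is_tree, rule bs_orientation)

lemma pos_iff: "x \<in> bass_serre_pos \<GG> T P \<longleftrightarrow> x \<in> Edge bs \<and> fst x \<in> P"
  by (simp add: bass_serre_pos_def bs_def)

section \<open>The action on the tree factor\<close>

fun tree_act :: "('v, 'e, 'g) fgen word set \<Rightarrow>
    ('v \<times> ('v, 'e, 'g) fgen word set set, 'e \<times> ('v, 'e, 'g) fgen word set set) graph_point \<Rightarrow>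
    ('v \<times> ('v, 'e, 'g) fgen word set set, 'e \<times> ('v, 'e, 'g) fgen word set set) graph_point" where
  "tree_act h (VPoint x) = VPoint (lt h x)"
| "tree_act h (EPoint x t) = EPoint (lt h x) t"

lemma tree_act_closed: "h \<in> carrier H \<Longrightarrow> p \<in> BS.X \<Longrightarrow> tree_act h p \<in> BS.X"
  by (cases p) (auto simp: BS.points_iff lt_Vert pos_iff lt_Edge, auto simp: lt_def)

lemma tree_act_mult:
  "h \<in> carrier H \<Longrightarrow> k \<in> carrier H \<Longrightarrow> p \<in> BS.X \<Longrightarrow> tree_act (h \<otimes>\<^bsub>H\<^esub> k) p = tree_act h (tree_act k p)"
  by (cases p) (auto simp: BS.points_iff lt_mult_vert lt_mult_edge pos_iff)

lemma tree_act_one: "p \<in> BS.X \<Longrightarrow> tree_act \<one>\<^bsub>H\<^esub> p = p"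
  by (cases p) (auto simp: BS.points_iff lt_one_vert lt_one_edge pos_iff)

lemma tree_act_cube:
  assumes "h \<in> carrier H" "(m, \<phi>) \<in> cubes (graph_complex bs (bass_serre_pos \<GG> T P))"
  shows "(m, \<lambda>x. tree_act h (\<phi> x)) \<in> cubes (graph_complex bs (bass_serre_pos \<GG> T P))"
proof -
  consider v where "m = 0" "v \<in> Vert bs" "\<phi> = (\<lambda>x. VPoint v)"
    | e where "m = 1" "e \<in> Edge bs" "fst e \<in> P" "\<phi> = edge_chart bs e"
    using assms(2) unfolding BS.graph_cubes by (auto simp: pos_iff)
  then show ?thesis
  proof cases
    case 1
    then have "(\<lambda>x. tree_act h (\<phi> x)) = (\<lambda>x. VPoint (lt h v))" by simp
    then show ?thesis unfolding BS.graph_cubes using 1(1) lt_Vert[OF 1(2) assms(1)] by blast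
  next
    case 2
    have "(\<lambda>x. tree_act h (edge_chart bs e x)) = edge_chart bs (lt h e)"
      using lt_src[OF 2(2) assms(1)] lt_tgt[OF 2(2) assms(1)] by (auto simp: edge_chart_def)
    moreover have "lt h e \<in> bass_serre_pos \<GG> T P"
      using lt_Edge[OF 2(2) assms(1)] 2(3) by (simp add: pos_iff) (simp add: lt_def)
    ultimately show ?thesis unfolding BS.graph_cubes using 2 by auto
  qed
qed

text \<open>Translations keep the parameter of a point inside an edge, so an element fixing such a
  point fixes the edge, and the stabilizer of an edge lies in that of its source.\<close>

lemma tree_act_fixed:
  assumes "h \<in> carrier H" "p \<in> BS.X" "tree_act h p = p"
  shows "\<exists>v\<in>Vert \<Gamma>. \<exists>g\<in>carrier H. inv\<^bsub>H\<^esub> g \<otimes>\<^bsub>H\<^esub> h \<otimes>\<^bsub>H\<^esub> g \<in> HV v"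
proof (cases p)
  case (VPoint x)
  then have "x \<in> Vert bs" "lt h x = x" using assms by (auto simp: BS.points_iff)
  then show ?thesis using lt_fix_vert assms(1) by (metis bs_VertE)
next
  case (EPoint x t)
  then have "x \<in> Edge bs" "lt h x = x" using assms by (auto simp: BS.points_iff pos_iff)
  then show ?thesis using lt_fix_edge assms(1) rv by (metis bs_EdgeE)
qed

text \<open>The characters in \<open>F\<close> are the coordinates of the homomorphism
  \<open>\<Psi>\<close>, and \<open>g\<close> acts by translation on the tree and by adding
  \<open>\<Psi> g\<close> on Euclidean space. A fixed point puts \<open>g\<close> into a conjugate
  of some \<open>HV v\<close> and makes all characters vanish at \<open>g\<close>, so
  \<open>g\<close> is trivial by the choice of \<open>N\<close> and \<open>F\<close>.\<close>

theorem free_action: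
  assumes VRC: "VRC H"
    and vgroups: "\<forall>v\<in>Vert \<Gamma>. finitely_generated_group (vg v) \<and> virtually_abelian (vg v)"
  shows "\<exists>N n \<phi>. N \<lhd> H \<and> finite (rcosets\<^bsub>H\<^esub> N) \<and> free_cubical_action (H\<lparr>carrier := N\<rparr>) (BS.K n) \<phi>"
proof -
  have "\<exists>N F. N \<lhd> H \<and> finite (rcosets\<^bsub>H\<^esub> N) \<and> finite F \<and>
    (\<forall>f\<in>F. \<forall>x\<in>N. \<forall>y\<in>N. f (x \<otimes>\<^bsub>H\<^esub> y) = (f x + f y :: int)) \<and>
    (\<forall>V\<in>HV ` Vert \<Gamma>. \<forall>g\<in>carrier H. \<forall>x\<in>N. inv\<^bsub>H\<^esub> g \<otimes>\<^bsub>H\<^esub> x \<otimes>\<^bsub>H\<^esub> g \<in> V \<longrightarrow> (\<forall>f\<in>F. f x = 0) \<longrightarrow> x = \<one>\<^bsub>H\<^esub>)"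
    using gog HV_detects[OF VRC] vgroups HV_sub
    by (intro H.detecting_normal_subgroup) (auto simp: finite_graph_of_groups_def)
  then obtain N F where N: "N \<lhd> H" "finite (rcosets\<^bsub>H\<^esub> N)" and F: "finite F"
    and add0: "\<forall>f\<in>F. \<forall>x\<in>N. \<forall>y\<in>N. f (x \<otimes>\<^bsub>H\<^esub> y) = (f x + f y :: int)"
    and free0: "\<forall>V\<in>HV ` Vert \<Gamma>. \<forall>g\<in>carrier H. \<forall>x\<in>N. inv\<^bsub>H\<^esub> g \<otimes>\<^bsub>H\<^esub> x \<otimes>\<^bsub>H\<^esub> g \<in> V \<longrightarrow>
      (\<forall>f\<in>F. f x = 0) \<longrightarrow> x = \<one>\<^bsub>H\<^esub>"
    by (elim exE conjE)
  have add: "f (x \<otimes>\<^bsub>H\<^esub> y) = f x + f y" if "f \<in> F" "x \<in> N" "y \<in> N" for f x y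
    using add0 that by blast
  have free: "x = \<one>\<^bsub>H\<^esub>" if "v \<in> Vert \<Gamma>" "g \<in> carrier H" "x \<in> N"
    "inv\<^bsub>H\<^esub> g \<otimes>\<^bsub>H\<^esub> x \<otimes>\<^bsub>H\<^esub> g \<in> HV v" "\<forall>f\<in>F. f x = 0" for v g x
    using free0[rule_format, OF imageI[OF that(1)] that(2,3,4)] that(5) by blast
  have sN: "subgroup N H" using N(1) normal_imp_subgroup by blast
  have Nc: "x \<in> carrier H" if "x \<in> N" for x using subgroup.mem_carrier[OF sN that] .
  define n where "n = card F"
  obtain b where b: "bij_betw b {0..<n} F" using ex_bij_betw_nat_finite[OF F] n_def by blast
  have bF: "b i \<in> F" if "i < n" for i using b that by (auto simp: bij_betw_def)
  \<comment> \<open>Zero from index \<open>n\<close> on, so that the translation preserves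
    \<open>euclidean_points n\<close> and the shifted cubes belong to the standard
    cubulation.\<close>
  define \<Psi> where "\<Psi> g i = (if i < n then b i g else 0)" for g and i :: nat
  have \<Psi>_mult: "\<Psi> (g \<otimes>\<^bsub>H\<^esub> h) i = \<Psi> g i + \<Psi> h i" if "g \<in> N" "h \<in> N" for g h i
    using add[OF bF that] by (simp add: \<Psi>_def)
  have \<Psi>_one: "\<Psi> \<one>\<^bsub>H\<^esub> i = 0" for i
    using \<Psi>_mult[of "\<one>\<^bsub>H\<^esub>" "\<one>\<^bsub>H\<^esub>" i] subgroup.one_closed[OF sN] by simp
  let ?K = "BS.K n"
  define f where "f g = (\<lambda>(p, x). (tree_act g p, \<lambda>i. x i + of_int (\<Psi> g i) :: real))" for g
  define \<phi> where "\<phi> g = restrict (f g) (points ?K)" for g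
  have gN: "group (H\<lparr>carrier := N\<rparr>)" using subgroup.subgroup_is_group[OF sN H_group] .
  have closed: "f g x \<in> points ?K" if "g \<in> N" "x \<in> points ?K" for g x
    using that tree_act_closed[OF Nc] unfolding BS.K_points f_def
    by (auto simp: euclidean_points_def \<Psi>_def)
  have mult: "f (g \<otimes>\<^bsub>H\<^esub> h) x = f g (f h x)" if "g \<in> N" "h \<in> N" "x \<in> points ?K" for g h x
    using that tree_act_mult[OF Nc Nc] unfolding BS.K_points f_def
    by (auto simp: \<Psi>_mult)
  have one: "f \<one>\<^bsub>H\<^esub> x = x" if "x \<in> points ?K" for x
    using that tree_act_one unfolding BS.K_points f_def by (auto simp: \<Psi>_one)
  have act: "group_action (H\<lparr>carrier := N\<rparr>) (points ?K) \<phi>"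
    unfolding \<phi>_def using group_action_restrictI[OF gN, of "points ?K" f] closed mult one by simp
  have map: "cubical_map ?K (f g)" if g: "g \<in> N" for g
  proof (rule cubical_mapI)
    fix M \<Phi> assume "(M, \<Phi>) \<in> cubes ?K"
    then obtain m \<theta> z where c: "(m, \<theta>) \<in> cubes (graph_complex bs (bass_serre_pos \<GG> T P))" "\<forall>i\<ge>n. z i = (0::int)"
      "M = m + n" "\<Phi> = (\<lambda>x. (\<theta> (fst_coords m x), \<lambda>i. snd_coords m x i + of_int (z i)))" by (rule BS.K_cubeE)
    have "(m + n, \<lambda>x. (tree_act g (\<theta> (fst_coords m x)), \<lambda>i. snd_coords m x i + of_int (z i + \<Psi> g i))) \<in> cubes ?K"
      using BS.K_cubeI[OF tree_act_cube[OF Nc[OF g] c(1)], of n "\<lambda>i. z i + \<Psi> g i"] c(2) by (simp add: \<Psi>_def)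
    then show "\<exists>\<psi>. (M, \<psi>) \<in> cubes ?K \<and> (\<forall>x\<in>unit_cube M. f g (\<Phi> x) = \<psi> x)"
      unfolding c(3,4) f_def by (intro exI conjI) (assumption, simp add: add.assoc)
  qed
  have inv: "inv\<^bsub>H\<^esub> g \<in> N" if "g \<in> N" for g using subgroup.m_inv_closed[OF sN that] .
  have aut: "cubical_automorphism ?K (\<phi> g)" if g: "g \<in> N" for g
  proof -
    have bij: "bij_betw (\<phi> g) (points ?K) (points ?K)"
      using group_action.bij_prop0[OF act, of g] g by (simp add: Bij_def)
    have "inv_into (points ?K) (\<phi> g) p = f (inv\<^bsub>H\<^esub> g) p" if p: "p \<in> points ?K" for p
    proof (rule inv_into_f_eq)
      show "inj_on (\<phi> g) (points ?K)" using bij by (simp add: bij_betw_def)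
      show "f (inv\<^bsub>H\<^esub> g) p \<in> points ?K" using closed inv g p by blast
      then show "\<phi> g (f (inv\<^bsub>H\<^esub> g) p) = p"
        using mult[OF g inv[OF g] p] one[OF p] Nc[OF g] by (simp add: \<phi>_def)
    qed
    then have "cubical_map ?K (inv_into (points ?K) (\<phi> g))"
      using cubical_map_cong[OF BS.K_cubical] map[OF inv[OF g]] by blast
    moreover have "cubical_map ?K (\<phi> g)"
      using cubical_map_cong[OF BS.K_cubical _ map[OF g], of "\<phi> g"] by (simp add: \<phi>_def)
    ultimately show ?thesis using bij by (simp add: cubical_automorphism_def)
  qed
  have "g = \<one>\<^bsub>H\<^esub>" if g: "g \<in> N" and p: "p \<in> points ?K" and fix_p: "\<phi> g p = p" for g p
  proof -
    obtain q x where q: "p = (q, x)" "q \<in> BS.X" using p unfolding BS.K_points by blast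
    have "f g (q, x) = (q, x)" using fix_p p q(1) by (simp add: \<phi>_def)
    then have "tree_act g q = q" and x: "(\<lambda>i. x i + of_int (\<Psi> g i)) = x" by (auto simp: f_def)
    then obtain v k where v: "v \<in> Vert \<Gamma>" "k \<in> carrier H" "inv\<^bsub>H\<^esub> k \<otimes>\<^bsub>H\<^esub> g \<otimes>\<^bsub>H\<^esub> k \<in> HV v"
      using tree_act_fixed[OF Nc[OF g] q(2)] by blast
    have "\<Psi> g i = 0" for i using fun_cong[OF x, of i] by simp
    then have "b i g = 0" if "i < n" for i using that unfolding \<Psi>_def by metis
    then have "\<forall>f\<in>F. f g = 0" using b by (force simp: bij_betw_def)
    then show ?thesis using free[OF v(1,2) g v(3)] by blast
  qed
  then have "free_cubical_action (H\<lparr>carrier := N\<rparr>) ?K \<phi>"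
    unfolding free_cubical_action_def using act aut by simp
  then show ?thesis using N by blast
qed

end

theorem lemmaA1:
  fixes \<GG> :: "('v, 'e, 'g, 'k) graph_of_groups"
    and T :: "('v, 'e) sgraph" and P :: "'e set"
    and H :: "('v, 'e, 'g) fgen word set monoid"
  assumes "finite_graph_of_groups \<GG>"
    and "maximal_tree T (graph \<GG>)"
    and "orientation (graph \<GG>) P"
    and "\<forall>v\<in>Vert (graph \<GG>). finitely_generated_group (vgroup \<GG> v) \<and> virtually_abelian (vgroup \<GG> v)"
    and "H = fundamental_group \<GG> T P"
    and "VRC H"
  shows "\<exists>G n K \<phi>. G \<lhd> H \<and> finite (rcosets\<^bsub>H\<^esub> G) \<and>
           K = product_complex (graph_complex (bass_serre_tree \<GG> T P) (bass_serre_pos \<GG> T P))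
                 (euclidean_complex n) \<and>
           finite_dimensional K \<and> CAT0_cube_complex K \<and>
           free_cubical_action (H\<lparr>carrier := G\<rparr>) K \<phi>"
proof -
  interpret splitting \<GG> T P using assms(1-3) by unfold_locales
  obtain N n \<phi> where "N \<lhd> H" "finite (rcosets\<^bsub>H\<^esub> N)" "free_cubical_action (H\<lparr>carrier := N\<rparr>) (BS.K n) \<phi>"
    using free_action assms(4-6) by blast
  then show ?thesis using BS.K_finite_dimensional[of n] BS.K_CAT0[of n] unfolding bs_def by blast
qed

end
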